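(* Suppose that the operator $\Theta:L^2(0,\infty)\to\ell^2$, $\Theta f=\bigl(\int_0^\infty e^{-\bar\lambda_js}f(s)\,ds\bigr)_{j=1}^\infty$, is bounded and that there exist constants $\delta,M>0$ such that $\Re\lambda_j\ge\delta$ and $\sum_{k=1}^\infty|\lambda_j+\lambda_k|^{-2}\le M$ for all $j$; let $\xi=(\xi_j)_{j=1}^\infty\in\ell^1$. (i) Then the symbol $\phi(x)=Ce^{-xA}B$ gives rise to a Hankel operator $\Gamma_\phi:L^2(0,\infty)\to L^2(0,\infty)$ which is trace class. (ii) The operator $$R_x=\int_x^\infty e^{-sA}BCe^{-sA}\,ds$$ on $\ell^2$ is trace class, and for $\mu$ in an open neighbourhood of zero, the kernel $T_\mu(x,y)=-\mu Ce^{-xA}(I+\mu R_x)^{-1}e^{-yA}B$ gives a solution to the integral equation $$T_\mu(x,y)+\mu\phi(x+y)+\mu\int_x^\infty T_\mu(x,z)\phi(z+y)\,dz=0\qquad(0<x\le y).$$ (iii) Suppose that $I-R_t$ is invertible for all $t>0$. Then the Hankel operator $\Gamma_{\phi_{(t)}}$ with kernel $\phi(x+y+2t)$ satisfies $$\det(I-\Gamma_{\phi_{(t)}})=\exp\Bigl(-\int_t^\infty T_{-1}(u,u)\,du\Bigr).$$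
   Context: $(\lambda_j)_{j=1}^\infty$ are complex numbers with $\Re\lambda_j>0$ such that the exponentials $(e^{-\lambda_jx})_{j=1}^\infty$ are linearly independent in $L^2(0,\infty)$. The operators are $$B:\mathbf C\to\ell^1\subset\ell^2,\ a\mapsto a\xi;\qquad e^{-tA}:\ell^2\to\ell^2,\ (\alpha_j)\mapsto(e^{-t\lambda_j}\alpha_j);\qquad C:\ell^1\subset\ell^2\to\mathbf C,\ (\alpha_j)\mapsto\sum_{j=1}^\infty\alpha_j,$$ so that $\phi(x)=\sum_{j=1}^\infty\xi_je^{-\lambda_jx}$. The operator $R_x$ has matrix $\bigl[\xi_je^{-(\lambda_j+\lambda_k)x}/(\lambda_j+\lambda_k)\bigr]_{j,k\ge1}$. The Hankel operator with symbol $\phi$ is $\Gamma_\phi h(x)=\int_0^\infty\phi(x+y)h(y)\,dy$. *)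

theory Defs
  imports "HOL-Analysis.Analysis"
begin

section \<open>Operators between complex \<open>L\<^sup>2\<close> spaces\<close>

text \<open>
  Elements of \<open>L\<^sup>2(M)\<close> are represented by functions, so identities between them are almost-everywhere
  identities. An operator is a map on representatives; linearity almost everywhere together with
  norm-boundedness makes it compatible with almost-everywhere equality.
  Both \<open>\<ell>\<^sup>2\<close> (counting measure) and \<open>L\<^sup>2(0,\<infinity>)\<close> are instances.
\<close>

definition L2 :: "'a measure \<Rightarrow> ('a \<Rightarrow> complex) set" where
  "L2 M = {f \<in> borel_measurable M. integrable M (\<lambda>x. (cmod (f x))\<^sup>2)}"

definition L2_norm :: "'a measure \<Rightarrow> ('a \<Rightarrow> complex) \<Rightarrow> real" where
  "L2_norm M f = sqrt (\<integral>x. (cmod (f x))\<^sup>2 \<partial>M)"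

definition L2_inner :: "'a measure \<Rightarrow> ('a \<Rightarrow> complex) \<Rightarrow> ('a \<Rightarrow> complex) \<Rightarrow> complex" where
  "L2_inner M f g = (\<integral>x. f x * cnj (g x) \<partial>M)"

definition bounded_operator ::
    "'a measure \<Rightarrow> 'b measure \<Rightarrow> (('a \<Rightarrow> complex) \<Rightarrow> 'b \<Rightarrow> complex) \<Rightarrow> bool" where
  "bounded_operator M N T \<longleftrightarrow>
     (\<forall>f\<in>L2 M. T f \<in> L2 N) \<and>
     (\<forall>f\<in>L2 M. \<forall>g\<in>L2 M. AE x in N. T (\<lambda>y. f y + g y) x = T f x + T g x) \<and>
     (\<forall>c. \<forall>f\<in>L2 M. AE x in N. T (\<lambda>y. c * f y) x = c * T f x) \<and>
     (\<exists>K. \<forall>f\<in>L2 M. L2_norm N (T f) \<le> K * L2_norm M f)"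

definition operator_norm ::
    "'a measure \<Rightarrow> 'b measure \<Rightarrow> (('a \<Rightarrow> complex) \<Rightarrow> 'b \<Rightarrow> complex) \<Rightarrow> real" where
  "operator_norm M N T = Inf {K. 0 \<le> K \<and> (\<forall>f\<in>L2 M. L2_norm N (T f) \<le> K * L2_norm M f)}"

definition rank_at_most ::
    "'a measure \<Rightarrow> 'b measure \<Rightarrow> nat \<Rightarrow> (('a \<Rightarrow> complex) \<Rightarrow> 'b \<Rightarrow> complex) \<Rightarrow> bool" where
  "rank_at_most M N n F \<longleftrightarrow>
     (\<exists>g. (\<forall>i<n. g i \<in> L2 N) \<and>
          (\<forall>f\<in>L2 M. \<exists>c. AE x in N. F f x = (\<Sum>i<n. c i * g i x)))"

definition inverse_operator ::
    "'a measure \<Rightarrow> (('a \<Rightarrow> complex) \<Rightarrow> 'a \<Rightarrow> complex) \<Rightarrow> (('a \<Rightarrow> complex) \<Rightarrow> 'a \<Rightarrow> complex) \<Rightarrow> bool" where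
  "inverse_operator M T S \<longleftrightarrow>
     bounded_operator M M S \<and>
     (\<forall>f\<in>L2 M. (AE x in M. T (S f) x = f x) \<and> (AE x in M. S (T f) x = f x))"

definition invertible_operator ::
    "'a measure \<Rightarrow> (('a \<Rightarrow> complex) \<Rightarrow> 'a \<Rightarrow> complex) \<Rightarrow> bool" where
  "invertible_operator M T \<longleftrightarrow> bounded_operator M M T \<and> (\<exists>S. inverse_operator M T S)"

text \<open>If an inverse exists, the choice only concerns null sets and arguments outside \<open>L\<^sup>2(M)\<close>.\<close>

definition operator_inv ::
    "'a measure \<Rightarrow> (('a \<Rightarrow> complex) \<Rightarrow> 'a \<Rightarrow> complex) \<Rightarrow> (('a \<Rightarrow> complex) \<Rightarrow> 'a \<Rightarrow> complex)" where
  "operator_inv M T = (SOME S. inverse_operator M T S)"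

subsection \<open>Trace class operators and Fredholm determinants\<close>

text \<open>
  The singular numbers of a bounded operator \<open>T\<close> are its distances, in operator norm, from the operators of
  rank at most \<open>n\<close>, for \<open>n = 0, 1, \<dots>\<close>, and \<open>T\<close> is trace class if they are summable.
\<close>

definition singular_number ::
    "'a measure \<Rightarrow> (('a \<Rightarrow> complex) \<Rightarrow> 'a \<Rightarrow> complex) \<Rightarrow> nat \<Rightarrow> real" where
  "singular_number M T n =
     Inf {operator_norm M M (\<lambda>f x. T f x - F f x) |F.
            bounded_operator M M F \<and> rank_at_most M M n F}"

definition trace_class ::
    "'a measure \<Rightarrow> (('a \<Rightarrow> complex) \<Rightarrow> 'a \<Rightarrow> complex) \<Rightarrow> bool" where
  "trace_class M T \<longleftrightarrow> bounded_operator M M T \<and> summable (singular_number M T)"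

definition orthonormal_basis :: "'a measure \<Rightarrow> (nat \<Rightarrow> 'a \<Rightarrow> complex) \<Rightarrow> bool" where
  "orthonormal_basis M e \<longleftrightarrow>
     (\<forall>n. e n \<in> L2 M) \<and>
     (\<forall>m n. L2_inner M (e m) (e n) = (if m = n then 1 else 0)) \<and>
     (\<forall>f\<in>L2 M. (\<forall>n. L2_inner M f (e n) = 0) \<longrightarrow> (AE x in M. f x = 0))"

text \<open>
  For \<open>S = {i\<^sub>1 < \<dots> < i\<^sub>k}\<close> this is the diagonal matrix entry of the exterior power \<open>\<Lambda>\<^sup>k T\<close> at the basis vector
  \<open>e\<^bsub>i\<^sub>1\<^esub> \<and> \<dots> \<and> e\<^bsub>i\<^sub>k\<^esub>\<close>, namely the determinant of \<open>\<langle>T e\<^sub>j, e\<^sub>i\<rangle>\<close> with \<open>i, j \<in> S\<close>.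
\<close>

definition exterior_diagonal ::
    "'a measure \<Rightarrow> (nat \<Rightarrow> 'a \<Rightarrow> complex) \<Rightarrow> (('a \<Rightarrow> complex) \<Rightarrow> 'a \<Rightarrow> complex) \<Rightarrow> nat set \<Rightarrow> complex" where
  "exterior_diagonal M e T S =
     (\<Sum>p | p permutes S. of_int (sign p) * (\<Prod>i\<in>S. L2_inner M (T (e (p i))) (e i)))"

text \<open>
  \<open>has_fredholm_det M T d\<close> expresses \<open>det (I + T) = \<Sum>k. tr (\<Lambda>\<^sup>k T) = d\<close> for a trace class operator \<open>T\<close> on a
  separable infinite-dimensional \<open>L\<^sup>2(M)\<close>: the traces of all exterior powers, computed in an arbitrary orthonormal
  basis, are collected into one unconditionally convergent sum over the finite sets of indices.
\<close>

definition has_fredholm_det ::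
    "'a measure \<Rightarrow> (('a \<Rightarrow> complex) \<Rightarrow> 'a \<Rightarrow> complex) \<Rightarrow> complex \<Rightarrow> bool" where
  "has_fredholm_det M T d \<longleftrightarrow>
     trace_class M T \<and>
     (\<forall>e. orthonormal_basis M e \<longrightarrow> (exterior_diagonal M e T has_sum d) {S. finite S})"

section \<open>The linear system\<close>

abbreviation half_line :: "real measure" where
  "half_line \<equiv> lebesgue_on {0<..}"

text \<open>Sequences are indexed from \<open>0\<close>.\<close>

abbreviation seq_measure :: "nat measure" where
  "seq_measure \<equiv> count_space UNIV"

definition ell1 :: "(nat \<Rightarrow> complex) set" where
  "ell1 = {\<alpha>. summable (\<lambda>j. cmod (\<alpha> j))}"

definition exponentials_independent :: "(nat \<Rightarrow> complex) \<Rightarrow> bool" where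
  "exponentials_independent l \<longleftrightarrow>
     (\<forall>J c. finite J \<longrightarrow>
        (AE x in half_line. (\<Sum>j\<in>J. c j * exp (- l j * of_real x)) = 0) \<longrightarrow> (\<forall>j\<in>J. c j = 0))"

definition B_op :: "(nat \<Rightarrow> complex) \<Rightarrow> complex \<Rightarrow> nat \<Rightarrow> complex" where
  "B_op \<xi> a = (\<lambda>j. a * \<xi> j)"

definition semigroup_op :: "(nat \<Rightarrow> complex) \<Rightarrow> real \<Rightarrow> (nat \<Rightarrow> complex) \<Rightarrow> nat \<Rightarrow> complex" where
  "semigroup_op l t \<alpha> = (\<lambda>j. exp (- of_real t * l j) * \<alpha> j)"

text \<open>The domain of the following functional is \<^const>\<open>ell1\<close>.\<close>

definition C_op :: "(nat \<Rightarrow> complex) \<Rightarrow> complex" where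
  "C_op \<alpha> = (\<Sum>j. \<alpha> j)"

definition Theta_op :: "(nat \<Rightarrow> complex) \<Rightarrow> (real \<Rightarrow> complex) \<Rightarrow> nat \<Rightarrow> complex" where
  "Theta_op l f = (\<lambda>j. \<integral>s. exp (- cnj (l j) * of_real s) * f s \<partial>half_line)"

definition symbol_phi :: "(nat \<Rightarrow> complex) \<Rightarrow> (nat \<Rightarrow> complex) \<Rightarrow> real \<Rightarrow> complex" where
  "symbol_phi l \<xi> x = C_op (semigroup_op l x (B_op \<xi> 1))"

definition hankel_op :: "(real \<Rightarrow> complex) \<Rightarrow> (real \<Rightarrow> complex) \<Rightarrow> real \<Rightarrow> complex" where
  "hankel_op \<phi> h = (\<lambda>x. \<integral>y. \<phi> (x + y) * h y \<partial>half_line)"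

text \<open>
  \<open>R\<^sub>x\<close> on all of \<open>\<ell>\<^sup>2\<close>, given by its matrix. The formula \<open>\<integral>\<^sub>x\<^sup>\<infinity> e\<^sup>-\<^sup>s\<^sup>A B C e\<^sup>-\<^sup>s\<^sup>A ds\<close> can be read literally only on the
  sequences \<open>\<alpha>\<close> with \<open>e\<^sup>-\<^sup>s\<^sup>A \<alpha> \<in> \<ell>\<^sup>1\<close>, because \<open>C\<close> is unbounded; for \<open>\<lambda>\<^sub>j = 1 + i j\<close> these form a proper dense
  subspace of \<open>\<ell>\<^sup>2\<close>.
\<close>

definition R_op ::
    "(nat \<Rightarrow> complex) \<Rightarrow> (nat \<Rightarrow> complex) \<Rightarrow> real \<Rightarrow> (nat \<Rightarrow> complex) \<Rightarrow> nat \<Rightarrow> complex" where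
  "R_op l \<xi> x \<alpha> = (\<lambda>j. \<Sum>k. \<xi> j * exp (- (l j + l k) * of_real x) / (l j + l k) * \<alpha> k)"

definition resolvent_vector ::
    "(nat \<Rightarrow> complex) \<Rightarrow> (nat \<Rightarrow> complex) \<Rightarrow> complex \<Rightarrow> real \<Rightarrow> real \<Rightarrow> nat \<Rightarrow> complex" where
  "resolvent_vector l \<xi> \<mu> x y =
     semigroup_op l x
       (operator_inv seq_measure (\<lambda>\<alpha> j. \<alpha> j + \<mu> * R_op l \<xi> x \<alpha> j)
         (semigroup_op l y (B_op \<xi> 1)))"

definition T_kernel ::
    "(nat \<Rightarrow> complex) \<Rightarrow> (nat \<Rightarrow> complex) \<Rightarrow> complex \<Rightarrow> real \<Rightarrow> real \<Rightarrow> complex" where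
  "T_kernel l \<xi> \<mu> x y = - \<mu> * C_op (resolvent_vector l \<xi> \<mu> x y)"

end

theory Submission
  imports Defs "Jordan_Normal_Form.Determinant"
begin

text \<open>
  Both \<open>\<Gamma>\<^sub>\<phi>\<close> and \<open>R\<^sub>x\<close> are nuclear series \<open>\<Sum>\<^sub>j a\<^sub>j \<langle>\<cdot>, h\<^sub>j\<rangle> g\<^sub>j\<close> with \<open>(a\<^sub>j)\<close> summable. A two-sided greedy choice of
  orthonormal vectors with \<open>s\<^sub>2\<^sub>n(T) \<le> 2 |\<langle>T f\<^sub>n, u\<^sub>n\<rangle>|\<close> and Bessel's inequality show that such operators are trace
  class. The exterior traces of a nuclear operator in any orthonormal basis are rearranged, by exchanging
  the two index sets, into the principal minors of \<open>(a\<^sub>j \<langle>g\<^sub>j, h\<^sub>k\<rangle>)\<close>; absolute convergence follows from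
  \<open>\<Sum>\<^sub>J |J|! \<Prod>\<^bsub>j\<in>J\<^esub> c\<^sub>j < \<infinity>\<close> for summable \<open>c \<ge> 0\<close>.

  For \<open>\<Gamma>\<^bsub>\<phi>(t)\<^esub>\<close> these are the principal minors of \<open>- R\<^sub>t\<close>, so the determinant is the limit of the finite
  determinants \<open>D\<^sub>n(t)\<close> of the truncations. Since \<open>R\<^sub>t' = - e\<^bsup>-tA\<^esup> B C e\<^bsup>-tA\<^esup>\<close> has rank one, \<open>D\<^sub>n' = D\<^sub>n \<tau>\<^sub>n\<close> with
  \<open>\<tau>\<^sub>n\<close> the truncated kernel on the diagonal, hence \<open>D\<^sub>n(t) = exp (- \<integral>\<^sub>t\<^sup>\<infinity> \<tau>\<^sub>n)\<close>, and \<open>\<tau>\<^sub>n\<close> converges dominatedly because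
  \<open>I - R\<^sub>u\<close> is bounded below uniformly in \<open>u \<ge> t\<close>.
\<close>

section \<open>The Hilbert space structure of \<open>L2\<close>\<close>

text \<open>The functional \<open>C\<close> is unbounded on l^2, so closeness of solutions in l^2 is
  not enough. What helps throughout is the factor \<open>\<xi> j\<close> in front of row
  \<open>j\<close> of R_u: with rows bounded in l^2, R_u maps l^2 into l^1, and a solution of (I -
  R_u) w = b with b in l^1 inherits a summable bound from w = b + R_u w. Truncation errors are
  governed in the same way by the tail of \<open>\<xi>\<close>, uniformly in u. Invertibility is
  given for each u separately. The uniform lower bound rests on the norm continuity of R_u (Hoelder
  exponent 1/2): two truncated exponentials differ only on a short interval. In the greedy
  inequality, the index 2n pays for compressing on both sides and the factor 2 for suprema that need
  not be attained. The factorial counts the permutations in a minor. It is harmless because the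
  products over k-element sets add up to at most (sum c)^k / k!, which leaves a geometric series
  once finitely many indices are set aside. A minor of the Hankel kernel carries e^(-2 l_j t) in row
  j, one of - R_t carries e^(-(l_j + l_k) t); they agree because a permutation only reorders the
  factors.\<close>

lemma L2_measurable: "f \<in> L2 M \<Longrightarrow> f \<in> borel_measurable M"
  by (simp add: L2_def)

lemma L2_integrable_square: "f \<in> L2 M \<Longrightarrow> integrable M (\<lambda>x. (cmod (f x))\<^sup>2)"
  by (simp add: L2_def)

lemma L2I:
  "f \<in> borel_measurable M \<Longrightarrow> integrable M (\<lambda>x. (cmod (f x))\<^sup>2) \<Longrightarrow> f \<in> L2 M"
  by (simp add: L2_def)

lemma L2_bound:
  assumes "f \<in> borel_measurable M" "integrable M g" "AE x in M. (cmod (f x))\<^sup>2 \<le> g x"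
  shows "f \<in> L2 M"
proof (rule L2I)
  show "integrable M (\<lambda>x. (cmod (f x))\<^sup>2)"
    by (rule Bochner_Integration.integrable_bound[OF assms(2)]) (use assms in auto)
qed fact

lemma borel_measurable_cnj [measurable (raw)]:
  "f \<in> borel_measurable M \<Longrightarrow> (\<lambda>x. cnj (f x)) \<in> borel_measurable M"
  by (erule measurable_compose, rule borel_measurable_continuous_onI) (intro continuous_intros)

lemma L2_cnj: "f \<in> L2 M \<Longrightarrow> (\<lambda>x. cnj (f x)) \<in> L2 M"
  by (auto simp: L2_def)

lemma L2_scale [intro]: "f \<in> L2 M \<Longrightarrow> (\<lambda>x. c * f x) \<in> L2 M"
  by (auto simp: L2_def norm_mult power_mult_distrib)

lemma L2_zero [intro, simp]: "(\<lambda>x. 0) \<in> L2 M"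
  by (simp add: L2_def)

lemma L2_uminus [intro]: "f \<in> L2 M \<Longrightarrow> (\<lambda>x. - f x) \<in> L2 M"
  by (auto simp: L2_def)

lemma norm_add_square_le: "(norm (a + b))\<^sup>2 \<le> 2 * (norm a)\<^sup>2 + 2 * (norm b)\<^sup>2"
proof -
  have "(norm (a + b))\<^sup>2 \<le> (norm a + norm b)\<^sup>2"
    by (intro power_mono norm_triangle_ineq) auto
  also have "\<dots> \<le> 2 * (norm a)\<^sup>2 + 2 * (norm b)\<^sup>2"
    using sum_squares_bound[of "norm a" "norm b"] by (simp add: power2_sum)
  finally show ?thesis .
qed

lemma L2_add [intro]:
  assumes "f \<in> L2 M" "g \<in> L2 M"
  shows "(\<lambda>x. f x + g x) \<in> L2 M"
proof (rule L2_bound)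
  show "(\<lambda>x. f x + g x) \<in> borel_measurable M"
    using assms[THEN L2_measurable] by measurable
  show "integrable M (\<lambda>x. 2 * (cmod (f x))\<^sup>2 + 2 * (cmod (g x))\<^sup>2)"
    using assms[THEN L2_integrable_square] by auto
qed (simp add: norm_add_square_le)

lemma L2_diff [intro]: "f \<in> L2 M \<Longrightarrow> g \<in> L2 M \<Longrightarrow> (\<lambda>x. f x - g x) \<in> L2 M"
  using L2_add[OF _ L2_uminus, of f M g] by simp

lemma L2_sum [intro]: "(\<And>i. i \<in> I \<Longrightarrow> f i \<in> L2 M) \<Longrightarrow> (\<lambda>x. \<Sum>i\<in>I. f i x) \<in> L2 M"
  by (induction I rule: infinite_finite_induct) auto

lemma L2_norm_nonneg [simp]: "0 \<le> L2_norm M f"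
  by (simp add: L2_norm_def)

lemma L2_norm_square: "(L2_norm M f)\<^sup>2 = (\<integral>x. (cmod (f x))\<^sup>2 \<partial>M)"
  by (simp add: L2_norm_def)

lemma L2_norm_zero [simp]: "L2_norm M (\<lambda>x. 0) = 0"
  by (simp add: L2_norm_def)

lemma L2_norm_scale: "L2_norm M (\<lambda>x. c * f x) = cmod c * L2_norm M f"
  by (simp add: L2_norm_def norm_mult power_mult_distrib real_sqrt_mult)

lemma L2_norm_uminus [simp]: "L2_norm M (\<lambda>x. - f x) = L2_norm M f"
  by (simp add: L2_norm_def)

lemma L2_norm_cnj [simp]: "L2_norm M (\<lambda>x. cnj (f x)) = L2_norm M f"
  by (simp add: L2_norm_def)

lemma L2_norm_minus_commute: "L2_norm M (\<lambda>x. f x - g x) = L2_norm M (\<lambda>x. g x - f x)"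
  by (simp add: L2_norm_def norm_minus_commute)

lemma L2_norm_cong_AE:
  assumes "f \<in> borel_measurable M" "g \<in> borel_measurable M" "AE x in M. f x = g x"
  shows "L2_norm M f = L2_norm M g"
  unfolding L2_norm_def
  by (rule arg_cong[of _ _ sqrt], rule integral_cong_AE) (use assms in auto)

lemma L2_norm_eq_0:
  assumes "f \<in> L2 M"
  shows "L2_norm M f = 0 \<longleftrightarrow> (AE x in M. f x = 0)"
proof -
  have "L2_norm M f = 0 \<longleftrightarrow> (\<integral>x. (cmod (f x))\<^sup>2 \<partial>M) = 0"
    by (simp add: L2_norm_def)
  also have "\<dots> \<longleftrightarrow> (AE x in M. (cmod (f x))\<^sup>2 = 0)"
    by (rule integral_nonneg_eq_0_iff_AE) (use assms L2_integrable_square in auto)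
  finally show ?thesis by simp
qed

lemma L2_norm_mono:
  assumes "g \<in> L2 M" "\<And>x. x \<in> space M \<Longrightarrow> cmod (f x) \<le> cmod (g x)"
  shows "L2_norm M f \<le> L2_norm M g"
  unfolding L2_norm_def
  by (intro real_sqrt_le_mono integral_mono_AE')
    (use assms L2_integrable_square[OF assms(1)] in \<open>auto intro!: power_mono\<close>)

lemma L2_mult_integrable:
  assumes "f \<in> L2 M" "g \<in> L2 M"
  shows "integrable M (\<lambda>x. f x * g x)"
proof (rule Bochner_Integration.integrable_bound)
  show "integrable M (\<lambda>x. (cmod (f x))\<^sup>2 + (cmod (g x))\<^sup>2)"
    using assms[THEN L2_integrable_square] by auto
  show "(\<lambda>x. f x * g x) \<in> borel_measurable M"
    using assms[THEN L2_measurable] by measurable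
  have "norm (f x * g x) \<le> norm ((cmod (f x))\<^sup>2 + (cmod (g x))\<^sup>2)" for x
    using sum_squares_bound[of "cmod (f x)" "cmod (g x)"]
      mult_nonneg_nonneg[of "cmod (f x)" "cmod (g x)", OF norm_ge_zero norm_ge_zero]
    unfolding norm_mult real_norm_def by linarith
  then show "AE x in M. norm (f x * g x) \<le> norm ((cmod (f x))\<^sup>2 + (cmod (g x))\<^sup>2)"
    by simp
qed

lemma L2_inner_integrable: "f \<in> L2 M \<Longrightarrow> g \<in> L2 M \<Longrightarrow> integrable M (\<lambda>x. f x * cnj (g x))"
  by (intro L2_mult_integrable L2_cnj)

text \<open>The moduli stay inside the integral because the termwise integration of the Hankel
  series needs a bound for the integral of |h| |E|, not only for an inner product.\<close>

lemma L2_Cauchy_Schwarz_abs: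
  assumes f: "f \<in> L2 M" and g: "g \<in> L2 M"
  shows "(\<integral>x. cmod (f x) * cmod (g x) \<partial>M) \<le> L2_norm M f * L2_norm M g"
proof -
  let ?I = "\<integral>x. cmod (f x) * cmod (g x) \<partial>M"
  have [measurable]: "f \<in> borel_measurable M" "g \<in> borel_measurable M"
    using assms L2_measurable by auto
  have int: "integrable M (\<lambda>x. cmod (f x) * cmod (g x))"
    using integrable_norm[OF L2_mult_integrable[OF f g]] by (simp add: norm_mult)
  have "ennreal (?I\<^sup>2) = (\<integral>\<^sup>+x. ennreal (cmod (f x)) * ennreal (cmod (g x)) \<partial>M)\<^sup>2"
    using nn_integral_eq_integral[OF int] by (simp add: ennreal_mult ennreal_power)
  also have "\<dots> \<le> (\<integral>\<^sup>+x. (ennreal (cmod (f x)))\<^sup>2 \<partial>M) * (\<integral>\<^sup>+x. (ennreal (cmod (g x)))\<^sup>2 \<partial>M)"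
    by (rule Cauchy_Schwarz_nn_integral) auto
  also have "\<dots> = ennreal ((L2_norm M f)\<^sup>2) * ennreal ((L2_norm M g)\<^sup>2)"
    using nn_integral_eq_integral[OF L2_integrable_square[OF f]]
      nn_integral_eq_integral[OF L2_integrable_square[OF g]]
    by (simp add: L2_norm_square ennreal_power)
  also have "\<dots> = ennreal ((L2_norm M f * L2_norm M g)\<^sup>2)"
    by (simp add: ennreal_mult power_mult_distrib)
  finally have "?I\<^sup>2 \<le> (L2_norm M f * L2_norm M g)\<^sup>2"
    by (simp add: ennreal_le_iff)
  then show ?thesis
    by (rule power2_le_imp_le) simp
qed

lemma L2_Cauchy_Schwarz:
  assumes f: "f \<in> L2 M" and g: "g \<in> L2 M"
  shows "cmod (L2_inner M f g) \<le> L2_norm M f * L2_norm M g"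
proof -
  have "cmod (L2_inner M f g) \<le> (\<integral>x. cmod (f x * cnj (g x)) \<partial>M)"
    unfolding L2_inner_def by (rule integral_norm_bound)
  then show ?thesis
    using L2_Cauchy_Schwarz_abs[OF assms] by (simp add: norm_mult)
qed

lemma L2_inner_commute: "L2_inner M f g = cnj (L2_inner M g f)"
proof -
  have "cnj (L2_inner M g f) = (\<integral>x. cnj (g x * cnj (f x)) \<partial>M)"
    unfolding L2_inner_def by (simp only: Bochner_Integration.integral_cnj)
  then show ?thesis by (simp add: L2_inner_def mult.commute)
qed

lemma L2_inner_add_left:
  "f \<in> L2 M \<Longrightarrow> g \<in> L2 M \<Longrightarrow> h \<in> L2 M \<Longrightarrow>
    L2_inner M (\<lambda>x. f x + g x) h = L2_inner M f h + L2_inner M g h"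
  unfolding L2_inner_def distrib_right
  by (intro Bochner_Integration.integral_add L2_inner_integrable)

lemma L2_inner_scale_left: "L2_inner M (\<lambda>x. c * f x) h = c * L2_inner M f h"
  unfolding L2_inner_def by (simp add: mult.assoc)

lemma L2_inner_diff_left:
  "f \<in> L2 M \<Longrightarrow> g \<in> L2 M \<Longrightarrow> h \<in> L2 M \<Longrightarrow>
    L2_inner M (\<lambda>x. f x - g x) h = L2_inner M f h - L2_inner M g h"
  unfolding L2_inner_def left_diff_distrib
  by (intro Bochner_Integration.integral_diff L2_inner_integrable)

lemma L2_inner_zero_left [simp]: "L2_inner M (\<lambda>x. 0) h = 0"
  by (simp add: L2_inner_def)

lemma L2_inner_zero_right [simp]: "L2_inner M h (\<lambda>x. 0) = 0"
  by (simp add: L2_inner_def)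

lemma L2_inner_sum_left:
  "(\<And>i. i \<in> I \<Longrightarrow> f i \<in> L2 M) \<Longrightarrow> h \<in> L2 M \<Longrightarrow>
    L2_inner M (\<lambda>x. \<Sum>i\<in>I. f i x) h = (\<Sum>i\<in>I. L2_inner M (f i) h)"
  by (induction I rule: infinite_finite_induct) (auto simp: L2_inner_add_left L2_sum)

lemma L2_inner_add_right:
  "f \<in> L2 M \<Longrightarrow> g \<in> L2 M \<Longrightarrow> h \<in> L2 M \<Longrightarrow>
    L2_inner M h (\<lambda>x. f x + g x) = L2_inner M h f + L2_inner M h g"
  by (subst (1 2 3) L2_inner_commute) (simp add: L2_inner_add_left)

lemma L2_inner_scale_right: "L2_inner M h (\<lambda>x. c * f x) = cnj c * L2_inner M h f"
  by (subst (1 2) L2_inner_commute) (simp add: L2_inner_scale_left)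

lemma L2_inner_diff_right:
  "f \<in> L2 M \<Longrightarrow> g \<in> L2 M \<Longrightarrow> h \<in> L2 M \<Longrightarrow>
    L2_inner M h (\<lambda>x. f x - g x) = L2_inner M h f - L2_inner M h g"
  by (subst (1 2 3) L2_inner_commute) (simp add: L2_inner_diff_left)

lemma L2_inner_sum_right:
  "(\<And>i. i \<in> I \<Longrightarrow> f i \<in> L2 M) \<Longrightarrow> h \<in> L2 M \<Longrightarrow>
    L2_inner M h (\<lambda>x. \<Sum>i\<in>I. f i x) = (\<Sum>i\<in>I. L2_inner M h (f i))"
  by (induction I rule: infinite_finite_induct) (auto simp: L2_inner_add_right L2_sum)

lemma L2_inner_self: "L2_inner M f f = of_real ((L2_norm M f)\<^sup>2)"
proof -
  have "L2_inner M f f = (\<integral>x. of_real ((cmod (f x))\<^sup>2) \<partial>M)"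
    unfolding L2_inner_def by (simp only: complex_norm_square)
  also have "\<dots> = of_real (\<integral>x. (cmod (f x))\<^sup>2 \<partial>M)"
    by (rule integral_complex_of_real)
  finally show ?thesis
    by (simp add: L2_norm_square)
qed

lemma L2_inner_cong_AE:
  assumes "f \<in> borel_measurable M" "f' \<in> borel_measurable M" "g \<in> borel_measurable M"
    and "AE x in M. f x = f' x"
  shows "L2_inner M f g = L2_inner M f' g"
  unfolding L2_inner_def
  by (rule integral_cong_AE) (use assms in auto)

lemma L2_norm_add_square:
  assumes "f \<in> L2 M" "g \<in> L2 M"
  shows "(L2_norm M (\<lambda>x. f x + g x))\<^sup>2 =
    (L2_norm M f)\<^sup>2 + (L2_norm M g)\<^sup>2 + 2 * Re (L2_inner M f g)"
proof -
  have "of_real ((L2_norm M (\<lambda>x. f x + g x))\<^sup>2) = L2_inner M (\<lambda>x. f x + g x) (\<lambda>x. f x + g x)"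
    by (simp add: L2_inner_self)
  also have "\<dots> = L2_inner M f f + L2_inner M g g + (L2_inner M f g + cnj (L2_inner M f g))"
    using assms L2_inner_commute[of M g f]
    by (simp add: L2_inner_add_left L2_inner_add_right L2_add)
  also have "\<dots> = of_real ((L2_norm M f)\<^sup>2 + (L2_norm M g)\<^sup>2 + 2 * Re (L2_inner M f g))"
    by (simp add: L2_inner_self complex_add_cnj)
  finally show ?thesis
    by (simp only: of_real_eq_iff)
qed

lemma L2_norm_triangle:
  assumes "f \<in> L2 M" "g \<in> L2 M"
  shows "L2_norm M (\<lambda>x. f x + g x) \<le> L2_norm M f + L2_norm M g"
proof (rule power2_le_imp_le)
  have "Re (L2_inner M f g) \<le> L2_norm M f * L2_norm M g"
    using L2_Cauchy_Schwarz[OF assms] complex_Re_le_cmod order_trans by blast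
  then show "(L2_norm M (\<lambda>x. f x + g x))\<^sup>2 \<le> (L2_norm M f + L2_norm M g)\<^sup>2"
    by (simp add: L2_norm_add_square[OF assms] power2_sum)
qed simp

lemma L2_norm_triangle_diff:
  assumes "f \<in> L2 M" "g \<in> L2 M"
  shows "L2_norm M (\<lambda>x. f x - g x) \<le> L2_norm M f + L2_norm M g"
  using L2_norm_triangle[OF assms(1) L2_uminus[OF assms(2)]] by simp

lemma L2_norm_triangle_sub:
  assumes "f \<in> L2 M" "g \<in> L2 M"
  shows "L2_norm M f \<le> L2_norm M g + L2_norm M (\<lambda>x. f x - g x)"
  using L2_norm_triangle[OF assms(2) L2_diff[OF assms]] by simp

lemma L2_norm_sum_le:
  "(\<And>i. i \<in> I \<Longrightarrow> f i \<in> L2 M) \<Longrightarrow> L2_norm M (\<lambda>x. \<Sum>i\<in>I. f i x) \<le> (\<Sum>i\<in>I. L2_norm M (f i))"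
proof (induction I rule: infinite_finite_induct)
  case (insert i I)
  then have "L2_norm M (\<lambda>x. f i x + (\<Sum>i\<in>I. f i x)) \<le> L2_norm M (f i) + L2_norm M (\<lambda>x. \<Sum>i\<in>I. f i x)"
    by (intro L2_norm_triangle L2_sum) auto
  with insert show ?case by simp
qed auto

subsection \<open>Orthogonal projections\<close>

text \<open>The zero vector is allowed as a member, because greedy choices may run out of directions.\<close>

definition orthonormal_or_zero :: "'a measure \<Rightarrow> nat \<Rightarrow> (nat \<Rightarrow> 'a \<Rightarrow> complex) \<Rightarrow> bool" where
  "orthonormal_or_zero M n f \<longleftrightarrow>
     (\<forall>i<n. f i \<in> L2 M \<and> L2_norm M (f i) \<in> {0, 1}) \<and>
     (\<forall>i<n. \<forall>j<n. i \<noteq> j \<longrightarrow> L2_inner M (f i) (f j) = 0)"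

definition projection :: "'a measure \<Rightarrow> nat \<Rightarrow> (nat \<Rightarrow> 'a \<Rightarrow> complex) \<Rightarrow> ('a \<Rightarrow> complex) \<Rightarrow> 'a \<Rightarrow> complex" where
  "projection M n f h = (\<lambda>x. \<Sum>i<n. L2_inner M h (f i) * f i x)"

lemma projection_L2: "orthonormal_or_zero M n f \<Longrightarrow> projection M n f h \<in> L2 M"
  unfolding projection_def orthonormal_or_zero_def by (intro L2_sum L2_scale) auto

lemma projection_inner:
  assumes f: "orthonormal_or_zero M n f" and h: "h \<in> L2 M" and k: "k < n"
  shows "L2_inner M (projection M n f h) (f k) = L2_inner M h (f k)"
proof -
  have "L2_inner M (projection M n f h) (f k) = (\<Sum>i<n. L2_inner M h (f i) * L2_inner M (f i) (f k))"
    using assms unfolding projection_def orthonormal_or_zero_def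
    by (subst L2_inner_sum_left) (auto simp: L2_inner_scale_left)
  also have "\<dots> = (\<Sum>i<n. if i = k then L2_inner M h (f k) * of_real ((L2_norm M (f k))\<^sup>2) else 0)"
    using assms unfolding orthonormal_or_zero_def
    by (intro sum.cong) (auto simp: L2_inner_self)
  also have "\<dots> = L2_inner M h (f k) * of_real ((L2_norm M (f k))\<^sup>2)"
    using k by simp
  also have "\<dots> = L2_inner M h (f k)"
  \<comment> \<open>A zero member of the system has zero inner product with everything, so the
    identity survives for it as 0 = 0.\<close>
  proof (cases "L2_norm M (f k) = 0")
    case True
    then have "cmod (L2_inner M h (f k)) \<le> 0"
      using L2_Cauchy_Schwarz[of h M "f k"] f h k by (auto simp: orthonormal_or_zero_def)
    then show ?thesis by simp
  next
    case False
    then show ?thesis using f k by (auto simp: orthonormal_or_zero_def)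
  qed
  finally show ?thesis .
qed

lemma projection_residual_orthogonal:
  assumes f: "orthonormal_or_zero M n f" and h: "h \<in> L2 M" and k: "k < n"
  shows "L2_inner M (\<lambda>x. h x - projection M n f h x) (f k) = 0"
  using assms by (subst L2_inner_diff_left) (auto simp: projection_L2 projection_inner orthonormal_or_zero_def)

lemma L2_inner_projection:
  assumes f: "orthonormal_or_zero M n f" and h: "h \<in> L2 M" and u: "u \<in> L2 M"
  shows "L2_inner M u (projection M n f h) = (\<Sum>i<n. L2_inner M u (f i) * cnj (L2_inner M h (f i)))"
  using assms unfolding projection_def orthonormal_or_zero_def
  by (subst L2_inner_sum_right) (auto intro!: L2_scale simp: L2_inner_scale_right mult.commute[of "cnj _"])

lemma projection_norm:
  assumes f: "orthonormal_or_zero M n f" and h: "h \<in> L2 M"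
  shows "(L2_norm M (projection M n f h))\<^sup>2 = (\<Sum>i<n. (cmod (L2_inner M h (f i)))\<^sup>2)"
proof -
  have "of_real ((L2_norm M (projection M n f h))\<^sup>2) = L2_inner M (projection M n f h) (projection M n f h)"
    by (simp add: L2_inner_self)
  also have "\<dots> = (\<Sum>i<n. L2_inner M h (f i) * cnj (L2_inner M h (f i)))"
    by (subst L2_inner_projection[OF f h projection_L2[OF f]]) (simp add: projection_inner[OF f h])
  also have "\<dots> = of_real (\<Sum>i<n. (cmod (L2_inner M h (f i)))\<^sup>2)"
    by (simp only: complex_norm_square of_real_sum)
  finally show ?thesis by (simp only: of_real_eq_iff)
qed

lemma projection_pythagoras:
  assumes f: "orthonormal_or_zero M n f" and h: "h \<in> L2 M"
  shows "(L2_norm M h)\<^sup>2 = (L2_norm M (projection M n f h))\<^sup>2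
    + (L2_norm M (\<lambda>x. h x - projection M n f h x))\<^sup>2"
proof -
  let ?p = "projection M n f h" and ?r = "\<lambda>x. h x - projection M n f h x"
  have r: "?r \<in> L2 M" using projection_L2[OF f] h by auto
  have "L2_inner M ?r ?p = 0"
    using L2_inner_projection[OF f h r] projection_residual_orthogonal[OF f h] by simp
  then have "L2_inner M ?p ?r = 0"
    using L2_inner_commute[of M ?p ?r] by simp
  then show ?thesis
    using L2_norm_add_square[OF projection_L2[OF f, of h] r] by simp
qed

lemma Bessel_finite:
  assumes "orthonormal_or_zero M n f" "h \<in> L2 M"
  shows "(\<Sum>i<n. (cmod (L2_inner M h (f i)))\<^sup>2) \<le> (L2_norm M h)\<^sup>2"
  using projection_pythagoras[OF assms] projection_norm[OF assms] by simp

lemma projection_residual_norm_le: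
  assumes "orthonormal_or_zero M n f" "h \<in> L2 M"
  shows "L2_norm M (\<lambda>x. h x - projection M n f h x) \<le> L2_norm M h"
  by (rule power2_le_imp_le) (use projection_pythagoras[OF assms] in auto)

text \<open>Bessel in both systems, joined by the Cauchy-Schwarz inequality for finite sums. The
  bound does not depend on \<open>n\<close> or on the systems, which is what makes nuclear series
  trace class.\<close>

lemma Bessel_product:
  assumes f: "orthonormal_or_zero M n f" "h \<in> L2 M" and u: "orthonormal_or_zero N n u" "g \<in> L2 N"
  shows "(\<Sum>i<n. cmod (L2_inner M h (f i)) * cmod (L2_inner N g (u i))) \<le> L2_norm M h * L2_norm N g"
proof -
  have "(\<Sum>i<n. \<bar>cmod (L2_inner M h (f i))\<bar> * \<bar>cmod (L2_inner N g (u i))\<bar>)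
      \<le> L2_set (\<lambda>i. cmod (L2_inner M h (f i))) {..<n} * L2_set (\<lambda>i. cmod (L2_inner N g (u i))) {..<n}"
    by (rule L2_set_mult_ineq)
  also have "\<dots> \<le> sqrt ((L2_norm M h)\<^sup>2) * sqrt ((L2_norm N g)\<^sup>2)"
    unfolding L2_set_def
    by (intro mult_mono real_sqrt_le_mono Bessel_finite assms) (auto intro: sum_nonneg)
  finally show ?thesis by simp
qed

subsection \<open>Completeness\<close>

text \<open>The common tool for limits: a pointwise limit inherits both membership and the norm
  bound of its approximants. It serves completeness, the nuclear series and the function
  \<open>C e^(-sA) \<alpha>\<close>. The bound is required only from \<open>N\<close> on because
  tails of series are estimated with it.\<close>

lemma L2_Fatou:
  assumes h: "\<And>k. h k \<in> L2 M" and H [measurable]: "H \<in> borel_measurable M"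
    and lim: "AE x in M. (\<lambda>k. h k x) \<longlonglongrightarrow> H x"
    and B: "\<And>k. k \<ge> N \<Longrightarrow> L2_norm M (h k) \<le> B"
  shows "H \<in> L2 M" "L2_norm M H \<le> B"
proof -
  have [measurable]: "h k \<in> borel_measurable M" for k
    using h L2_measurable by auto
  have B0: "0 \<le> B" using B[of N] L2_norm_nonneg[of M "h N"] by linarith
  have "(\<integral>\<^sup>+x. ennreal ((cmod (H x))\<^sup>2) \<partial>M) = (\<integral>\<^sup>+x. liminf (\<lambda>k. ennreal ((cmod (h k x))\<^sup>2)) \<partial>M)"
  proof (rule nn_integral_cong_AE)
    show "AE x in M. ennreal ((cmod (H x))\<^sup>2) = liminf (\<lambda>k. ennreal ((cmod (h k x))\<^sup>2))"
      using lim
    proof eventually_elim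
      fix x assume "(\<lambda>k. h k x) \<longlonglongrightarrow> H x"
      then have "(\<lambda>k. ennreal ((cmod (h k x))\<^sup>2)) \<longlonglongrightarrow> ennreal ((cmod (H x))\<^sup>2)"
        by (intro tendsto_intros)
      then show "ennreal ((cmod (H x))\<^sup>2) = liminf (\<lambda>k. ennreal ((cmod (h k x))\<^sup>2))"
        by (intro lim_imp_Liminf[symmetric]) auto
    qed
  qed
  also have "\<dots> \<le> liminf (\<lambda>k. \<integral>\<^sup>+x. ennreal ((cmod (h k x))\<^sup>2) \<partial>M)"
    by (rule nn_integral_liminf) auto
  also have "\<dots> \<le> ennreal (B\<^sup>2)"
  proof (rule Liminf_le)
    show "eventually (\<lambda>k. (\<integral>\<^sup>+x. ennreal ((cmod (h k x))\<^sup>2) \<partial>M) \<le> ennreal (B\<^sup>2)) sequentially"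
      using eventually_ge_at_top[of N]
    proof eventually_elim
      fix k assume k: "N \<le> k"
      have "(\<integral>\<^sup>+x. ennreal ((cmod (h k x))\<^sup>2) \<partial>M) = ennreal ((L2_norm M (h k))\<^sup>2)"
        using nn_integral_eq_integral[OF L2_integrable_square[OF h]] by (simp add: L2_norm_square)
      also have "\<dots> \<le> ennreal (B\<^sup>2)"
        by (intro ennreal_leI power_mono B k) simp
      finally show "(\<integral>\<^sup>+x. ennreal ((cmod (h k x))\<^sup>2) \<partial>M) \<le> ennreal (B\<^sup>2)" .
    qed
  qed simp
  finally have le: "(\<integral>\<^sup>+x. ennreal ((cmod (H x))\<^sup>2) \<partial>M) \<le> ennreal (B\<^sup>2)" .
  have int: "integrable M (\<lambda>x. (cmod (H x))\<^sup>2)"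
    by (rule integrableI_bounded) (use le in \<open>auto simp: le_less_trans\<close>)
  then show H2: "H \<in> L2 M"
    by (intro L2I) auto
  have "(L2_norm M H)\<^sup>2 \<le> B\<^sup>2"
    using le nn_integral_eq_integral[OF int] by (simp add: L2_norm_square ennreal_le_iff)
  then show "L2_norm M H \<le> B"
    using B0 by (rule power2_le_imp_le)
qed

text \<open>On an infinite measure space the L^2 norm does not control the L^1 norm, so the
  increments are not summed directly. Their squares are summed with weights 2^k, which the geometric
  decay still allows.\<close>

lemma L2_geometric_convergent:
  assumes f: "\<And>k. f k \<in> L2 M" and d: "\<And>k. L2_norm M (\<lambda>x. f (Suc k) x - f k x) \<le> (1/2) ^ k"
  shows "AE x in M. convergent (\<lambda>k. f k x)"
proof -
  have [measurable]: "f k \<in> borel_measurable M" for k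
    using f L2_measurable by auto
  define D where "D k x = f (Suc k) x - f k x" for k x
  have D: "D k \<in> L2 M" for k
    unfolding D_def using f by auto
  have [measurable]: "D k \<in> borel_measurable M" for k
    using D L2_measurable by auto
  have "(\<integral>\<^sup>+x. (\<Sum>k. ennreal (2 ^ k * (cmod (D k x))\<^sup>2)) \<partial>M)
      = (\<Sum>k. \<integral>\<^sup>+x. ennreal (2 ^ k * (cmod (D k x))\<^sup>2) \<partial>M)"
    by (rule nn_integral_suminf) auto
  also have "\<dots> \<le> (\<Sum>k. ennreal ((1/2) ^ k))"
  proof (rule suminf_le)
    fix k
    have "(\<integral>\<^sup>+x. ennreal (2 ^ k * (cmod (D k x))\<^sup>2) \<partial>M) = ennreal (2 ^ k * (L2_norm M (D k))\<^sup>2)"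
      by (subst nn_integral_eq_integral)
        (auto simp: L2_norm_square intro!: L2_integrable_square[OF D])
    also have "\<dots> \<le> ennreal (2 ^ k * ((1/2) ^ k)\<^sup>2)"
      using d[of k] by (intro ennreal_leI mult_left_mono power_mono) (auto simp: D_def[abs_def])
    also have "2 ^ k * ((1/2) ^ k)\<^sup>2 = (1/2 :: real) ^ k"
      by (simp add: power2_eq_square power_one_over)
    finally show "(\<integral>\<^sup>+x. ennreal (2 ^ k * (cmod (D k x))\<^sup>2) \<partial>M) \<le> ennreal ((1/2) ^ k)" .
  qed auto
  also have "\<dots> = ennreal (\<Sum>k. (1/2) ^ k)"
    by (rule suminf_ennreal2) (auto intro: summable_geometric)
  also have "\<dots> < \<infinity>" by simp
  finally have "AE x in M. (\<Sum>k. ennreal (2 ^ k * (cmod (D k x))\<^sup>2)) \<noteq> \<infinity>"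
    by (intro nn_integral_noteq_infinite) auto
  then show ?thesis
  proof eventually_elim
    fix x assume "(\<Sum>k. ennreal (2 ^ k * (cmod (D k x))\<^sup>2)) \<noteq> \<infinity>"
    then have "summable (\<lambda>k. 2 ^ k * (cmod (D k x))\<^sup>2)"
      by (intro summable_suminf_not_top) auto
    then have "summable (\<lambda>k. (1/2) ^ k + 2 ^ k * (cmod (D k x))\<^sup>2)"
      by (intro summable_add summable_geometric) auto
    \<comment> \<open>With s = 2^-k, (s - a)^2 \<ge> 0 gives s a \<le> s^2 + a^2; multiplying by 2^k
      bounds a by a summable term plus the weighted square.\<close>
    moreover have "norm (D k x) \<le> (1/2) ^ k + 2 ^ k * (cmod (D k x))\<^sup>2" for k
    proof -
      let ?s = "(1/2 :: real) ^ k" and ?a = "cmod (D k x)"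
      have "0 \<le> (?s - ?a)\<^sup>2" by simp
      then have "?s * ?a \<le> ?s\<^sup>2 + ?a\<^sup>2"
        using mult_nonneg_nonneg[OF zero_le_power[of "1/2"] norm_ge_zero, of k "D k x"]
        unfolding power2_diff by linarith
      then have "2 ^ k * (?s * ?a) \<le> 2 ^ k * (?s\<^sup>2 + ?a\<^sup>2)"
        by (intro mult_left_mono) auto
      moreover have "2 ^ k * ?s = 1"
        by (simp add: power_one_over)
      ultimately show ?thesis
        by (simp only: distrib_left power2_eq_square mult.assoc[symmetric] mult_1)
    qed
    ultimately have "summable (\<lambda>k. D k x)"
      by (rule summable_comparison_test'[of _ 0])
    then have "convergent (\<lambda>n. \<Sum>k<n. D k x)"
      by (simp add: summable_iff_convergent)
    moreover have "(\<Sum>k<n. D k x) = f n x - f 0 x" for n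
      unfolding D_def by (rule sum_lessThan_telescope)
    ultimately have "convergent (\<lambda>n. f n x - f 0 x)" by simp
    from convergent_add[OF this convergent_const[of "f 0 x"]]
    show "convergent (\<lambda>k. f k x)" by simp
  qed
qed

text \<open>Riesz-Fischer: a subsequence with geometrically small steps converges almost everywhere,
  and \<open>L2_Fatou\<close> turns the Cauchy estimate for f_n - f_(r j) into one for f_n minus the
  limit.\<close>

theorem L2_complete:
  assumes f: "\<And>n. f n \<in> L2 M"
    and Cauchy: "\<And>e. e > 0 \<Longrightarrow> \<exists>N. \<forall>m\<ge>N. \<forall>n\<ge>N. L2_norm M (\<lambda>x. f m x - f n x) < e"
  obtains g where "g \<in> L2 M" "(\<lambda>n. L2_norm M (\<lambda>x. f n x - g x)) \<longlonglongrightarrow> 0"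
proof -
  have [measurable]: "f k \<in> borel_measurable M" for k
    using f L2_measurable by auto
  have "\<exists>r. \<forall>k. (\<forall>m\<ge>r k. \<forall>n\<ge>r k. L2_norm M (\<lambda>x. f m x - f n x) < (1/2) ^ k) \<and> r k \<le> r (Suc k)"
  proof (rule dependent_nat_choice)
    show "\<exists>N. \<forall>m\<ge>N. \<forall>n\<ge>N. L2_norm M (\<lambda>x. f m x - f n x) < (1/2) ^ 0"
      by (rule Cauchy) simp
    fix N k
    obtain N' where N': "\<forall>m\<ge>N'. \<forall>n\<ge>N'. L2_norm M (\<lambda>x. f m x - f n x) < (1/2) ^ Suc k"
      using Cauchy[of "(1/2) ^ Suc k"] by auto
    show "\<exists>y. (\<forall>m\<ge>y. \<forall>n\<ge>y. L2_norm M (\<lambda>x. f m x - f n x) < (1/2) ^ Suc k) \<and> N \<le> y"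
      by (rule exI[of _ "max N N'"]) (use N' in auto)
  qed
  then obtain r where r: "\<And>k m n. m \<ge> r k \<Longrightarrow> n \<ge> r k \<Longrightarrow> L2_norm M (\<lambda>x. f m x - f n x) < (1/2) ^ k"
    and mono: "\<And>k. r k \<le> r (Suc k)"
    by blast
  have mono': "r k \<le> r n" if "k \<le> n" for k n
    using that mono by (rule lift_Suc_mono_le[rotated])
  have conv: "AE x in M. convergent (\<lambda>k. f (r k) x)"
    by (rule L2_geometric_convergent) (auto intro!: f less_imp_le r mono)
  define g where "g x = lim (\<lambda>k. f (r k) x)" for x
  have [measurable]: "g \<in> borel_measurable M"
    unfolding g_def[abs_def] by measurable
  have est: "(\<lambda>x. f n x - g x) \<in> L2 M \<and> L2_norm M (\<lambda>x. f n x - g x) \<le> (1/2) ^ k" if n: "n \<ge> r k" for n k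
  proof -
    have lim: "AE x in M. (\<lambda>j. f n x - f (r j) x) \<longlonglongrightarrow> f n x - g x"
      using conv
    proof eventually_elim
      fix x assume "convergent (\<lambda>k. f (r k) x)"
      then show "(\<lambda>j. f n x - f (r j) x) \<longlonglongrightarrow> f n x - g x"
        unfolding g_def by (intro tendsto_diff tendsto_const) (simp add: convergent_LIMSEQ_iff)
    qed
    have B: "L2_norm M (\<lambda>x. f n x - f (r j) x) \<le> (1/2) ^ k" if "j \<ge> k" for j
      by (rule less_imp_le, rule r[OF n mono'[OF that]])
    have "(\<lambda>x. f n x - g x) \<in> borel_measurable M" by measurable
    note F = L2_Fatou[OF L2_diff[OF f f] this lim B]
    show ?thesis by (intro conjI F)
  qed
  have "(\<lambda>x. f (r 0) x - (f (r 0) x - g x)) \<in> L2 M"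
    by (intro L2_diff f est[THEN conjunct1, of 0]) simp
  then have "g \<in> L2 M" by simp
  moreover have "(\<lambda>n. L2_norm M (\<lambda>x. f n x - g x)) \<longlonglongrightarrow> 0"
  proof (rule LIMSEQ_I)
    fix e :: real assume "e > 0"
    then obtain k where k: "(1/2) ^ k < e"
      using real_arch_pow_inv[of e "1/2"] by auto
    show "\<exists>N. \<forall>n\<ge>N. norm (L2_norm M (\<lambda>x. f n x - g x) - 0) < e"
      by (rule exI[of _ "r k"]) (use est[of k] k in \<open>auto intro: le_less_trans\<close>)
  qed
  ultimately show ?thesis by (rule that)
qed

section \<open>Expansions in an orthonormal basis\<close>

lemma L2_inner_tendsto:
  assumes "\<And>n. f n \<in> L2 M" "g \<in> L2 M" "h \<in> L2 M"
    and "(\<lambda>n. L2_norm M (\<lambda>x. f n x - g x)) \<longlonglongrightarrow> 0"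
  shows "(\<lambda>n. L2_inner M (f n) h) \<longlonglongrightarrow> L2_inner M g h"
proof -
  have "(\<lambda>n. L2_inner M (f n) h - L2_inner M g h) \<longlonglongrightarrow> 0"
  proof (rule Lim_null_comparison)
    have "cmod (L2_inner M (f n) h - L2_inner M g h) \<le> L2_norm M (\<lambda>x. f n x - g x) * L2_norm M h" for n
      using L2_Cauchy_Schwarz[OF L2_diff[OF assms(1,2)] assms(3)] assms
      by (simp add: L2_inner_diff_left)
    then show "\<forall>\<^sub>F n in sequentially. norm (L2_inner M (f n) h - L2_inner M g h)
        \<le> L2_norm M (\<lambda>x. f n x - g x) * L2_norm M h"
      by simp
    show "(\<lambda>n. L2_norm M (\<lambda>x. f n x - g x) * L2_norm M h) \<longlonglongrightarrow> 0"
      using tendsto_mult_right[OF assms(4), of "L2_norm M h"] by simp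
  qed
  then show ?thesis by (simp add: LIM_zero_iff)
qed

lemma orthonormal_basis_orthonormal:
  assumes "orthonormal_basis M e"
  shows "orthonormal_or_zero M n e"
proof -
  have "L2_norm M (e i) = 1" for i
  proof -
    have "complex_of_real ((L2_norm M (e i))\<^sup>2) = 1"
      using assms L2_inner_self[of M "e i"] by (simp add: orthonormal_basis_def)
    then have "(L2_norm M (e i))\<^sup>2 = 1\<^sup>2" by (simp only: of_real_eq_1_iff one_power2)
    then show ?thesis by (rule power2_eq_imp_eq) auto
  qed
  then show ?thesis
    using assms by (auto simp: orthonormal_basis_def orthonormal_or_zero_def)
qed

text \<open>The squared norms of the projections increase and stay below that of \<open>g\<close>,
  so by Pythagoras the projections are Cauchy. Their limit has the same coefficients as
  \<open>g\<close>, and completeness of the basis identifies the two almost everywhere.\<close>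

lemma orthonormal_basis_projection_tendsto:
  assumes e: "orthonormal_basis M e" and g: "g \<in> L2 M"
  shows "(\<lambda>n. L2_norm M (\<lambda>x. projection M n e g x - g x)) \<longlonglongrightarrow> 0"
proof -
  let ?p = "\<lambda>n. projection M n e g"
  note on = orthonormal_basis_orthonormal[OF e]
  have eL2: "e k \<in> L2 M" for k
    using e by (simp add: orthonormal_basis_def)
  have proj: "projection M n e (?p m) = ?p n" if "n \<le> m" for m n
    unfolding projection_def[of M n]
    using that by (intro ext sum.cong) (auto simp: projection_inner[OF on g])
  \<comment> \<open>Pythagoras for the vector \<open>?p m\<close>, whose projection onto the first
    \<open>n\<close> basis vectors is \<open>?p n\<close>.\<close>
  have norms: "(L2_norm M (\<lambda>x. ?p m x - ?p n x))\<^sup>2 = (L2_norm M (?p m))\<^sup>2 - (L2_norm M (?p n))\<^sup>2"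
    if "n \<le> m" for m n
    using projection_pythagoras[OF on[of n] projection_L2[OF on[of m]], of g] proj[OF that] by simp
  have "convergent (\<lambda>n. (L2_norm M (?p n))\<^sup>2)"
  proof (rule Bseq_monoseq_convergent)
    have "norm ((L2_norm M (?p n))\<^sup>2) \<le> (L2_norm M g)\<^sup>2" for n
      using projection_pythagoras[OF on[of n] g] by simp
    then show "Bseq (\<lambda>n. (L2_norm M (?p n))\<^sup>2)" by (rule BseqI')
    show "monoseq (\<lambda>n. (L2_norm M (?p n))\<^sup>2)"
    proof (rule monoI1, intro allI impI)
      show "(L2_norm M (?p n))\<^sup>2 \<le> (L2_norm M (?p m))\<^sup>2" if "n \<le> m" for m n
        using norms[OF that] zero_le_power2[of "L2_norm M (\<lambda>x. ?p m x - ?p n x)"] by linarith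
    qed
  qed
  then have C: "Cauchy (\<lambda>n. (L2_norm M (?p n))\<^sup>2)"
    by (rule convergent_Cauchy)
  have small: "\<exists>N. \<forall>m\<ge>N. \<forall>n\<ge>N. L2_norm M (\<lambda>x. ?p m x - ?p n x) < \<epsilon>" if "\<epsilon> > 0" for \<epsilon>
  proof -
    obtain N where N: "\<And>m n. m \<ge> N \<Longrightarrow> n \<ge> N \<Longrightarrow>
        dist ((L2_norm M (?p m))\<^sup>2) ((L2_norm M (?p n))\<^sup>2) < \<epsilon>\<^sup>2"
      using metric_CauchyD[OF C, of "\<epsilon>\<^sup>2"] \<open>\<epsilon> > 0\<close> by auto
    have *: "L2_norm M (\<lambda>x. ?p m x - ?p n x) < \<epsilon>" if "m \<ge> N" "n \<ge> N" "n \<le> m" for m n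
    proof -
      have "(L2_norm M (\<lambda>x. ?p m x - ?p n x))\<^sup>2 < \<epsilon>\<^sup>2"
        using N[OF that(1,2)] norms[OF that(3)] by (simp add: dist_real_def abs_if split: if_splits)
      then show ?thesis
        using \<open>\<epsilon> > 0\<close> by (intro power2_less_imp_less[of _ \<epsilon>]) auto
    qed
    have "L2_norm M (\<lambda>x. ?p m x - ?p n x) < \<epsilon>" if "m \<ge> N" "n \<ge> N" for m n
      using *[of m n] *[of n m] that L2_norm_minus_commute[of M "?p m" "?p n"]
      by (cases "n \<le> m") auto
    then show ?thesis by blast
  qed
  obtain p where p: "p \<in> L2 M" "(\<lambda>n. L2_norm M (\<lambda>x. ?p n x - p x)) \<longlonglongrightarrow> 0"
    by (rule L2_complete[of ?p M]) (use projection_L2[OF on] small in blast)+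
  have "L2_inner M p (e k) = L2_inner M g (e k)" for k
  proof (rule LIMSEQ_unique)
    show "(\<lambda>n. L2_inner M (?p n) (e k)) \<longlonglongrightarrow> L2_inner M p (e k)"
      by (rule L2_inner_tendsto) (auto intro!: projection_L2[OF on] p eL2)
    have "\<forall>\<^sub>F n in sequentially. L2_inner M (?p n) (e k) = L2_inner M g (e k)"
      using eventually_gt_at_top[of k] by eventually_elim (rule projection_inner[OF on g])
    then show "(\<lambda>n. L2_inner M (?p n) (e k)) \<longlonglongrightarrow> L2_inner M g (e k)"
      by (rule tendsto_eventually)
  qed
  then have "L2_inner M (\<lambda>x. p x - g x) (e k) = 0" for k
    by (simp add: L2_inner_diff_left p(1) g eL2)
  moreover have "\<forall>f\<in>L2 M. (\<forall>n. L2_inner M f (e n) = 0) \<longrightarrow> (AE x in M. f x = 0)"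
    using e unfolding orthonormal_basis_def by (elim conjE)
  ultimately have "AE x in M. p x - g x = 0"
    using L2_diff[OF p(1) g] by blast
  then have AE: "AE x in M. ?p n x - p x = ?p n x - g x" for n
    by eventually_elim simp
  have "L2_norm M (\<lambda>x. ?p n x - p x) = L2_norm M (\<lambda>x. ?p n x - g x)" for n
    by (intro L2_norm_cong_AE L2_measurable[OF L2_diff] projection_L2[OF on] p(1) g AE)
  with p(2) show ?thesis by simp
qed

lemma Parseval_sums:
  assumes e: "orthonormal_basis M e" and g: "g \<in> L2 M" and h: "h \<in> L2 M"
  shows "(\<lambda>i. L2_inner M g (e i) * L2_inner M (e i) h) sums L2_inner M g h"
proof -
  note on = orthonormal_basis_orthonormal[OF e]
  have eL2: "e k \<in> L2 M" for k
    using e by (simp add: orthonormal_basis_def)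
  have "(\<lambda>n. L2_inner M (projection M n e g) h) \<longlonglongrightarrow> L2_inner M g h"
    by (rule L2_inner_tendsto[OF projection_L2[OF on] g h orthonormal_basis_projection_tendsto[OF e g]])
  moreover have "L2_inner M (projection M n e g) h
      = (\<Sum>i<n. L2_inner M g (e i) * L2_inner M (e i) h)" for n
    unfolding projection_def by (subst L2_inner_sum_left) (auto intro!: L2_scale eL2 h simp: L2_inner_scale_left)
  ultimately show ?thesis
    by (simp add: sums_def)
qed

lemma sum_inner_basis_le:
  assumes e: "orthonormal_basis M e" and g: "g \<in> L2 M" and h: "h \<in> L2 M"
  shows "summable (\<lambda>i. cmod (L2_inner M g (e i)) * cmod (L2_inner M (e i) h))"
    and "(\<Sum>i. cmod (L2_inner M g (e i)) * cmod (L2_inner M (e i) h)) \<le> L2_norm M g * L2_norm M h"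
proof -
  have sym: "cmod (L2_inner M (e i) h) = cmod (L2_inner M h (e i))" for i
    by (subst L2_inner_commute) simp
  have *: "(\<Sum>i<n. cmod (L2_inner M g (e i)) * cmod (L2_inner M (e i) h)) \<le> L2_norm M g * L2_norm M h" for n
    unfolding sym
    by (rule Bessel_product[OF orthonormal_basis_orthonormal[OF e] g orthonormal_basis_orthonormal[OF e] h])
  show s: "summable (\<lambda>i. cmod (L2_inner M g (e i)) * cmod (L2_inner M (e i) h))"
    by (rule summableI_nonneg_bounded[OF _ *]) simp
  show "(\<Sum>i. cmod (L2_inner M g (e i)) * cmod (L2_inner M (e i) h)) \<le> L2_norm M g * L2_norm M h"
    by (rule suminf_le_const[OF s *])
qed

section \<open>Bounded operators and singular numbers\<close>

lemma bounded_operator_L2: "bounded_operator M N T \<Longrightarrow> f \<in> L2 M \<Longrightarrow> T f \<in> L2 N"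
  by (simp add: bounded_operator_def)

lemma bounded_operator_measurable:
  "bounded_operator M N T \<Longrightarrow> f \<in> L2 M \<Longrightarrow> T f \<in> borel_measurable N"
  by (rule L2_measurable[OF bounded_operator_L2])

lemma bounded_operator_add:
  "bounded_operator M N T \<Longrightarrow> f \<in> L2 M \<Longrightarrow> g \<in> L2 M \<Longrightarrow>
    AE x in N. T (\<lambda>y. f y + g y) x = T f x + T g x"
  by (simp add: bounded_operator_def)

lemma bounded_operator_scale:
  "bounded_operator M N T \<Longrightarrow> f \<in> L2 M \<Longrightarrow> AE x in N. T (\<lambda>y. c * f y) x = c * T f x"
  by (simp add: bounded_operator_def)

lemma bounded_operator_bound:
  assumes "bounded_operator M N T"
  obtains K where "0 \<le> K" "\<And>f. f \<in> L2 M \<Longrightarrow> L2_norm N (T f) \<le> K * L2_norm M f"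
proof -
  obtain K where K: "\<And>f. f \<in> L2 M \<Longrightarrow> L2_norm N (T f) \<le> K * L2_norm M f"
    using assms unfolding bounded_operator_def by blast
  have "L2_norm N (T f) \<le> max 0 K * L2_norm M f" if "f \<in> L2 M" for f
    using K[OF that] mult_right_mono[OF max.cobounded2[of K 0] L2_norm_nonneg[of M f]] by linarith
  then show ?thesis by (intro that[of "max 0 K"]) auto
qed

lemma bounded_operator_diff:
  assumes T: "bounded_operator M N T" and f: "f \<in> L2 M" and g: "g \<in> L2 M"
  shows "AE x in N. T (\<lambda>y. f y - g y) x = T f x - T g x"
  using bounded_operator_add[OF T f L2_scale[OF g, of "-1"]] bounded_operator_scale[OF T g, of "-1"]
  by eventually_elim simp

lemma bounded_operator_zero:
  assumes T: "bounded_operator M N T"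
  shows "AE x in N. T (\<lambda>y. 0) x = 0"
  using bounded_operator_scale[OF T L2_zero, of 0] by simp

lemma bounded_operator_sum:
  assumes T: "bounded_operator M N T" and f: "\<And>i. i \<in> I \<Longrightarrow> f i \<in> L2 M"
  shows "AE x in N. T (\<lambda>y. \<Sum>i\<in>I. c i * f i y) x = (\<Sum>i\<in>I. c i * T (f i) x)"
  using f
proof (induction I rule: infinite_finite_induct)
  case (insert i I)
  have "AE x in N. T (\<lambda>y. c i * f i y + (\<Sum>i\<in>I. c i * f i y)) x
      = T (\<lambda>y. c i * f i y) x + T (\<lambda>y. \<Sum>i\<in>I. c i * f i y) x"
    using insert.prems by (intro bounded_operator_add[OF T] L2_scale L2_sum) auto
  moreover have "AE x in N. T (\<lambda>y. c i * f i y) x = c i * T (f i) x"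
    using insert.prems by (intro bounded_operator_scale[OF T]) auto
  moreover have "AE x in N. T (\<lambda>y. \<Sum>i\<in>I. c i * f i y) x = (\<Sum>i\<in>I. c i * T (f i) x)"
    using insert by auto
  ultimately show ?case
    by eventually_elim (use insert in simp)
qed (auto intro: bounded_operator_zero[OF T])

section \<open>Finite rank operators and approximation in operator norm\<close>

text \<open>The coefficients are arbitrary bounded functionals instead of inner products, so that h
  -> <T h, u_i> is covered without constructing the adjoint of \<open>T\<close>.\<close>

lemma finite_rank_operator:
  assumes add: "\<And>i f g. f \<in> L2 M \<Longrightarrow> g \<in> L2 M \<Longrightarrow> \<phi> i (\<lambda>x. f x + g x) = \<phi> i f + \<phi> i g"
    and scale: "\<And>i c f. f \<in> L2 M \<Longrightarrow> \<phi> i (\<lambda>x. c * f x) = c * \<phi> i f"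
    and bound: "\<And>i f. f \<in> L2 M \<Longrightarrow> cmod (\<phi> i f) \<le> K i * L2_norm M f"
    and g: "\<And>i. i < n \<Longrightarrow> g i \<in> L2 N"
  shows "bounded_operator M N (\<lambda>f x. \<Sum>i<n. \<phi> i f * g i x)"
    and "rank_at_most M N n (\<lambda>f x. \<Sum>i<n. \<phi> i f * g i x)"
proof -
  have "L2_norm N (\<lambda>x. \<Sum>i<n. \<phi> i f * g i x) \<le> (\<Sum>i<n. K i * L2_norm N (g i)) * L2_norm M f"
    if f: "f \<in> L2 M" for f
  proof -
    have "L2_norm N (\<lambda>x. \<Sum>i<n. \<phi> i f * g i x) \<le> (\<Sum>i<n. L2_norm N (\<lambda>x. \<phi> i f * g i x))"
      using g by (intro L2_norm_sum_le L2_scale) auto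
    also have "\<dots> \<le> (\<Sum>i<n. (K i * L2_norm M f) * L2_norm N (g i))"
      unfolding L2_norm_scale by (intro sum_mono mult_right_mono bound f) simp
    finally show ?thesis by (simp add: sum_distrib_left sum_distrib_right mult_ac)
  qed
  then show "bounded_operator M N (\<lambda>f x. \<Sum>i<n. \<phi> i f * g i x)"
    unfolding bounded_operator_def
    by (auto simp: add scale distrib_right sum.distrib sum_distrib_left mult.assoc
        intro!: L2_sum L2_scale g)
  show "rank_at_most M N n (\<lambda>f x. \<Sum>i<n. \<phi> i f * g i x)"
    unfolding rank_at_most_def by (rule exI[of _ g]) (use g in auto)
qed

lemma rank_at_most_mono:
  assumes "rank_at_most M N m F" "m \<le> n"
  shows "rank_at_most M N n F"
proof -
  obtain g where g: "\<forall>i<m. g i \<in> L2 N" "\<forall>f\<in>L2 M. \<exists>c. AE x in N. F f x = (\<Sum>i<m. c i * g i x)"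
    using assms by (auto simp: rank_at_most_def)
  have *: "(\<Sum>i<n. c i * (if i < m then g i x else 0)) = (\<Sum>i<m. c i * g i x)" for c x
    using \<open>m \<le> n\<close> by (intro sum.mono_neutral_cong_right) auto
  have "(\<lambda>x. if i < m then g i x else 0) \<in> L2 N" for i
    using g(1) by (cases "i < m") auto
  then show ?thesis
    unfolding rank_at_most_def
    by (intro exI[of _ "\<lambda>i x. if i < m then g i x else 0"]) (use g(2) * in auto)
qed

lemma operator_norm_le:
  assumes "0 \<le> K" "\<And>f. f \<in> L2 M \<Longrightarrow> L2_norm N (T f) \<le> K * L2_norm M f"
  shows "operator_norm M N T \<le> K"
  unfolding operator_norm_def by (rule cInf_lower) (use assms in \<open>auto intro: bdd_belowI[of _ 0]\<close>)

lemma bounded_operator_minus: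
  assumes "bounded_operator M N T" "bounded_operator M N F"
  obtains K where "0 \<le> K" "\<And>f. f \<in> L2 M \<Longrightarrow> L2_norm N (\<lambda>x. T f x - F f x) \<le> K * L2_norm M f"
proof -
  obtain K where K: "0 \<le> K" "\<And>f. f \<in> L2 M \<Longrightarrow> L2_norm N (T f) \<le> K * L2_norm M f"
    using bounded_operator_bound[OF assms(1)] by blast
  obtain K' where K': "0 \<le> K'" "\<And>f. f \<in> L2 M \<Longrightarrow> L2_norm N (F f) \<le> K' * L2_norm M f"
    using bounded_operator_bound[OF assms(2)] by blast
  show ?thesis
  proof (rule that[of "K + K'"])
    fix f assume f: "f \<in> L2 M"
    then show "L2_norm N (\<lambda>x. T f x - F f x) \<le> (K + K') * L2_norm M f"
      using L2_norm_triangle_diff[OF assms[THEN bounded_operator_L2, OF f]] K(2)[OF f] K'(2)[OF f]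
      by (simp add: distrib_right)
  qed (use K K' in simp)
qed

lemma operator_norm_minus_nonneg:
  assumes "bounded_operator M N T" "bounded_operator M N F"
  shows "0 \<le> operator_norm M N (\<lambda>f x. T f x - F f x)"
proof -
  obtain K where "0 \<le> K" "\<And>f. f \<in> L2 M \<Longrightarrow> L2_norm N (\<lambda>x. T f x - F f x) \<le> K * L2_norm M f"
    using bounded_operator_minus[OF assms] by blast
  then show ?thesis
    unfolding operator_norm_def by (intro cInf_greatest) auto
qed

lemma zero_bounded_operator: "bounded_operator M N (\<lambda>f x. 0)"
  unfolding bounded_operator_def by (auto intro: exI[of _ 0])

lemma zero_rank_at_most: "rank_at_most M N n (\<lambda>f x. 0)"
  unfolding rank_at_most_def by (rule exI[of _ "\<lambda>i x. 0"]) auto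

lemma singular_number_le_operator_norm:
  assumes T: "bounded_operator M M T" and "bounded_operator M M F" "rank_at_most M M n F"
  shows "singular_number M T n \<le> operator_norm M M (\<lambda>f x. T f x - F f x)"
  unfolding singular_number_def
  by (rule cInf_lower) (use assms in \<open>auto intro!: bdd_belowI[of _ 0] operator_norm_minus_nonneg\<close>)

lemma singular_number_nonneg:
  assumes T: "bounded_operator M M T"
  shows "0 \<le> singular_number M T n"
  unfolding singular_number_def
proof (rule cInf_greatest)
  show "{operator_norm M M (\<lambda>f x. T f x - F f x) |F. bounded_operator M M F \<and> rank_at_most M M n F} \<noteq> {}"
    using zero_bounded_operator zero_rank_at_most by blast
qed (use T in \<open>auto intro: operator_norm_minus_nonneg\<close>)

lemma singular_number_antimono:
  assumes T: "bounded_operator M M T" and "m \<le> n"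
  shows "singular_number M T n \<le> singular_number M T m"
  unfolding singular_number_def[of M T m]
proof (rule cInf_greatest)
  show "{operator_norm M M (\<lambda>f x. T f x - F f x) |F. bounded_operator M M F \<and> rank_at_most M M m F} \<noteq> {}"
    using zero_bounded_operator zero_rank_at_most by blast
qed (use assms rank_at_most_mono in \<open>blast intro: singular_number_le_operator_norm\<close>)

subsection \<open>A trace class criterion\<close>

lemma sum_lessThan_add: "(\<Sum>i<m + n. f i) = (\<Sum>i<m. f i) + (\<Sum>i<n. f (m + i))"
  for f :: "nat \<Rightarrow> 'a::comm_monoid_add"
  by (induction n) (simp_all add: add.assoc)

text \<open>
  With \<open>P\<close>, \<open>Q\<close> the projections onto the spans of two systems of \<open>n\<close> vectors, \<open>T - (I - Q) T (I - P)\<close> has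
  rank at most \<open>2 n\<close>.
\<close>

lemma singular_number_le_compression:
  assumes T: "bounded_operator M M T"
    and f: "orthonormal_or_zero M n f" and u: "orthonormal_or_zero M n u"
    and "0 \<le> K"
    and bound: "\<And>g w. g \<in> L2 M \<Longrightarrow> w \<in> L2 M \<Longrightarrow> (\<And>i. i < n \<Longrightarrow> L2_inner M g (f i) = 0) \<Longrightarrow>
      (\<And>i. i < n \<Longrightarrow> L2_inner M w (u i) = 0) \<Longrightarrow>
      cmod (L2_inner M (T g) w) \<le> K * L2_norm M g * L2_norm M w"
  shows "singular_number M T (2 * n) \<le> K"
proof -
  have fL2: "f i \<in> L2 M" if "i < n" for i using f that by (simp add: orthonormal_or_zero_def)
  have uL2: "u i \<in> L2 M" if "i < n" for i using u that by (simp add: orthonormal_or_zero_def)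
  obtain C where C: "0 \<le> C" "\<And>h. h \<in> L2 M \<Longrightarrow> L2_norm M (T h) \<le> C * L2_norm M h"
    using bounded_operator_bound[OF T] by blast
  \<comment> \<open>The first \<open>n\<close> summands of \<open>F\<close> build Q T, the last
    \<open>n\<close> build (I - Q) T P, and Q T + (I - Q) T P = T - (I - Q) T (I - P).\<close>
  define \<phi> where "\<phi> i h = (if i < n then L2_inner M (T h) (u i) else if i < n + n then L2_inner M h (f (i - n)) else 0)" for i h
  define G where "G i = (if i < n then u i else (\<lambda>x. T (f (i - n)) x - projection M n u (T (f (i - n))) x))" for i
  define F where "F h x = (\<Sum>i<n + n. \<phi> i h * G i x)" for h x
  have add: "\<phi> i (\<lambda>x. h x + k x) = \<phi> i h + \<phi> i k" if h: "h \<in> L2 M" and k: "k \<in> L2 M" for i h k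
  proof (cases "i < n")
    case True
    have "L2_inner M (T (\<lambda>x. h x + k x)) (u i) = L2_inner M (\<lambda>x. T h x + T k x) (u i)"
      using bounded_operator_add[OF T h k]
      by (intro L2_inner_cong_AE bounded_operator_measurable[OF T] L2_measurable)
        (auto intro!: L2_add bounded_operator_L2[OF T] h k uL2 True)
    then show ?thesis
      using True h k by (simp add: \<phi>_def L2_inner_add_left bounded_operator_L2[OF T] uL2)
  qed (use that in \<open>auto simp: \<phi>_def L2_inner_add_left fL2\<close>)
  have scale: "\<phi> i (\<lambda>x. c * h x) = c * \<phi> i h" if h: "h \<in> L2 M" for i c h
  proof (cases "i < n")
    case True
    have "L2_inner M (T (\<lambda>x. c * h x)) (u i) = L2_inner M (\<lambda>x. c * T h x) (u i)"
      using bounded_operator_scale[OF T h]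
      by (intro L2_inner_cong_AE bounded_operator_measurable[OF T] L2_measurable)
        (auto intro!: L2_scale bounded_operator_L2[OF T] h uL2 True)
    then show ?thesis
      using True by (simp add: \<phi>_def L2_inner_scale_left)
  qed (use that in \<open>auto simp: \<phi>_def L2_inner_scale_left\<close>)
  have bd: "cmod (\<phi> i h) \<le> (if i < n then C * L2_norm M (u i) else if i < n + n then L2_norm M (f (i - n)) else 0) * L2_norm M h"
    if h: "h \<in> L2 M" for i h
  proof (cases "i < n")
    case True
    then have "cmod (\<phi> i h) \<le> L2_norm M (T h) * L2_norm M (u i)"
      using L2_Cauchy_Schwarz[OF bounded_operator_L2[OF T h] uL2[OF True]] by (simp add: \<phi>_def)
    also have "\<dots> \<le> C * L2_norm M h * L2_norm M (u i)"
      by (intro mult_right_mono C h) simp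
    finally show ?thesis using True by (simp add: mult_ac)
  next
    case False
    then show ?thesis
      using L2_Cauchy_Schwarz[OF h fL2[of "i - n"]] by (auto simp: \<phi>_def mult.commute)
  qed
  have G: "G i \<in> L2 M" if "i < n + n" for i
    using that by (auto simp: G_def intro!: uL2 L2_diff projection_L2[OF u] bounded_operator_L2[OF T] fL2)
  have F: "bounded_operator M M F" "rank_at_most M M (n + n) F"
    unfolding F_def[abs_def]
    by (rule finite_rank_operator; fact add scale bd G)+
  have "L2_norm M (\<lambda>x. T h x - F h x) \<le> K * L2_norm M h" if h: "h \<in> L2 M" for h
  proof -
    define g where "g x = h x - projection M n f h x" for x
    have g: "g \<in> L2 M"
      unfolding g_def[abs_def] by (intro L2_diff h projection_L2[OF f])
    define w where "w x = T g x - projection M n u (T g) x" for x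
    have Tg: "T g \<in> L2 M" by (rule bounded_operator_L2[OF T g])
    have w: "w \<in> L2 M"
      unfolding w_def[abs_def] by (intro L2_diff Tg projection_L2[OF u])
    have eqTg: "AE x in M. T g x = T h x - (\<Sum>i<n. L2_inner M h (f i) * T (f i) x)"
    proof -
      have "AE x in M. T g x = T h x - T (projection M n f h) x"
        unfolding g_def[abs_def] by (rule bounded_operator_diff[OF T h projection_L2[OF f]])
      moreover have "AE x in M. T (projection M n f h) x = (\<Sum>i<n. L2_inner M h (f i) * T (f i) x)"
        unfolding projection_def by (rule bounded_operator_sum[OF T]) (use fL2 in auto)
      ultimately show ?thesis by eventually_elim simp
    qed
    have inner_Tg: "L2_inner M (T g) (u k) = L2_inner M (T h) (u k)
        - (\<Sum>i<n. L2_inner M h (f i) * L2_inner M (T (f i)) (u k))" if k: "k < n" for k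
    proof -
      have sumL2: "(\<lambda>x. \<Sum>i<n. L2_inner M h (f i) * T (f i) x) \<in> L2 M"
        by (intro L2_sum L2_scale bounded_operator_L2[OF T] fL2) auto
      have "L2_inner M (T g) (u k) = L2_inner M (\<lambda>x. T h x - (\<Sum>i<n. L2_inner M h (f i) * T (f i) x)) (u k)"
        by (intro L2_inner_cong_AE eqTg L2_measurable Tg uL2 k L2_diff sumL2 bounded_operator_L2[OF T h])
      also have "\<dots> = L2_inner M (T h) (u k) - L2_inner M (\<lambda>x. \<Sum>i<n. L2_inner M h (f i) * T (f i) x) (u k)"
        by (intro L2_inner_diff_left bounded_operator_L2[OF T h] sumL2 uL2 k)
      also have "L2_inner M (\<lambda>x. \<Sum>i<n. L2_inner M h (f i) * T (f i) x) (u k)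
          = (\<Sum>i<n. L2_inner M h (f i) * L2_inner M (T (f i)) (u k))"
        by (subst L2_inner_sum_left) (auto simp: L2_inner_scale_left intro!: L2_scale bounded_operator_L2[OF T] fL2 uL2 k)
      finally show ?thesis .
    qed
    have "AE x in M. T h x - F h x = w x"
      using eqTg
    proof eventually_elim
      fix x assume x: "T g x = T h x - (\<Sum>i<n. L2_inner M h (f i) * T (f i) x)"
      have "projection M n u (T g) x = projection M n u (T h) x
          - (\<Sum>k<n. \<Sum>i<n. L2_inner M h (f i) * L2_inner M (T (f i)) (u k) * u k x)"
        unfolding projection_def
        by (simp add: inner_Tg left_diff_distrib sum_subtractf sum_distrib_right)
      also have "(\<Sum>k<n. \<Sum>i<n. L2_inner M h (f i) * L2_inner M (T (f i)) (u k) * u k x)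
          = (\<Sum>i<n. L2_inner M h (f i) * projection M n u (T (f i)) x)"
        unfolding projection_def by (subst sum.swap) (simp add: sum_distrib_left mult.assoc)
      finally have "w x = T h x - (\<Sum>i<n. L2_inner M h (f i) * T (f i) x)
          - projection M n u (T h) x + (\<Sum>i<n. L2_inner M h (f i) * projection M n u (T (f i)) x)"
        by (simp add: w_def x)
      moreover have "F h x = projection M n u (T h) x
          + (\<Sum>i<n. L2_inner M h (f i) * (T (f i) x - projection M n u (T (f i)) x))"
        unfolding F_def sum_lessThan_add by (simp add: \<phi>_def G_def projection_def)
      ultimately show "T h x - F h x = w x"
        by (simp add: right_diff_distrib sum_subtractf)
    qed
    then have "L2_norm M (\<lambda>x. T h x - F h x) = L2_norm M w"
      by (intro L2_norm_cong_AE L2_measurable L2_diff w bounded_operator_L2[OF T] bounded_operator_L2[OF F(1)] h)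
    also have "L2_norm M w \<le> K * L2_norm M g"
    proof (cases "L2_norm M w = 0")
      case False
      have w_orth: "L2_inner M w (u i) = 0" if "i < n" for i
        unfolding w_def[abs_def] by (rule projection_residual_orthogonal[OF u Tg that])
      \<comment> \<open>Since w = (I - Q) T g is orthogonal to the range of Q, its squared norm is
        <T g, w>, to which the assumed bound applies; one factor of the norm then cancels.\<close>
      have "L2_inner M w (projection M n u (T g)) = 0"
        using L2_inner_projection[OF u Tg w] w_orth by simp
      then have "L2_inner M (projection M n u (T g)) w = 0"
        using L2_inner_commute[of M "projection M n u (T g)" w] by simp
      then have "L2_inner M w w = L2_inner M (T g) w"
        using L2_inner_diff_left[OF Tg projection_L2[OF u] w, of "T g"] by (simp add: w_def[abs_def])
      then have "(L2_norm M w)\<^sup>2 = cmod (L2_inner M (T g) w)"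
        by (metis L2_inner_self abs_of_nonneg norm_of_real zero_le_power2)
      also have "\<dots> \<le> K * L2_norm M g * L2_norm M w"
        by (rule bound[OF g w _ w_orth])
          (simp_all add: g_def[abs_def] projection_residual_orthogonal[OF f h])
      finally show ?thesis
        using False L2_norm_nonneg[of M w] by (simp add: power2_eq_square)
    qed (use \<open>0 \<le> K\<close> in simp)
    also have "\<dots> \<le> K * L2_norm M h"
      unfolding g_def[abs_def] by (intro mult_left_mono projection_residual_norm_le[OF f h] \<open>0 \<le> K\<close>)
    finally show ?thesis .
  qed
  then have "operator_norm M M (\<lambda>f x. T f x - F f x) \<le> K"
    by (rule operator_norm_le[OF \<open>0 \<le> K\<close>])
  then show ?thesis
    using singular_number_le_operator_norm[OF T F] by (simp add: mult_2)
qed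

text \<open>Let \<sigma> be the supremum of |<T g, w>| over unit or zero vectors orthogonal to the
  vectors chosen so far. By homogeneity \<sigma> bounds the compression, hence the singular number,
  and some admissible pair reaches at least \<sigma>/2.\<close>

lemma singular_number_greedy:
  assumes T: "bounded_operator M M T"
    and f: "orthonormal_or_zero M n f" and u: "orthonormal_or_zero M n u"
  obtains f' u' where "orthonormal_or_zero M (Suc n) f'" "orthonormal_or_zero M (Suc n) u'"
    "\<And>i. i < n \<Longrightarrow> f' i = f i" "\<And>i. i < n \<Longrightarrow> u' i = u i"
    "singular_number M T (2 * n) \<le> 2 * cmod (L2_inner M (T (f' n)) (u' n))"
proof -
  define adm where "adm v g \<longleftrightarrow> g \<in> L2 M \<and> L2_norm M g \<in> {0, 1} \<and> (\<forall>i<n. L2_inner M g (v i) = 0)" for v g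
  define A where "A = {cmod (L2_inner M (T g) w) |g w. adm f g \<and> adm u w}"
  obtain C where C: "0 \<le> C" "\<And>h. h \<in> L2 M \<Longrightarrow> L2_norm M (T h) \<le> C * L2_norm M h"
    using bounded_operator_bound[OF T] by blast
  have zero: "adm v (\<lambda>x. 0)" for v by (simp add: adm_def)
  then have "0 \<in> A" by (force simp: A_def)
  have bdd: "bdd_above A"
  proof (rule bdd_aboveI)
    fix a assume "a \<in> A"
    then obtain g w where a: "a = cmod (L2_inner M (T g) w)" and g: "adm f g" and w: "adm u w"
      by (auto simp: A_def)
    have "a \<le> L2_norm M (T g) * L2_norm M w"
      unfolding a using g w by (intro L2_Cauchy_Schwarz bounded_operator_L2[OF T]) (auto simp: adm_def)
    also have "\<dots> \<le> (C * L2_norm M g) * L2_norm M w"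
      using g by (intro mult_right_mono C) (auto simp: adm_def)
    also have "\<dots> \<le> C" using g w C(1) by (auto simp: adm_def)
    finally show "a \<le> C" .
  qed
  define \<sigma> where "\<sigma> = Sup A"
  have \<sigma>: "0 \<le> \<sigma>" unfolding \<sigma>_def by (rule cSup_upper[OF \<open>0 \<in> A\<close> bdd])
  have "singular_number M T (2 * n) \<le> \<sigma>"
  proof (rule singular_number_le_compression[OF T f u \<sigma>])
    fix g w assume g: "g \<in> L2 M" "\<And>i. i < n \<Longrightarrow> L2_inner M g (f i) = 0"
      and w: "w \<in> L2 M" "\<And>i. i < n \<Longrightarrow> L2_inner M w (u i) = 0"
    let ?a = "L2_norm M g" and ?b = "L2_norm M w"
    show "cmod (L2_inner M (T g) w) \<le> \<sigma> * ?a * ?b"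
    proof (cases "?a = 0 \<or> ?b = 0")
      case True
      have "cmod (L2_inner M (T g) w) \<le> L2_norm M (T g) * ?b"
        by (intro L2_Cauchy_Schwarz bounded_operator_L2[OF T] g w)
      also have "\<dots> \<le> C * ?a * ?b"
        by (intro mult_right_mono C g) simp
      finally show ?thesis using True by auto
    next
      case False
      define g' w' where "g' x = inverse (of_real ?a) * g x" and "w' x = inverse (of_real ?b) * w x" for x
      have adm: "adm f g'" "adm u w'"
        using g w False unfolding adm_def g'_def[abs_def] w'_def[abs_def]
        by (auto simp: L2_norm_scale L2_inner_scale_left norm_inverse)
      then have "cmod (L2_inner M (T g') w') \<le> \<sigma>"
        unfolding \<sigma>_def by (intro cSup_upper bdd) (auto simp: A_def)
      moreover have "L2_inner M (T g') w' = inverse (of_real ?a) * inverse (of_real ?b) * L2_inner M (T g) w"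
      proof -
        have "L2_inner M (T g') w' = L2_inner M (\<lambda>x. inverse (of_real ?a) * T g x) w'"
          unfolding g'_def[abs_def]
          by (intro L2_inner_cong_AE L2_measurable bounded_operator_scale[OF T g(1)])
            (use adm in \<open>auto simp: adm_def intro!: bounded_operator_L2[OF T] g\<close>)
        then show ?thesis
          by (simp add: L2_inner_scale_left L2_inner_scale_right w'_def[abs_def])
      qed
      ultimately have "cmod (L2_inner M (T g) w) / (?a * ?b) \<le> \<sigma>"
        by (simp add: norm_mult norm_inverse divide_inverse mult_ac)
      moreover have "0 < ?a * ?b"
        using False L2_norm_nonneg[of M g] L2_norm_nonneg[of M w] by (simp add: less_eq_real_def)
      ultimately show ?thesis by (simp add: divide_le_eq mult.assoc)
    qed
  qed
  moreover obtain g w where g: "adm f g" and w: "adm u w" and near: "\<sigma> \<le> 2 * cmod (L2_inner M (T g) w)"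
  proof (cases "\<sigma> = 0")
    \<comment> \<open>If \<sigma> = 0 there may be no unit vector left to choose; the zero vector
      then keeps the construction going.\<close>
    case True
    then show ?thesis by (intro that[of "\<lambda>x. 0" "\<lambda>x. 0"] zero) simp
  next
    case False
    then have "\<sigma> / 2 < Sup A" using \<sigma> by (simp add: \<sigma>_def)
    then obtain a where "a \<in> A" "\<sigma> / 2 < a"
      using less_cSupE \<open>0 \<in> A\<close> by (metis empty_iff)
    then show ?thesis using that by (force simp: A_def)
  qed
  have ext: "orthonormal_or_zero M (Suc n) (v(n := g))"
    if "orthonormal_or_zero M n v" and "adm v g" for v g
    using that L2_inner_commute[of M "v _" g]
    by (auto simp: orthonormal_or_zero_def adm_def less_Suc_eq)
  show ?thesis
  proof (rule that[of "f(n := g)" "u(n := w)"])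
    show "singular_number M T (2 * n) \<le> 2 * cmod (L2_inner M (T ((f(n := g)) n)) ((u(n := w)) n))"
      using calculation near by simp
  qed (use ext[OF f g] ext[OF u w] in auto)
qed

text \<open>Dependent choice strings the greedy steps into two infinite systems, along which the
  matrix entries |<T f_n, u_n>| dominate the even singular numbers. A bound on such diagonal sums is
  easy for nuclear operators, where no explicit approximants are at hand.\<close>

theorem trace_classI:
  assumes T: "bounded_operator M M T"
    and C: "\<And>n f u. orthonormal_or_zero M n f \<Longrightarrow> orthonormal_or_zero M n u \<Longrightarrow>
      (\<Sum>i<n. cmod (L2_inner M (T (f i)) (u i))) \<le> C"
  shows "trace_class M T"
proof -
  let ?s = "singular_number M T"
  define P where "P n s \<longleftrightarrow> orthonormal_or_zero M n (fst s) \<and> orthonormal_or_zero M n (snd s)"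
    for n :: nat and s :: "(nat \<Rightarrow> 'a \<Rightarrow> complex) \<times> (nat \<Rightarrow> 'a \<Rightarrow> complex)"
  define Q where "Q n s s' \<longleftrightarrow> (\<forall>i<n. fst s' i = fst s i \<and> snd s' i = snd s i) \<and>
      ?s (2 * n) \<le> 2 * cmod (L2_inner M (T (fst s' n)) (snd s' n))"
    for n :: nat and s s' :: "(nat \<Rightarrow> 'a \<Rightarrow> complex) \<times> (nat \<Rightarrow> 'a \<Rightarrow> complex)"
  have "\<exists>S. \<forall>n. P n (S n) \<and> Q n (S n) (S (Suc n))"
  proof (rule dependent_nat_choice)
    show "\<exists>s. P 0 s" by (auto simp: P_def orthonormal_or_zero_def)
    fix s n assume "P n s"
    then have "orthonormal_or_zero M n (fst s)" "orthonormal_or_zero M n (snd s)"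
      by (auto simp: P_def)
    from singular_number_greedy[OF T this]
    obtain f' u' where "orthonormal_or_zero M (Suc n) f'" "orthonormal_or_zero M (Suc n) u'"
      "\<And>i. i < n \<Longrightarrow> f' i = fst s i" "\<And>i. i < n \<Longrightarrow> u' i = snd s i"
      "?s (2 * n) \<le> 2 * cmod (L2_inner M (T (f' n)) (u' n))"
      by metis
    then show "\<exists>y. P (Suc n) y \<and> Q n s y"
      by (intro exI[of _ "(f', u')"]) (auto simp: P_def Q_def)
  qed
  then obtain S where S: "\<And>n. P n (S n)" "\<And>n. Q n (S n) (S (Suc n))" by blast
  \<comment> \<open>Step i fixes the i-th vectors for good, so all inequalities chosen up to stage
    \<open>n\<close> can be read off from the single pair of systems \<open>S n\<close>.\<close>
  have stable: "fst (S (Suc (i + k))) i = fst (S (Suc i)) i \<and> snd (S (Suc (i + k))) i = snd (S (Suc i)) i" for i k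
  proof (induction k)
    case (Suc k)
    then show ?case using S(2)[of "Suc (i + k)"] by (simp add: Q_def)
  qed simp
  have even: "(\<Sum>i<n. ?s (2 * i)) \<le> 2 * C" for n
  proof -
    have "(\<Sum>i<n. ?s (2 * i)) \<le> (\<Sum>i<n. 2 * cmod (L2_inner M (T (fst (S n) i)) (snd (S n) i)))"
    proof (rule sum_mono)
      fix i assume "i \<in> {..<n}"
      then obtain k where "n = Suc (i + k)" by (auto dest: less_imp_Suc_add)
      then show "?s (2 * i) \<le> 2 * cmod (L2_inner M (T (fst (S n) i)) (snd (S n) i))"
        using S(2)[of i] stable[of i k] by (simp add: Q_def)
    qed
    also have "\<dots> \<le> 2 * C"
      using C[of n "fst (S n)" "snd (S n)"] S(1)[of n] by (simp add: P_def flip: sum_distrib_left)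
    finally show ?thesis .
  qed
  \<comment> \<open>Each odd-indexed singular number is at most its even-indexed predecessor, which
    doubles the bound 2 C for the even ones.\<close>
  have "(\<Sum>i<n. ?s i) \<le> 4 * C" for n
  proof -
    have "(\<Sum>i<n. ?s i) \<le> (\<Sum>i<2 * n. ?s i)"
      by (intro sum_mono2) (auto intro: singular_number_nonneg[OF T])
    also have "\<dots> = (\<Sum>i<n. ?s (2 * i) + ?s (2 * i + 1))"
      by (induction n) simp_all
    also have "\<dots> \<le> (\<Sum>i<n. 2 * ?s (2 * i))"
    proof (rule sum_mono)
      show "?s (2 * i) + ?s (2 * i + 1) \<le> 2 * ?s (2 * i)" for i
        using singular_number_antimono[OF T, of "2 * i" "2 * i + 1"] by simp
    qed
    also have "\<dots> \<le> 4 * C"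
      using even[of n] by (simp flip: sum_distrib_left)
    finally show ?thesis .
  qed
  then have "summable ?s"
    by (intro summableI_nonneg_bounded[of _ "4 * C"] singular_number_nonneg[OF T])
  then show ?thesis using T by (simp add: trace_class_def)
qed

subsection \<open>Nuclear operators\<close>

text \<open>Thanks to the pointwise bound on \<open>g\<close> the series converges at every point of
  the space, so \<open>T_eq\<close> is an equation between representatives. One uniform
  \<open>B\<close> bounds all vectors; the summability sits in \<open>a\<close> alone.\<close>

locale nuclear_operator =
  fixes M :: "'a measure" and T :: "('a \<Rightarrow> complex) \<Rightarrow> 'a \<Rightarrow> complex"
    and a :: "nat \<Rightarrow> complex" and g h :: "nat \<Rightarrow> 'a \<Rightarrow> complex" and B :: real
  assumes a_summable: "summable (\<lambda>j. cmod (a j))"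
    and g_L2: "\<And>j. g j \<in> L2 M" and h_L2: "\<And>j. h j \<in> L2 M"
    and g_norm: "\<And>j. L2_norm M (g j) \<le> B" and h_norm: "\<And>j. L2_norm M (h j) \<le> B"
    and g_bound: "\<And>j x. x \<in> space M \<Longrightarrow> cmod (g j x) \<le> B"
    and T_eq: "\<And>f x. f \<in> L2 M \<Longrightarrow> x \<in> space M \<Longrightarrow> T f x = (\<Sum>j. a j * L2_inner M f (h j) * g j x)"
begin

lemma B_nonneg: "0 \<le> B"
  using g_norm[of 0] L2_norm_nonneg[of M "g 0"] by linarith

lemma inner_h_bound:
  assumes f: "f \<in> L2 M"
  shows "cmod (L2_inner M f (h j)) \<le> B * L2_norm M f"
proof -
  have "cmod (L2_inner M f (h j)) \<le> L2_norm M f * L2_norm M (h j)"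
    by (rule L2_Cauchy_Schwarz[OF f h_L2])
  also have "\<dots> \<le> L2_norm M f * B"
    by (rule mult_left_mono[OF h_norm L2_norm_nonneg])
  finally show ?thesis by (simp only: mult.commute)
qed

lemma series_summable:
  assumes f: "f \<in> L2 M" and x: "x \<in> space M"
  shows "summable (\<lambda>j. a j * L2_inner M f (h j) * g j x)"
proof (rule summable_comparison_test'[of _ 0])
  show "summable (\<lambda>j. cmod (a j) * (B * L2_norm M f * B))"
    by (rule summable_mult2[OF a_summable])
  show "norm (a j * L2_inner M f (h j) * g j x) \<le> cmod (a j) * (B * L2_norm M f * B)" for j
    unfolding norm_mult mult.assoc[of "cmod (a j)"]
    by (intro mult_left_mono mult_mono inner_h_bound f g_bound x)
      (auto intro!: mult_nonneg_nonneg B_nonneg)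
qed

definition partial_series :: "nat \<Rightarrow> ('a \<Rightarrow> complex) \<Rightarrow> 'a \<Rightarrow> complex" where
  "partial_series n f x = (\<Sum>j<n. a j * L2_inner M f (h j) * g j x)"

lemma partial_series_L2: "partial_series n f \<in> L2 M"
  unfolding partial_series_def[abs_def] by (intro L2_sum L2_scale g_L2)

lemma partial_series_tendsto:
  "f \<in> L2 M \<Longrightarrow> x \<in> space M \<Longrightarrow> (\<lambda>n. partial_series n f x) \<longlonglongrightarrow> T f x"
  unfolding partial_series_def by (simp add: T_eq summable_LIMSEQ series_summable)

lemma T_measurable:
  assumes f: "f \<in> L2 M"
  shows "T f \<in> borel_measurable M"
proof -
  have "(\<lambda>x. \<Sum>j. a j * L2_inner M f (h j) * g j x) \<in> borel_measurable M"
    using g_L2[THEN L2_measurable] by measurable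
  then show ?thesis
    using measurable_cong[of M "T f" "\<lambda>x. \<Sum>j. a j * L2_inner M f (h j) * g j x" borel] T_eq[OF f] by simp
qed

text \<open>\<open>L2_Fatou\<close> applied to the blocks from \<open>n\<close> to \<open>k\<close>.
  The case n = 0 yields boundedness of \<open>T\<close>, large \<open>n\<close> the norm convergence
  of the partial sums.\<close>

lemma T_minus_partial_series:
  assumes f: "f \<in> L2 M"
  shows "(\<lambda>x. T f x - partial_series n f x) \<in> L2 M"
    and "L2_norm M (\<lambda>x. T f x - partial_series n f x)
      \<le> ((\<Sum>j. cmod (a j)) - (\<Sum>j<n. cmod (a j))) * (B\<^sup>2 * L2_norm M f)"
proof -
  have meas: "(\<lambda>x. T f x - partial_series n f x) \<in> borel_measurable M"
    using T_measurable[OF f] L2_measurable[OF partial_series_L2] by measurable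
  have lim: "AE x in M. (\<lambda>k. partial_series k f x - partial_series n f x) \<longlonglongrightarrow> T f x - partial_series n f x"
    by (intro AE_I2 tendsto_diff partial_series_tendsto f tendsto_const)
  have bound: "L2_norm M (\<lambda>x. partial_series k f x - partial_series n f x)
      \<le> ((\<Sum>j. cmod (a j)) - (\<Sum>j<n. cmod (a j))) * (B\<^sup>2 * L2_norm M f)" if k: "k \<ge> n" for k
  proof -
    have split: "{..<k} = {..<n} \<union> {n..<k}" "{..<n} \<inter> {n..<k} = {}"
      using k by auto
    have "L2_norm M (\<lambda>x. partial_series k f x - partial_series n f x)
        = L2_norm M (\<lambda>x. \<Sum>j\<in>{n..<k}. a j * L2_inner M f (h j) * g j x)"
      unfolding partial_series_def split(1) by (subst sum.union_disjoint) (use split in auto)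
    also have "\<dots> \<le> (\<Sum>j\<in>{n..<k}. L2_norm M (\<lambda>x. a j * L2_inner M f (h j) * g j x))"
      by (intro L2_norm_sum_le L2_scale g_L2)
    also have "\<dots> \<le> (\<Sum>j\<in>{n..<k}. cmod (a j) * (B\<^sup>2 * L2_norm M f))"
    proof (rule sum_mono)
      fix j
      have "cmod (L2_inner M f (h j)) * L2_norm M (g j) \<le> (B * L2_norm M f) * B"
        by (intro mult_mono inner_h_bound f g_norm mult_nonneg_nonneg B_nonneg L2_norm_nonneg)
      then have "cmod (a j) * (cmod (L2_inner M f (h j)) * L2_norm M (g j)) \<le> cmod (a j) * ((B * L2_norm M f) * B)"
        by (rule mult_left_mono) simp
      then show "L2_norm M (\<lambda>x. a j * L2_inner M f (h j) * g j x) \<le> cmod (a j) * (B\<^sup>2 * L2_norm M f)"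
        unfolding L2_norm_scale norm_mult power2_eq_square by (simp only: mult_ac)
    qed
    also have "\<dots> = ((\<Sum>j<k. cmod (a j)) - (\<Sum>j<n. cmod (a j))) * (B\<^sup>2 * L2_norm M f)"
      unfolding split(1) by (subst sum.union_disjoint) (use split in \<open>auto simp: sum_distrib_right\<close>)
    also have "\<dots> \<le> ((\<Sum>j. cmod (a j)) - (\<Sum>j<n. cmod (a j))) * (B\<^sup>2 * L2_norm M f)"
      by (intro mult_right_mono diff_right_mono sum_le_suminf a_summable) auto
    finally show ?thesis .
  qed
  note F = L2_Fatou[OF L2_diff[OF partial_series_L2 partial_series_L2] meas lim bound]
  show "(\<lambda>x. T f x - partial_series n f x) \<in> L2 M" by (rule F)
  show "L2_norm M (\<lambda>x. T f x - partial_series n f x)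
      \<le> ((\<Sum>j. cmod (a j)) - (\<Sum>j<n. cmod (a j))) * (B\<^sup>2 * L2_norm M f)" by (rule F)
qed

lemma T_L2: "f \<in> L2 M \<Longrightarrow> T f \<in> L2 M"
  using T_minus_partial_series(1)[of f 0] by (simp add: partial_series_def)

lemma T_norm: "f \<in> L2 M \<Longrightarrow> L2_norm M (T f) \<le> (\<Sum>j. cmod (a j)) * (B\<^sup>2 * L2_norm M f)"
  using T_minus_partial_series(2)[of f 0] by (simp add: partial_series_def)

lemma T_bounded: "bounded_operator M M T"
  unfolding bounded_operator_def
proof (intro conjI ballI allI)
  fix f k assume f: "f \<in> L2 M" and k: "k \<in> L2 M"
  show "AE x in M. T (\<lambda>y. f y + k y) x = T f x + T k x"
    using suminf_add[OF series_summable[OF f] series_summable[OF k]]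
    by (intro AE_I2) (simp add: T_eq f k L2_add L2_inner_add_left h_L2 algebra_simps)
next
  fix c f assume f: "f \<in> L2 M"
  show "AE x in M. T (\<lambda>y. c * f y) x = c * T f x"
    using suminf_mult[OF series_summable[OF f], of _ c]
    by (intro AE_I2) (simp add: T_eq f L2_scale L2_inner_scale_left algebra_simps)
next
  show "\<exists>K. \<forall>f\<in>L2 M. L2_norm M (T f) \<le> K * L2_norm M f"
    using T_norm by (intro exI[of _ "(\<Sum>j. cmod (a j)) * B\<^sup>2"]) (simp add: mult.assoc)
qed (rule T_L2)

lemma T_inner_sums:
  assumes f: "f \<in> L2 M" and u: "u \<in> L2 M"
  shows "(\<lambda>j. a j * L2_inner M f (h j) * L2_inner M (g j) u) sums L2_inner M (T f) u"
proof -
  have "(\<lambda>n. L2_norm M (\<lambda>x. partial_series n f x - T f x)) \<longlonglongrightarrow> 0"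
  proof (rule tendsto_sandwich[OF _ _ tendsto_const])
    show "\<forall>\<^sub>F n in sequentially. L2_norm M (\<lambda>x. partial_series n f x - T f x)
        \<le> ((\<Sum>j. cmod (a j)) - (\<Sum>j<n. cmod (a j))) * (B\<^sup>2 * L2_norm M f)"
      using T_minus_partial_series(2)[OF f] by (simp add: L2_norm_minus_commute[of M "partial_series _ f"])
    have "(\<lambda>n. ((\<Sum>j. cmod (a j)) - (\<Sum>j<n. cmod (a j))) * (B\<^sup>2 * L2_norm M f))
        \<longlonglongrightarrow> ((\<Sum>j. cmod (a j)) - (\<Sum>j. cmod (a j))) * (B\<^sup>2 * L2_norm M f)"
      by (intro tendsto_intros summable_LIMSEQ a_summable)
    then show "(\<lambda>n. ((\<Sum>j. cmod (a j)) - (\<Sum>j<n. cmod (a j))) * (B\<^sup>2 * L2_norm M f)) \<longlonglongrightarrow> 0"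
      by simp
  qed simp
  from L2_inner_tendsto[OF partial_series_L2 T_L2[OF f] u this]
  have "(\<lambda>n. L2_inner M (partial_series n f) u) \<longlonglongrightarrow> L2_inner M (T f) u" .
  moreover have "L2_inner M (partial_series n f) u = (\<Sum>j<n. a j * L2_inner M f (h j) * L2_inner M (g j) u)" for n
    unfolding partial_series_def
    by (subst L2_inner_sum_left) (auto simp: L2_inner_scale_left intro!: L2_scale g_L2 u)
  ultimately show ?thesis by (simp add: sums_def)
qed

lemma T_inner_abs_summable:
  assumes f: "f \<in> L2 M" and u: "u \<in> L2 M"
  shows "summable (\<lambda>j. cmod (a j) * (cmod (L2_inner M f (h j)) * cmod (L2_inner M (g j) u)))"
proof (rule summable_comparison_test'[of _ 0])
  show "summable (\<lambda>j. cmod (a j) * (B * L2_norm M f * (B * L2_norm M u)))"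
    by (rule summable_mult2[OF a_summable])
  have "cmod (L2_inner M (g j) u) \<le> B * L2_norm M u" for j
    using L2_Cauchy_Schwarz[OF g_L2 u] mult_right_mono[OF g_norm L2_norm_nonneg, of j M u] order_trans by blast
  then show "norm (cmod (a j) * (cmod (L2_inner M f (h j)) * cmod (L2_inner M (g j) u)))
      \<le> cmod (a j) * (B * L2_norm M f * (B * L2_norm M u))" for j
    by (auto intro!: mult_left_mono mult_mono inner_h_bound f mult_nonneg_nonneg B_nonneg)
qed

text \<open>Exchanging the sums over i and j leaves, for each j, a product of coefficients of
  \<open>h j\<close> and \<open>g j\<close> in two orthonormal systems; Bessel bounds it by B^2, and
  \<open>a\<close> is summable.\<close>

theorem T_trace_class: "trace_class M T"
proof (rule trace_classI[OF T_bounded])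
  fix n :: nat and f u
  assume f: "orthonormal_or_zero M n f" and u: "orthonormal_or_zero M n u"
  have fL2: "f i \<in> L2 M" and uL2: "u i \<in> L2 M" if "i < n" for i
    using f u that by (auto simp: orthonormal_or_zero_def)
  let ?t = "\<lambda>i j. cmod (a j) * (cmod (L2_inner M (f i) (h j)) * cmod (L2_inner M (g j) (u i)))"
  have sum: "summable (?t i)" if "i < n" for i
    by (rule T_inner_abs_summable[OF fL2[OF that] uL2[OF that]])
  have "(\<Sum>i<n. cmod (L2_inner M (T (f i)) (u i))) \<le> (\<Sum>i<n. \<Sum>j. ?t i j)"
  proof (rule sum_mono)
    fix i assume "i \<in> {..<n}"
    then have i: "i < n" by simp
    have "L2_inner M (T (f i)) (u i) = (\<Sum>j. a j * L2_inner M (f i) (h j) * L2_inner M (g j) (u i))"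
      using T_inner_sums[OF fL2[OF i] uL2[OF i]] by (simp add: sums_iff)
    also have "cmod \<dots> \<le> (\<Sum>j. ?t i j)"
      using summable_norm[of "\<lambda>j. a j * L2_inner M (f i) (h j) * L2_inner M (g j) (u i)"] sum[OF i]
      by (simp add: norm_mult mult.assoc)
    finally show "cmod (L2_inner M (T (f i)) (u i)) \<le> (\<Sum>j. ?t i j)" .
  qed
  also have "\<dots> = (\<Sum>j. \<Sum>i<n. ?t i j)"
    by (rule suminf_sum[symmetric]) (use sum in auto)
  also have "\<dots> \<le> (\<Sum>j. cmod (a j) * B\<^sup>2)"
  proof (rule suminf_le)
    fix j
    have "cmod (L2_inner M (f i) (h j)) = cmod (L2_inner M (h j) (f i))" for i
      by (subst L2_inner_commute) simp
    then have "(\<Sum>i<n. ?t i j)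
        = cmod (a j) * (\<Sum>i<n. cmod (L2_inner M (h j) (f i)) * cmod (L2_inner M (g j) (u i)))"
      by (simp add: sum_distrib_left)
    also have "\<dots> \<le> cmod (a j) * (L2_norm M (h j) * L2_norm M (g j))"
      by (intro mult_left_mono Bessel_product f u g_L2 h_L2) simp
    also have "\<dots> \<le> cmod (a j) * B\<^sup>2"
      unfolding power2_eq_square by (intro mult_left_mono mult_mono g_norm h_norm B_nonneg) auto
    finally show "(\<Sum>i<n. ?t i j) \<le> cmod (a j) * B\<^sup>2" .
  qed (use sum in \<open>auto intro!: summable_sum summable_mult2 a_summable\<close>)
  finally show "(\<Sum>i<n. cmod (L2_inner M (T (f i)) (u i))) \<le> (\<Sum>j. cmod (a j) * B\<^sup>2)" .
qed

end

subsection \<open>Invertibility\<close>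

text \<open>The inverse is a choice of preimages. The lower bound makes preimages unique almost
  everywhere, and this uniqueness gives linearity and the left inverse property; the bound itself
  gives continuity.\<close>

lemma invertible_operatorI:
  assumes T: "bounded_operator M M T"
    and surj: "\<And>f. f \<in> L2 M \<Longrightarrow> \<exists>g\<in>L2 M. AE x in M. T g x = f x"
    and below: "\<And>g. g \<in> L2 M \<Longrightarrow> L2_norm M g \<le> K * L2_norm M (T g)"
  shows "invertible_operator M T"
proof -
  define S where "S f = (SOME g. g \<in> L2 M \<and> (AE x in M. T g x = f x))" for f
  have S: "S f \<in> L2 M" "AE x in M. T (S f) x = f x" if "f \<in> L2 M" for f
    using someI_ex[of "\<lambda>g. g \<in> L2 M \<and> (AE x in M. T g x = f x)"] surj[OF that]
    unfolding S_def by blast+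
  have inj: "AE x in M. g x = k x"
    if g: "g \<in> L2 M" and k: "k \<in> L2 M" and eq: "AE x in M. T g x = T k x" for g k
  proof -
    have gk: "(\<lambda>x. g x - k x) \<in> L2 M" using g k by (rule L2_diff)
    have "AE x in M. T (\<lambda>x. g x - k x) x = 0"
      using bounded_operator_diff[OF T g k] eq by eventually_elim simp
    then have "L2_norm M (T (\<lambda>x. g x - k x)) = 0"
      using L2_norm_eq_0[OF bounded_operator_L2[OF T gk]] by blast
    then have "L2_norm M (\<lambda>x. g x - k x) = 0"
      using below[OF gk] L2_norm_nonneg[of M "\<lambda>x. g x - k x"] by simp
    then have "AE x in M. g x - k x = 0"
      using L2_norm_eq_0[OF gk] by blast
    then show ?thesis by eventually_elim simp
  qed
  have "bounded_operator M M S"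
    unfolding bounded_operator_def
  proof (intro conjI ballI allI)
    fix f g assume f: "f \<in> L2 M" and g: "g \<in> L2 M"
    show "AE x in M. S (\<lambda>y. f y + g y) x = S f x + S g x"
    proof (rule inj)
      show "AE x in M. T (S (\<lambda>y. f y + g y)) x = T (\<lambda>x. S f x + S g x) x"
        using S(2)[OF L2_add[OF f g]] S(2)[OF f] S(2)[OF g] bounded_operator_add[OF T S(1)[OF f] S(1)[OF g]]
        by eventually_elim simp
    qed (intro S L2_add f g)+
  next
    fix c f assume f: "f \<in> L2 M"
    show "AE x in M. S (\<lambda>y. c * f y) x = c * S f x"
    proof (rule inj)
      show "AE x in M. T (S (\<lambda>y. c * f y)) x = T (\<lambda>x. c * S f x) x"
        using S(2)[OF L2_scale[OF f, of c]] S(2)[OF f] bounded_operator_scale[OF T S(1)[OF f], of c]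
        by eventually_elim simp
    qed (intro S L2_scale f)+
  next
    show "\<exists>K. \<forall>f\<in>L2 M. L2_norm M (S f) \<le> K * L2_norm M f"
    proof (intro exI ballI)
      fix f assume f: "f \<in> L2 M"
      have "L2_norm M (T (S f)) = L2_norm M f"
        by (intro L2_norm_cong_AE S f L2_measurable bounded_operator_L2[OF T])
      then show "L2_norm M (S f) \<le> K * L2_norm M f"
        using below[OF S(1)[OF f]] by simp
    qed
  qed (rule S)
  moreover have "AE x in M. S (T f) x = f x" if f: "f \<in> L2 M" for f
    by (rule inj) (rule S bounded_operator_L2[OF T] f)+
  ultimately have "inverse_operator M T S"
    unfolding inverse_operator_def using S(2) by (intro conjI ballI)
  then show ?thesis
    unfolding invertible_operator_def using T by (intro conjI exI)
qed

lemma inverse_operator_inv: "invertible_operator M T \<Longrightarrow> inverse_operator M T (operator_inv M T)"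
  using someI[of "inverse_operator M T"] unfolding invertible_operator_def operator_inv_def by blast

lemma bounded_operator_add_id:
  assumes R: "bounded_operator M M R"
  shows "bounded_operator M M (\<lambda>f x. f x + c * R f x)"
proof -
  obtain K where K: "\<And>f. f \<in> L2 M \<Longrightarrow> L2_norm M (R f) \<le> K * L2_norm M f"
    using bounded_operator_bound[OF R] by blast
  show ?thesis
    unfolding bounded_operator_def
  proof (intro conjI ballI allI)
    fix f g assume f: "f \<in> L2 M" and g: "g \<in> L2 M"
    show "AE x in M. f x + g x + c * R (\<lambda>y. f y + g y) x = f x + c * R f x + (g x + c * R g x)"
      using bounded_operator_add[OF R f g] by eventually_elim (simp add: distrib_left)
  next
    fix d f assume f: "f \<in> L2 M"
    show "AE x in M. d * f x + c * R (\<lambda>y. d * f y) x = d * (f x + c * R f x)"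
      using bounded_operator_scale[OF R f, of d] by eventually_elim (simp add: distrib_left)
  next
    show "\<exists>K. \<forall>f\<in>L2 M. L2_norm M (\<lambda>x. f x + c * R f x) \<le> K * L2_norm M f"
    proof (intro exI ballI)
      fix f assume f: "f \<in> L2 M"
      have "L2_norm M (\<lambda>x. f x + c * R f x) \<le> L2_norm M f + cmod c * L2_norm M (R f)"
        using L2_norm_triangle[OF f L2_scale[OF bounded_operator_L2[OF R f], of c]]
        by (simp add: L2_norm_scale)
      also have "\<dots> \<le> (1 + cmod c * K) * L2_norm M f"
        using mult_left_mono[OF K[OF f] norm_ge_zero[of c]] by (simp add: distrib_right mult.assoc)
      finally show "L2_norm M (\<lambda>x. f x + c * R f x) \<le> (1 + cmod c * K) * L2_norm M f" .
    qed
  qed (intro L2_add L2_scale bounded_operator_L2[OF R])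
qed

text \<open>Instead of summing powers of the operator, the fixed point of g -> f - c R g is reached
  by iteration from 0. This needs only completeness of L^2 and works directly on
  representatives.\<close>

theorem Neumann_invertible:
  assumes R: "bounded_operator M M R" and "0 \<le> q" and "cmod c * q < 1"
    and bound: "\<And>f. f \<in> L2 M \<Longrightarrow> L2_norm M (R f) \<le> q * L2_norm M f"
  shows "invertible_operator M (\<lambda>f x. f x + c * R f x)"
proof -
  define T where "T f x = c * R f x" for f x
  define p where "p = cmod c * q"
  have p: "0 \<le> p" "p < 1" using assms by (auto simp: p_def)
  have T_L2: "T f \<in> L2 M" if "f \<in> L2 M" for f
    unfolding T_def[abs_def] by (intro L2_scale bounded_operator_L2[OF R that])
  have T_diff_norm: "L2_norm M (\<lambda>x. T f x - T g x) \<le> p * L2_norm M (\<lambda>x. f x - g x)"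
    if f: "f \<in> L2 M" and g: "g \<in> L2 M" for f g
  proof -
    have eq: "AE x in M. T f x - T g x = c * R (\<lambda>x. f x - g x) x"
      using bounded_operator_diff[OF R f g] by eventually_elim (simp add: T_def right_diff_distrib)
    have "L2_norm M (\<lambda>x. T f x - T g x) = L2_norm M (\<lambda>x. c * R (\<lambda>x. f x - g x) x)"
      by (intro L2_norm_cong_AE eq L2_measurable L2_diff T_L2 f g L2_scale bounded_operator_L2[OF R])
    also have "\<dots> \<le> cmod c * (q * L2_norm M (\<lambda>x. f x - g x))"
      unfolding L2_norm_scale by (intro mult_left_mono bound L2_diff f g) simp
    finally show ?thesis by (simp add: p_def mult.assoc)
  qed
  have T_norm: "L2_norm M (T f) \<le> p * L2_norm M f" if f: "f \<in> L2 M" for f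
    unfolding T_def[abs_def] L2_norm_scale p_def
    using mult_left_mono[OF bound[OF f] norm_ge_zero[of c]] by (simp add: mult.assoc)
  show ?thesis
  proof (rule invertible_operatorI[OF bounded_operator_add_id[OF R]])
    fix g assume g: "g \<in> L2 M"
    have "L2_norm M g \<le> L2_norm M (\<lambda>x. g x + T g x) + L2_norm M (T g)"
      using L2_norm_triangle_diff[OF L2_add[OF g T_L2[OF g]] T_L2[OF g]] by simp
    with T_norm[OF g] have "(1 - p) * L2_norm M g \<le> L2_norm M (\<lambda>x. g x + T g x)"
      by (simp add: left_diff_distrib)
    then show "L2_norm M g \<le> inverse (1 - p) * L2_norm M (\<lambda>x. g x + c * R g x)"
      using p by (simp add: T_def field_simps)
  next
    fix f assume f: "f \<in> L2 M"
    define G where "G = rec_nat (\<lambda>x. 0) (\<lambda>_ k x. f x - T k x)"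
    have G0: "G 0 = (\<lambda>x. 0)" and GS: "G (Suc n) = (\<lambda>x. f x - T (G n) x)" for n
      by (simp_all add: G_def)
    have G: "G n \<in> L2 M" for n
      by (induction n) (simp_all add: G0 GS L2_diff f T_L2)
    \<comment> \<open>The bound is the solution b of b = |f| + p b, hence it is preserved by the
      iteration.\<close>
    have Gb: "L2_norm M (G n) \<le> L2_norm M f / (1 - p)" for n
    proof (induction n)
      case (Suc n)
      have "L2_norm M (G (Suc n)) \<le> L2_norm M f + L2_norm M (T (G n))"
        unfolding GS by (rule L2_norm_triangle_diff[OF f T_L2[OF G]])
      also have "\<dots> \<le> L2_norm M f + p * (L2_norm M f / (1 - p))"
        using T_norm[OF G, of n] mult_left_mono[OF Suc p(1)] by linarith
      also have "\<dots> = L2_norm M f / (1 - p)"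
        using p by (simp add: field_simps)
      finally show ?case .
    qed (use p in \<open>simp add: G0\<close>)
    have contr: "L2_norm M (\<lambda>x. G (m + n) x - G n x) \<le> p ^ n * (L2_norm M f / (1 - p))" for m n
    proof (induction n)
      case (Suc n)
      have "L2_norm M (\<lambda>x. G (m + Suc n) x - G (Suc n) x) = L2_norm M (\<lambda>x. T (G (m + n)) x - T (G n) x)"
        using L2_norm_minus_commute[of M "T (G (m + n))" "T (G n)"] by (simp add: GS)
      also have "\<dots> \<le> p * L2_norm M (\<lambda>x. G (m + n) x - G n x)"
        by (rule T_diff_norm[OF G G])
      also have "\<dots> \<le> p * (p ^ n * (L2_norm M f / (1 - p)))"
        by (rule mult_left_mono[OF Suc p(1)])
      finally show ?case by simp
    qed (use Gb in \<open>simp add: G0\<close>)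
    have Cau: "\<exists>N. \<forall>m\<ge>N. \<forall>n\<ge>N. L2_norm M (\<lambda>x. G m x - G n x) < e" if "e > 0" for e
    proof -
      have "(\<lambda>n. p ^ n * (L2_norm M f / (1 - p))) \<longlonglongrightarrow> 0 * (L2_norm M f / (1 - p))"
        using p by (intro tendsto_mult LIMSEQ_power_zero tendsto_const) auto
      then have "\<forall>\<^sub>F n in sequentially. p ^ n * (L2_norm M f / (1 - p)) < e / 2"
        using \<open>e > 0\<close> by (intro order_tendstoD) auto
      then obtain N where N: "p ^ N * (L2_norm M f / (1 - p)) < e / 2"
        by (auto simp: eventually_sequentially)
      have near: "L2_norm M (\<lambda>x. G m x - G N x) < e / 2" if "m \<ge> N" for m
      proof -
        have "L2_norm M (\<lambda>x. G m x - G N x) \<le> p ^ N * (L2_norm M f / (1 - p))"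
          using contr[of "m - N" N] that by (simp only: le_add_diff_inverse2)
        with N show ?thesis by linarith
      qed
      have "L2_norm M (\<lambda>x. G m x - G n x) < e" if "m \<ge> N" "n \<ge> N" for m n
        using L2_norm_triangle_diff[OF L2_diff[OF G G] L2_diff[OF G G], of m N n N]
          near[OF that(1)] near[OF that(2)] by simp
      then show ?thesis by blast
    qed
    obtain g where g: "g \<in> L2 M" and lim: "(\<lambda>n. L2_norm M (\<lambda>x. G n x - g x)) \<longlonglongrightarrow> 0"
      using L2_complete[of G M, OF G Cau] by blast
    have res: "(\<lambda>x. g x + T g x - f x) \<in> L2 M"
      by (intro L2_diff L2_add g T_L2 f)
    \<comment> \<open>The residual of the limit is compared with G (Suc n) + T (G n) - f = 0; both
      differences tend to 0 with \<open>n\<close>, so the residual vanishes.\<close>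
    have le: "L2_norm M (\<lambda>x. g x + T g x - f x)
        \<le> L2_norm M (\<lambda>x. G (Suc n) x - g x) + p * L2_norm M (\<lambda>x. G n x - g x)" for n
    proof -
      have "L2_norm M (\<lambda>x. g x + T g x - f x) = L2_norm M (\<lambda>x. (G (Suc n) x - g x) + (T (G n) x - T g x))"
        using L2_norm_minus_commute[of M "\<lambda>x. g x + T g x" f] by (simp add: GS algebra_simps)
      also have "\<dots> \<le> L2_norm M (\<lambda>x. G (Suc n) x - g x) + L2_norm M (\<lambda>x. T (G n) x - T g x)"
        by (intro L2_norm_triangle L2_diff G g T_L2)
      finally show ?thesis using T_diff_norm[OF G g, of n] by simp
    qed
    have "(\<lambda>n. L2_norm M (\<lambda>x. G (Suc n) x - g x) + p * L2_norm M (\<lambda>x. G n x - g x)) \<longlonglongrightarrow> 0 + p * 0"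
      by (intro tendsto_intros lim LIMSEQ_Suc)
    then have "L2_norm M (\<lambda>x. g x + T g x - f x) \<le> 0 + p * 0"
      by (rule LIMSEQ_le_const) (use le in blast)
    then have "L2_norm M (\<lambda>x. g x + T g x - f x) = 0"
      using L2_norm_nonneg[of M "\<lambda>x. g x + T g x - f x"] by linarith
    then have "AE x in M. g x + T g x - f x = 0"
      using L2_norm_eq_0[OF res] by blast
    then have "AE x in M. g x + c * R g x = f x"
      by eventually_elim (simp add: T_def)
    with g show "\<exists>g\<in>L2 M. AE x in M. g x + c * R g x = f x" by blast
  qed
qed

section \<open>Fredholm determinants of nuclear operators\<close>

subsection \<open>Factorially weighted sums over finite sets\<close>

lemma sum_Pow_insert:
  assumes "finite A" "a \<notin> A"
  shows "(\<Sum>J\<in>Pow (insert a A). F J) = (\<Sum>J\<in>Pow A. F J) + (\<Sum>J\<in>Pow A. F (insert a J))"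
proof -
  have inj: "inj_on (insert a) (Pow A)"
    by (rule inj_onI) (metis PowD assms(2) insert_ident subsetD)
  have "(\<Sum>J\<in>Pow (insert a A). F J) = (\<Sum>J\<in>Pow A. F J) + (\<Sum>J\<in>insert a ` Pow A. F J)"
    unfolding Pow_insert by (rule sum.union_disjoint) (use assms in auto)
  then show ?thesis
    by (simp add: sum.reindex[OF inj])
qed

text \<open>The shift \<open>p\<close> makes this recursion closed: the sets containing
  \<open>a\<close> have one more element, which moves the factorial from \<open>p\<close> to
  \<open>Suc p\<close>.\<close>

lemma sum_fact_prod_insert:
  fixes c :: "'a \<Rightarrow> real"
  assumes "finite A" "a \<notin> A"
  shows "(\<Sum>J\<in>Pow (insert a A). fact (card J + p) * prod c J)
    = (\<Sum>J\<in>Pow A. fact (card J + p) * prod c J) + c a * (\<Sum>J\<in>Pow A. fact (card J + Suc p) * prod c J)"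
proof -
  have "(\<Sum>J\<in>Pow A. fact (card (insert a J) + p) * prod c (insert a J))
      = (\<Sum>J\<in>Pow A. c a * (fact (card J + Suc p) * prod c J))"
  proof (rule sum.cong[OF refl])
    fix J assume "J \<in> Pow A"
    then have "finite J" "a \<notin> J" using assms finite_subset by auto
    then show "fact (card (insert a J) + p) * prod c (insert a J) = c a * (fact (card J + Suc p) * prod c J)"
      by simp
  qed
  then show ?thesis
    unfolding sum_Pow_insert[OF assms] by (simp add: sum_distrib_left)
qed

text \<open>With s = sum c, the k-element sets contribute at most (k + p)!/k! s^k, and these terms
  add up to p!/(1 - s)^(p + 1). The induction proves this bound directly from the recursion.\<close>

lemma sum_fact_prod_le:
  fixes c :: "'a \<Rightarrow> real"
  assumes "finite A" "\<And>a. a \<in> A \<Longrightarrow> 0 \<le> c a" "sum c A < 1"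
  shows "(\<Sum>J\<in>Pow A. fact (card J + p) * prod c J) \<le> fact p / (1 - sum c A) ^ Suc p"
  using assms
proof (induction A arbitrary: p rule: finite_induct)
  case (insert a A)
  define s where "s = sum c A"
  define y where "y = 1 - s"
  have c: "0 \<le> c a" using insert.prems by simp
  have y: "0 < y - c a" using insert by (simp add: s_def y_def)
  then have "0 < y" using c by simp
  have "sum c A < 1" using insert.hyps insert.prems(2) c by simp
  then have IH: "(\<Sum>J\<in>Pow A. fact (card J + p) * prod c J) \<le> fact p / y ^ Suc p" for p
    unfolding y_def s_def by (intro insert.IH) (use insert.prems in auto)
  have "(\<Sum>J\<in>Pow (insert a A). fact (card J + p) * prod c J)
      \<le> fact p / y ^ Suc p + c a * (fact (Suc p) / y ^ Suc (Suc p))"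
    unfolding sum_fact_prod_insert[OF insert.hyps]
    by (intro add_mono mult_left_mono IH c)
  also have "\<dots> = fact p / y ^ Suc p * (1 + real (Suc p) * (c a / y))"
    using \<open>0 < y\<close> by (simp add: field_simps)
  \<comment> \<open>Bernoulli: 1 + (p + 1) x \<le> (1 + x)^(p + 1) with x = c a / y. What remains is
    (1 + x)/y \<le> 1/(y - c a), that is y^2 - (c a)^2 \<le> y^2.\<close>
  also have "\<dots> \<le> fact p / y ^ Suc p * (1 + c a / y) ^ Suc p"
    using \<open>0 < y\<close> c by (intro mult_left_mono Bernoulli_inequality) (auto intro: order_trans[of _ 0])
  also have "\<dots> = fact p * ((1 + c a / y) / y) ^ Suc p"
    by (simp add: power_divide)
  also have "\<dots> \<le> fact p * (1 / (y - c a)) ^ Suc p"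
  proof (intro mult_left_mono power_mono)
    have "(y + c a) * (y - c a) \<le> y * y"
      by (simp add: algebra_simps)
    then show "(1 + c a / y) / y \<le> 1 / (y - c a)"
      using \<open>0 < y\<close> y by (simp add: field_simps)
  qed (use \<open>0 < y\<close> c in auto)
  also have "y - c a = 1 - sum c (insert a A)"
    using insert.hyps by (simp add: y_def s_def)
  finally show ?case by (simp only: power_one_over times_divide_eq_right mult_1_right)
qed simp

text \<open>The explicit bound needs total mass below 1. Indices from \<open>m\<close> on have mass
  below 1/2; the finitely many earlier ones are adjoined one at a time with the recursion.\<close>

lemma summable_on_fact_prod:
  fixes c :: "nat \<Rightarrow> real"
  assumes nonneg: "\<And>j. 0 \<le> c j" and "summable c"
  shows "(\<lambda>J. fact (card J) * prod c J) summable_on {J. finite J}"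
proof -
  obtain m where m: "\<And>n. norm (\<Sum>j\<in>{m..<n}. c j) < 1 / 2"
  proof -
    have "\<exists>N. \<forall>m\<ge>N. \<forall>n. norm (sum c {m..<n}) < 1 / 2"
      using \<open>summable c\<close>[unfolded summable_Cauchy, THEN spec, of "1/2", THEN mp] by (simp only: half_gt_zero_iff zero_less_one)
    then obtain N where "\<forall>m\<ge>N. \<forall>n. norm (sum c {m..<n}) < 1 / 2" ..
    then show ?thesis by (intro that[of N]) (elim allE[of _ N], simp only: order_refl simp_thms)
  qed
  have tail: "(\<Sum>J\<in>Pow A. fact (card J + p) * prod c J) \<le> fact p / (1/2) ^ Suc p"
    if A: "finite A" "A \<subseteq> {m..}" for A p
  proof -
    obtain n where "A \<subseteq> {..<n}" using A(1) finite_nat_iff_bounded by blast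
    then have "A \<subseteq> {m..<n}" using A(2) by auto
    then have "sum c A \<le> (\<Sum>j\<in>{m..<n}. c j)"
      by (intro sum_mono2) (auto simp: nonneg)
    then have half: "sum c A < 1 / 2" using m[of n] by simp
    have "(\<Sum>J\<in>Pow A. fact (card J + p) * prod c J) \<le> fact p / (1 - sum c A) ^ Suc p"
      by (rule sum_fact_prod_le) (use A half nonneg in auto)
    also have "\<dots> \<le> fact p / (1/2) ^ Suc p"
      using half by (intro divide_left_mono power_mono mult_pos_pos zero_less_power) auto
    finally show ?thesis .
  qed
  define \<phi> where "\<phi> p A = (\<Sum>J\<in>Pow A. fact (card J + p) * prod c J)" for p A
  define bounded_by where "bounded_by E p C \<longleftrightarrow> (\<forall>A. finite A \<longrightarrow> A \<subseteq> E \<union> {m..} \<longrightarrow> \<phi> p A \<le> C)" for E p C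
  \<comment> \<open>The induction runs over all \<open>p\<close> simultaneously, since adjoining an
    index calls for the bound at \<open>Suc p\<close>.\<close>
  have bound: "\<exists>C. bounded_by E p C" if "finite E" for E p
    using that
  proof (induction arbitrary: p)
    case empty
    have "bounded_by {} p (fact p / (1/2) ^ Suc p)"
      unfolding bounded_by_def \<phi>_def by (intro allI impI tail) (simp_all only: Un_empty_left)
    then show ?case ..
  next
    case (insert a E)
    obtain C where C: "bounded_by E p C" using insert.IH ..
    obtain C' where C': "bounded_by E (Suc p) C'" using insert.IH ..
    note CD = C[unfolded bounded_by_def, rule_format] and CD' = C'[unfolded bounded_by_def, rule_format]
    have "bounded_by (insert a E) p (C + c a * C')"
      unfolding bounded_by_def
    proof (intro allI impI)
      fix A assume A: "finite A" "A \<subseteq> insert a E \<union> {m..}"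
      show "\<phi> p A \<le> C + c a * C'"
      proof (cases "a \<in> A")
        case True
        have sub: "finite (A - {a})" "A - {a} \<subseteq> E \<union> {m..}" using A by auto
        have "\<phi> p (insert a (A - {a})) = \<phi> p (A - {a}) + c a * \<phi> (Suc p) (A - {a})"
          unfolding \<phi>_def by (rule sum_fact_prod_insert) (use A in auto)
        also have "\<dots> \<le> C + c a * C'"
          by (intro add_mono mult_left_mono nonneg CD CD' sub)
        finally show ?thesis using True by (simp only: insert_Diff)
      next
        case False
        then have sub: "A \<subseteq> E \<union> {m..}" using A by auto
        have "0 \<le> \<phi> (Suc p) A"
          unfolding \<phi>_def by (intro sum_nonneg mult_nonneg_nonneg prod_nonneg) (auto simp: nonneg)
        also have "\<dots> \<le> C'" by (rule CD'[OF A(1) sub])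
        finally have "0 \<le> c a * C'" by (intro mult_nonneg_nonneg nonneg)
        moreover have "\<phi> p A \<le> C" by (rule CD[OF A(1) sub])
        ultimately show ?thesis by linarith
      qed
    qed
    then show ?case ..
  qed
  obtain C where "bounded_by {..<m} 0 C"
    using bound[of "{..<m}" 0] finite_lessThan by blast
  note C = this[unfolded bounded_by_def, rule_format]
  have "UNIV = {..<m} \<union> {m..}" by (auto simp: not_less)
  show ?thesis
  proof (rule nonneg_bdd_above_summable_on)
    show "bdd_above (sum (\<lambda>J. fact (card J) * prod c J) ` {F. F \<subseteq> {J. finite J} \<and> finite F})"
    proof (rule bdd_aboveI2)
      fix F :: "nat set set" assume F: "F \<in> {F. F \<subseteq> {J. finite J} \<and> finite F}"
      then have fin: "finite (\<Union>F)" by auto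
      have "sum (\<lambda>J. fact (card J) * prod c J) F \<le> (\<Sum>J\<in>Pow (\<Union>F). fact (card J) * prod c J)"
        by (rule sum_mono2) (use fin in \<open>auto intro!: mult_nonneg_nonneg prod_nonneg nonneg\<close>)
      also have "\<dots> \<le> C" using C[OF fin] by (simp add: \<phi>_def flip: \<open>UNIV = {..<m} \<union> {m..}\<close>)
      finally show "sum (\<lambda>J. fact (card J) * prod c J) F \<le> C" .
    qed
  qed (auto intro!: mult_nonneg_nonneg prod_nonneg nonneg)
qed

subsection \<open>Products of series\<close>

text \<open>A finite family of maps lies in the product of its finite coordinate images, over which
  the sum factorises and is bounded by the product of the total sums.\<close>

lemma abs_summable_prod_PiE:
  fixes f :: "'i \<Rightarrow> 'k \<Rightarrow> complex"
  assumes fin: "finite A" and f: "\<And>x. x \<in> A \<Longrightarrow> (\<lambda>y. norm (f x y)) summable_on B x"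
  shows "(\<lambda>g. norm (\<Prod>x\<in>A. f x (g x))) summable_on PiE A B"
proof (rule nonneg_bdd_above_summable_on)
  show "bdd_above (sum (\<lambda>g. norm (\<Prod>x\<in>A. f x (g x))) ` {F. F \<subseteq> PiE A B \<and> finite F})"
  proof (rule bdd_aboveI2)
    fix F assume "F \<in> {F. F \<subseteq> PiE A B \<and> finite F}"
    then have F: "F \<subseteq> PiE A B" "finite F" by auto
    define B' where "B' x = (\<lambda>g. g x) ` F" for x
    have B': "finite (B' x)" for x using F by (simp add: B'_def)
    have B'B: "B' x \<subseteq> B x" if "x \<in> A" for x using F that by (auto simp: B'_def PiE_def)
    have sub: "F \<subseteq> PiE A B'"
    proof
      fix g assume g: "g \<in> F"
      then show "g \<in> PiE A B'"
        using F(1) by (auto simp: B'_def PiE_def extensional_def)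
    qed
    have "sum (\<lambda>g. norm (\<Prod>x\<in>A. f x (g x))) F \<le> (\<Sum>g\<in>PiE A B'. norm (\<Prod>x\<in>A. f x (g x)))"
      by (rule sum_mono2) (use sub B' fin in \<open>auto intro: finite_PiE\<close>)
    also have "\<dots> = (\<Prod>x\<in>A. \<Sum>y\<in>B' x. norm (f x y))"
      by (subst prod_sum_PiE) (use B' fin in \<open>auto simp: prod_norm\<close>)
    also have "\<dots> \<le> (\<Prod>x\<in>A. infsum (\<lambda>y. norm (f x y)) (B x))"
      by (intro prod_mono conjI sum_nonneg finite_sum_le_infsum f) (use B' B'B in auto)
    finally show "sum (\<lambda>g. norm (\<Prod>x\<in>A. f x (g x))) F \<le> (\<Prod>x\<in>A. infsum (\<lambda>y. norm (f x y)) (B x))" .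
  qed
qed auto

lemma has_sum_finite_sum:
  fixes f :: "'i \<Rightarrow> 'k \<Rightarrow> 'c::topological_comm_monoid_add"
  shows "(\<And>i. i \<in> I \<Longrightarrow> (f i has_sum s i) A) \<Longrightarrow> ((\<lambda>x. \<Sum>i\<in>I. f i x) has_sum (\<Sum>i\<in>I. s i)) A"
  by (induction I rule: infinite_finite_induct) (auto intro: has_sum_add)

lemma has_sum_prod_PiE:
  fixes f :: "'i \<Rightarrow> 'k \<Rightarrow> complex"
  assumes "finite A" "\<And>x. x \<in> A \<Longrightarrow> (\<lambda>y. norm (f x y)) summable_on B x"
  shows "((\<lambda>g. \<Prod>x\<in>A. f x (g x)) has_sum (\<Prod>x\<in>A. infsum (f x) (B x))) (PiE A B)"
  using abs_summable_summable[OF abs_summable_prod_PiE[OF assms]] infsum_prod_PiE_abs[OF assms]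
  by (simp add: has_sum_iff)

lemma has_sum_prod_PiE_nonneg:
  fixes f :: "'i \<Rightarrow> 'k \<Rightarrow> real"
  assumes "finite A" "\<And>x. x \<in> A \<Longrightarrow> f x summable_on B x" "\<And>x y. x \<in> A \<Longrightarrow> 0 \<le> f x y"
  shows "((\<lambda>g. \<Prod>x\<in>A. f x (g x)) has_sum (\<Prod>x\<in>A. infsum (f x) (B x))) (PiE A B)"
proof -
  have "(\<lambda>y. norm (complex_of_real (f x y))) summable_on B x" if "x \<in> A" for x
    using assms that by simp
  from has_sum_prod_PiE[OF assms(1) this]
  have "((\<lambda>g. complex_of_real (\<Prod>x\<in>A. f x (g x))) has_sum
      (\<Prod>x\<in>A. infsum (\<lambda>y. complex_of_real (f x y)) (B x))) (PiE A B)"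
    by simp
  moreover have "(\<Prod>x\<in>A. infsum (\<lambda>y. complex_of_real (f x y)) (B x)) = complex_of_real (\<Prod>x\<in>A. infsum (f x) (B x))"
    unfolding of_real_prod
  proof (rule prod.cong[OF refl])
    fix x assume "x \<in> A"
    then have "(f x has_sum infsum (f x) (B x)) (B x)"
      using assms by simp
    then show "infsum (\<lambda>y. complex_of_real (f x y)) (B x) = complex_of_real (infsum (f x) (B x))"
      by (intro infsumI has_sum_of_real)
  qed
  ultimately show ?thesis
    by (simp only: has_sum_of_real_iff)
qed

text \<open>The power sets of {..<n} exhaust the finite sets of naturals, and summing principal
  minors over them gives n-by-n determinants. This connects the unconditional sum with the truncated
  determinants.\<close>

lemma has_sum_finite_sets_tendsto:
  assumes "(f has_sum X) {J :: nat set. finite J}"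
  shows "(\<lambda>n. \<Sum>J\<in>Pow {..<n}. f J) \<longlonglongrightarrow> X"
proof -
  have "filterlim (\<lambda>n. Pow {..<n}) (finite_subsets_at_top {J :: nat set. finite J}) sequentially"
    unfolding filterlim_iff eventually_finite_subsets_at_top
  proof (intro allI impI, elim exE conjE)
    fix P and X :: "nat set set"
    assume X: "finite X" "X \<subseteq> {J. finite J}"
      and P: "\<forall>Y. finite Y \<and> X \<subseteq> Y \<and> Y \<subseteq> {J. finite J} \<longrightarrow> P Y"
    have "finite (\<Union>X)" using X by auto
    then obtain N where N: "\<Union>X \<subseteq> {..<N}" using finite_nat_iff_bounded by blast
    show "\<forall>\<^sub>F n in sequentially. P (Pow {..<n})"
      using eventually_ge_at_top[of N]
    proof eventually_elim
      fix n assume "N \<le> n"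
      then have "X \<subseteq> Pow {..<n}" using N by fastforce
      moreover have "Pow {..<n} \<subseteq> {J. finite J}" by (auto intro: finite_subset)
      ultimately show "P (Pow {..<n})" using P by simp
    qed
  qed
  then show ?thesis
    using assms unfolding has_sum_def by (rule filterlim_compose[rotated])
qed

subsection \<open>Exchanging the two index sets\<close>

text \<open>A determinant with two equal rows: composing with the transposition of i and j reverses
  the sign and leaves the product unchanged, so the sum equals its negative.\<close>

lemma signed_sum_not_inj:
  fixes w :: "'b \<Rightarrow> 'a \<Rightarrow> complex"
  assumes fin: "finite S" and not_inj: "\<not> inj_on f S"
  shows "(\<Sum>p | p permutes S. of_int (sign p) * (\<Prod>i\<in>S. w (f i) (p i))) = 0"
proof -
  obtain i j where ij: "i \<in> S" "j \<in> S" "i \<noteq> j" "f i = f j"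
    using not_inj by (auto simp: inj_on_def)
  let ?\<tau> = "Transposition.transpose i j"
  have \<tau>: "?\<tau> permutes S"
    using ij by (simp add: permutes_swap_id)
  let ?X = "\<lambda>p. of_int (sign p) * (\<Prod>k\<in>S. w (f k) (p k))"
  have "?X (p \<circ> ?\<tau>) = - ?X p" if p: "p permutes S" for p
  proof -
    have "sign (p \<circ> ?\<tau>) = - sign p"
      using sign_compose[of p ?\<tau>] permutes_imp_permutation[OF fin] p \<tau> ij
      by (simp add: sign_swap_id)
    moreover have "(\<Prod>k\<in>S. w (f k) ((p \<circ> ?\<tau>) k)) = (\<Prod>k\<in>S. w (f k) (p k))"
    proof -
      have f\<tau>: "f (?\<tau> k) = f k" for k
        using ij by (simp add: Transposition.transpose_def)
      have "(\<Prod>k\<in>S. w (f k) (p k)) = (\<Prod>k\<in>S. w (f (?\<tau> k)) (p (?\<tau> k)))"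
        by (subst prod.permute[OF \<tau>]) (simp add: o_def)
      then show ?thesis by (simp add: f\<tau>)
    qed
    ultimately show ?thesis by simp
  qed
  then have "(\<Sum>p | p permutes S. ?X (p \<circ> ?\<tau>)) = - (\<Sum>p | p permutes S. ?X p)"
    by (simp add: sum_negf)
  then have "(\<Sum>p | p permutes S. ?X p) = - (\<Sum>p | p permutes S. ?X p)"
    using sum_permutations_compose_right[OF \<tau>, of ?X] by simp
  then show ?thesis by simp
qed

text \<open>The maps are extensional outside \<open>S\<close>, so that each injection on
  \<open>S\<close> is counted exactly once.\<close>

definition inj_maps :: "nat set \<Rightarrow> (nat \<Rightarrow> nat) set" where
  "inj_maps S = {f \<in> S \<rightarrow>\<^sub>E UNIV. inj_on f S}"

text \<open>
  A pair of a finite set and an injection from it is a finite partial bijection of the naturals; the lemma says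
  that passing to the inverse partial bijection only renames the terms.
\<close>

lemma has_sum_inverse_partial_bijection:
  fixes F G :: "nat set \<times> (nat \<Rightarrow> nat) \<Rightarrow> complex"
  assumes eq: "\<And>S f \<sigma>. finite S \<Longrightarrow> inj_on f S \<Longrightarrow> (\<And>i. i \<in> S \<Longrightarrow> \<sigma> (f i) = i) \<Longrightarrow> F (S, f) = G (f ` S, \<sigma>)"
    and G: "(G has_sum X) (Sigma {J. finite J} inj_maps)"
  shows "(F has_sum X) (Sigma {S. finite S} inj_maps)"
proof -
  \<comment> \<open>Restricting the inverse keeps it extensional, which makes \<open>swap\<close> an
    involution on the index set.\<close>
  define swap :: "nat set \<times> (nat \<Rightarrow> nat) \<Rightarrow> nat set \<times> (nat \<Rightarrow> nat)"
    where "swap z = (snd z ` fst z, restrict (inv_into (fst z) (snd z)) (snd z ` fst z))" for z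
  have dom: "swap z \<in> Sigma {J. finite J} inj_maps" if "z \<in> Sigma {J. finite J} inj_maps" for z
    using that by (auto simp: swap_def inj_maps_def intro!: inj_onI dest: inv_into_injective)
  have inv: "swap (swap z) = z" if z: "z \<in> Sigma {J. finite J} inj_maps" for z
  proof -
    obtain S f where [simp]: "z = (S, f)" by (cases z)
    have f: "f \<in> S \<rightarrow>\<^sub>E UNIV" "inj_on f S" using z by (auto simp: inj_maps_def)
    have img: "restrict (inv_into S f) (f ` S) ` f ` S = S"
      using f(2) by (auto simp: image_iff)
    have "restrict (inv_into (f ` S) (restrict (inv_into S f) (f ` S))) S i = f i" for i
    proof (cases "i \<in> S")
      case True
      have "inj_on (restrict (inv_into S f) (f ` S)) (f ` S)"
        by (auto intro!: inj_onI dest: inv_into_injective)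
      then show ?thesis
        using True f(2) by (auto intro!: inv_into_f_eq)
    qed (use f(1) in \<open>auto simp: PiE_def extensional_def\<close>)
    then have "restrict (inv_into (f ` S) (restrict (inv_into S f) (f ` S))) S = f" ..
    then show ?thesis
      by (simp only: swap_def \<open>z = (S, f)\<close> fst_conv snd_conv img)
  qed
  show ?thesis
  proof (rule has_sum_reindex_bij_witness[where i = swap and j = swap, THEN iffD2, OF _ _ _ _ _ refl G])
    fix z :: "nat set \<times> (nat \<Rightarrow> nat)" assume "z \<in> Sigma {J. finite J} inj_maps"
    then obtain S f where [simp]: "z = (S, f)" and "finite S" "inj_on f S"
      by (auto simp: inj_maps_def)
    then show "G (swap z) = F z"
      by (auto simp: swap_def intro!: eq[symmetric])
  qed (use dom inv in auto)
qed

text \<open>With U, V the matrices of \<open>u\<close>, \<open>v\<close> and A = diag(a), the large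
  matrix is U A V and the small one is, up to transposition, V U A. The aim is the infinite form of
  det (I + U A V) = det (I + V U A), minor by minor as in Cauchy-Binet. The bound
  \<open>\<kappa>\<close> is uniform so that it can enter the factorial estimate.\<close>

locale matrix_of_series =
  fixes a :: "nat \<Rightarrow> complex" and u v :: "nat \<Rightarrow> nat \<Rightarrow> complex" and \<kappa> :: real
  assumes a_summable: "summable (\<lambda>j. cmod (a j))"
    and uv_summable: "\<And>j k. summable (\<lambda>i. cmod (v k i) * cmod (u j i))"
    and uv_bound: "\<And>j k. (\<Sum>i. cmod (v k i) * cmod (u j i)) \<le> \<kappa>"
    and auv_summable: "\<And>i q. summable (\<lambda>j. cmod (a j) * (cmod (v j q) * cmod (u j i)))"
begin

definition big_minor :: "nat set \<Rightarrow> complex" where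
  "big_minor S = (\<Sum>p | p permutes S. of_int (sign p) * (\<Prod>i\<in>S. \<Sum>j. a j * v j (p i) * u j i))"

definition small_minor :: "nat set \<Rightarrow> complex" where
  "small_minor J = (\<Sum>p | p permutes J. of_int (sign p) * (\<Prod>j\<in>J. a j * (\<Sum>i. v (p j) i * u j i)))"

definition big_term :: "nat set \<times> (nat \<Rightarrow> nat) \<Rightarrow> complex" where
  "big_term = (\<lambda>(S, f). \<Sum>p | p permutes S. of_int (sign p) * (\<Prod>i\<in>S. a (f i) * v (f i) (p i) * u (f i) i))"

definition small_term :: "nat set \<times> (nat \<Rightarrow> nat) \<Rightarrow> complex" where
  "small_term = (\<lambda>(J, \<sigma>). \<Sum>p | p permutes J. of_int (sign p) * (\<Prod>j\<in>J. a j * v (p j) (\<sigma> j) * u j (\<sigma> j)))"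

text \<open>Multiplying out the series in all rows, \<open>f\<close> records which term is taken in
  each row. For two rows using the same term the signed sum cancels, so only injective choices
  remain.\<close>

lemma big_term_has_sum:
  assumes S: "finite S"
  shows "((\<lambda>f. big_term (S, f)) has_sum big_minor S) (inj_maps S)"
proof -
  have ab: "(\<lambda>j. norm (a j * v j q * u j i)) summable_on UNIV" for i q
    using auv_summable[of q i] by (simp add: summable_on_UNIV_nonneg_real_iff norm_mult mult.assoc)
  have infs: "infsum (\<lambda>j. a j * v j q * u j i) UNIV = (\<Sum>j. a j * v j q * u j i)" for i q
    using has_sum_imp_sums[OF has_sum_infsum[OF abs_summable_summable[OF ab]]] by (simp add: sums_iff)
  have "((\<lambda>f. big_term (S, f)) has_sum big_minor S) (S \<rightarrow>\<^sub>E UNIV)"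
    unfolding big_term_def big_minor_def prod.case infs[symmetric]
    by (intro has_sum_finite_sum has_sum_cmult_right has_sum_prod_PiE S ab)
  moreover have "big_term (S, f) = 0" if "\<not> inj_on f S" for f
  proof -
    have "big_term (S, f) = (\<Prod>i\<in>S. a (f i) * u (f i) i) *
        (\<Sum>p | p permutes S. of_int (sign p) * (\<Prod>i\<in>S. v (f i) (p i)))"
      by (simp add: big_term_def sum_distrib_left prod.distrib mult_ac)
    then show ?thesis using signed_sum_not_inj[OF S that] by simp
  qed
  then have "((\<lambda>f. big_term (S, f)) has_sum big_minor S) (S \<rightarrow>\<^sub>E UNIV) \<longleftrightarrow>
      ((\<lambda>f. big_term (S, f)) has_sum big_minor S) (inj_maps S)"
    by (intro has_sum_cong_neutral) (auto simp: inj_maps_def)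
  ultimately show ?thesis by simp
qed

lemma vu_abs_summable: "(\<lambda>i. norm (v k i * u j i)) summable_on UNIV"
  using uv_summable[of k j] by (simp add: summable_on_UNIV_nonneg_real_iff norm_mult)

text \<open>The mirror image of \<open>big_term_has_sum\<close>: here \<sigma> records the index
  taken from each inner series, and repeated indices cancel by antisymmetry in the first index of
  \<open>v\<close>.\<close>

lemma small_term_has_sum:
  assumes J: "finite J"
  shows "((\<lambda>\<sigma>. small_term (J, \<sigma>)) has_sum small_minor J) (inj_maps J)"
proof -
  have ab: "(\<lambda>i. norm (a j * v k i * u j i)) summable_on UNIV" for j k
    using summable_on_cmult_right[OF vu_abs_summable[of k j], of "cmod (a j)"] by (simp add: norm_mult mult.assoc)
  have infs: "infsum (\<lambda>i. a j * v k i * u j i) UNIV = a j * (\<Sum>i. v k i * u j i)" for j k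
    using has_sum_imp_sums[OF has_sum_cmult_right[OF has_sum_infsum[OF abs_summable_summable[OF vu_abs_summable]]], of "a j" k j]
      has_sum_imp_sums[OF has_sum_infsum[OF abs_summable_summable[OF vu_abs_summable]], of k j]
      has_sum_imp_sums[OF has_sum_infsum[OF abs_summable_summable[OF ab]], of j k]
    by (simp add: sums_iff mult.assoc)
  have "((\<lambda>\<sigma>. small_term (J, \<sigma>)) has_sum small_minor J) (J \<rightarrow>\<^sub>E UNIV)"
    unfolding small_term_def small_minor_def prod.case infs[symmetric]
    by (intro has_sum_finite_sum has_sum_cmult_right has_sum_prod_PiE J ab)
  moreover have "small_term (J, \<sigma>) = 0" if "\<not> inj_on \<sigma> J" for \<sigma>
  proof -
    have "small_term (J, \<sigma>) = (\<Prod>j\<in>J. a j * u j (\<sigma> j)) *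
        (\<Sum>p | p permutes J. of_int (sign p) * (\<Prod>j\<in>J. v (p j) (\<sigma> j)))"
      by (simp add: small_term_def sum_distrib_left prod.distrib mult_ac)
    then show ?thesis using signed_sum_not_inj[OF J that, of "\<lambda>x y. v y x"] by simp
  qed
  then have "((\<lambda>\<sigma>. small_term (J, \<sigma>)) has_sum small_minor J) (J \<rightarrow>\<^sub>E UNIV) \<longleftrightarrow>
      ((\<lambda>\<sigma>. small_term (J, \<sigma>)) has_sum small_minor J) (inj_maps J)"
    by (intro has_sum_cong_neutral) (auto simp: inj_maps_def)
  ultimately show ?thesis by simp
qed

text \<open>Conjugation by \<open>f\<close> carries the permutations of \<open>S\<close> to those of
  its image with the same sign.\<close>

lemma big_term_eq_small_term:
  assumes S: "finite S" and f: "inj_on f S" and \<sigma>: "\<And>i. i \<in> S \<Longrightarrow> \<sigma> (f i) = i"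
  shows "big_term (S, f) = small_term (f ` S, \<sigma>)"
proof -
  let ?J = "f ` S"
  have bij: "bij_betw f S ?J" using f by (simp add: bij_betw_def)
  have \<sigma>_bij: "bij_betw \<sigma> ?J S"
    using \<sigma> by (intro bij_betwI[of _ _ _ f]) auto
  have "big_term (S, f) = (\<Sum>p | p permutes ?J. of_int (sign p) * (\<Prod>j\<in>?J. a j * v j (\<sigma> (p j)) * u j (\<sigma> j)))"
    unfolding big_term_def prod.case
  proof (rule sum.reindex_bij_witness[where i = "map_permutation ?J \<sigma>" and j = "map_permutation S f"]; clarsimp)
    fix p assume p: "p permutes S"
    show "map_permutation ?J \<sigma> (map_permutation S f p) = p"
      by (rule map_permutation_compose_inv[OF bij p \<sigma>])
    show "map_permutation S f p permutes ?J"
      by (rule map_permutation_permutes[OF bij p])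
    have "(\<Prod>j\<in>?J. a j * v j (\<sigma> (map_permutation S f p j)) * u j (\<sigma> j))
        = (\<Prod>i\<in>S. a (f i) * v (f i) (\<sigma> (map_permutation S f p (f i))) * u (f i) (\<sigma> (f i)))"
      by (simp add: prod.reindex[OF f])
    also have "\<dots> = (\<Prod>i\<in>S. a (f i) * v (f i) (p i) * u (f i) i)"
      using \<sigma> permutes_in_image[OF p] by (intro prod.cong) (auto simp: map_permutation_apply[OF f])
    finally show "of_int (sign (map_permutation S f p)) *
        (\<Prod>j\<in>?J. a j * v j (\<sigma> (map_permutation S f p j)) * u j (\<sigma> j)) =
        of_int (sign p) * (\<Prod>i\<in>S. a (f i) * v (f i) (p i) * u (f i) i)"
      by (simp add: sign_map_permutation[OF f p S])
  next
    fix p assume p: "p permutes ?J"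
    show "map_permutation S f (map_permutation ?J \<sigma> p) = p"
      by (rule map_permutation_compose_inv[OF \<sigma>_bij p]) (use \<sigma> in auto)
    show "map_permutation ?J \<sigma> p permutes S"
      by (rule map_permutation_permutes[OF \<sigma>_bij p])
  qed
  \<comment> \<open>After conjugation the permutation acts on the second index of \<open>v\<close>,
    whereas \<open>small_term\<close> permutes the first; replacing p by its inverse and reindexing
    the product moves it across.\<close>
  also have "\<dots> = (\<Sum>p | p permutes ?J. of_int (sign (inv_into UNIV p)) * (\<Prod>j\<in>?J. a j * v j (\<sigma> (inv_into UNIV p j)) * u j (\<sigma> j)))"
    by (rule sum_permutations_inverse)
  also have "\<dots> = small_term (?J, \<sigma>)"
    unfolding small_term_def prod.case
  proof (rule sum.cong[OF refl], clarsimp)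
    fix p assume p: "p permutes ?J"
    have "(\<Prod>j\<in>?J. v j (\<sigma> (inv_into UNIV p j))) = (\<Prod>j\<in>?J. v (p j) (\<sigma> (inv_into UNIV p (p j))))"
      by (subst prod.permute[OF p]) (simp add: o_def)
    also have "\<dots> = (\<Prod>j\<in>?J. v (p j) (\<sigma> j))"
      by (simp add: permutes_inverses[OF p])
    finally show "of_int (sign (inv_into UNIV p)) * (\<Prod>j\<in>?J. a j * v j (\<sigma> (inv_into UNIV p j)) * u j (\<sigma> j))
        = of_int (sign p) * (\<Prod>j\<in>?J. a j * v (p j) (\<sigma> j) * u j (\<sigma> j))"
      using sign_inverse[OF permutes_imp_permutation[OF _ p]] S by (simp add: prod.distrib)
  qed
  finally show ?thesis .
qed

lemma \<kappa>_nonneg: "0 \<le> \<kappa>"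
  using uv_bound[of 0 0] suminf_nonneg[OF uv_summable[of 0 0]] by simp

text \<open>Absolute convergence is proved on the small side, where the inner sums are bounded by
  \<open>\<kappa>\<close>: each of the |J|! permutations then contributes at most the product of
  |a_j| \<kappa> over J.\<close>

lemma small_term_summable: "small_term summable_on Sigma {J. finite J} inj_maps"
proof -
  \<comment> \<open>The majorant is summed over all maps from J, not only the injective ones,
    because then it factorises into a product of series.\<close>
  define H where "H = (\<lambda>(J, \<sigma>). \<Sum>p | p permutes J.
      \<Prod>j\<in>J. cmod (a j) * (cmod (v (p j) (\<sigma> j)) * cmod (u j (\<sigma> j))))"
  have H0: "0 \<le> H z" for z
    by (auto simp: H_def split: prod.split intro!: sum_nonneg prod_nonneg)
  define g where "g J = (\<Sum>p | p permutes J. \<Prod>j\<in>J. cmod (a j) * (\<Sum>i. cmod (v (p j) i) * cmod (u j i)))" for J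
  have sums: "((\<lambda>\<sigma>. H (J, \<sigma>)) has_sum g J) (J \<rightarrow>\<^sub>E UNIV)" if J: "finite J" for J
  proof -
    have ab: "(\<lambda>i. cmod (a j) * (cmod (v k i) * cmod (u j i))) summable_on UNIV" for j k
      using summable_on_cmult_right[OF vu_abs_summable[of k j], of "cmod (a j)"] by (simp add: norm_mult)
    have infs: "infsum (\<lambda>i. cmod (a j) * (cmod (v k i) * cmod (u j i))) UNIV
        = cmod (a j) * (\<Sum>i. cmod (v k i) * cmod (u j i))" for j k
      using has_sum_imp_sums[OF has_sum_infsum[OF ab], of j k] suminf_mult[OF uv_summable, of "cmod (a j)" k j]
      by (simp add: sums_iff)
    show ?thesis
      unfolding H_def g_def prod.case infs[symmetric]
      by (intro has_sum_finite_sum has_sum_prod_PiE_nonneg J ab) auto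
  qed
  have "g summable_on {J. finite J}"
  proof (rule summable_on_comparison_test)
    show "(\<lambda>J. fact (card J) * (\<Prod>j\<in>J. cmod (a j) * \<kappa>)) summable_on {J. finite J}"
      by (rule summable_on_fact_prod) (auto intro!: mult_nonneg_nonneg \<kappa>_nonneg summable_mult2 a_summable)
    show "g J \<le> fact (card J) * (\<Prod>j\<in>J. cmod (a j) * \<kappa>)" if "J \<in> {J. finite J}" for J
    proof -
      have "g J \<le> (\<Sum>p | p permutes J. \<Prod>j\<in>J. cmod (a j) * \<kappa>)"
        unfolding g_def
        by (intro sum_mono prod_mono conjI mult_left_mono mult_nonneg_nonneg uv_bound suminf_nonneg uv_summable) auto
      then show ?thesis using that card_permutations[of J "card J"] by simp
    qed
    show "0 \<le> g J" for J
      unfolding g_def by (intro sum_nonneg prod_nonneg mult_nonneg_nonneg suminf_nonneg uv_summable) auto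
  qed
  then have "H summable_on Sigma {J. finite J} (\<lambda>J. J \<rightarrow>\<^sub>E UNIV)"
    by (intro summable_on_SigmaI[where g = g]) (use sums H0 in auto)
  then have "H summable_on Sigma {J. finite J} inj_maps"
    by (rule summable_on_subset_banach) (auto simp: inj_maps_def)
  then have "(\<lambda>z. norm (H z)) summable_on Sigma {J. finite J} inj_maps"
    using H0 by simp
  then have "(\<lambda>z. norm (small_term z)) summable_on Sigma {J. finite J} inj_maps"
  proof (rule Infinite_Sum.abs_summable_on_comparison_test)
    fix z :: "nat set \<times> (nat \<Rightarrow> nat)"
    obtain J \<sigma> where z: "z = (J, \<sigma>)" by (cases z)
    have "norm (small_term z) \<le> (\<Sum>p | p permutes J. norm (of_int (sign p) *
        (\<Prod>j\<in>J. a j * v (p j) (\<sigma> j) * u j (\<sigma> j))))"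
      unfolding small_term_def z prod.case by (rule norm_sum)
    also have "\<dots> = H z"
      unfolding H_def z prod.case
      by (intro sum.cong refl) (simp add: norm_mult prod_norm[symmetric] mult.assoc sign_def)
    finally show "norm (small_term z) \<le> norm (H z)" using H0[of z] by simp
  qed
  then show ?thesis by (rule abs_summable_summable)
qed

text \<open>One absolutely convergent sum over partial bijections, grouped by domain on one side and
  by range on the other.\<close>

theorem minors_has_sum:
  obtains X where "(small_minor has_sum X) {J. finite J}" "(big_minor has_sum X) {S. finite S}"
proof -
  define X where "X = infsum small_term (Sigma {J. finite J} inj_maps)"
  have X: "(small_term has_sum X) (Sigma {J. finite J} inj_maps)"
    unfolding X_def by (rule has_sum_infsum[OF small_term_summable])
  then have X': "(big_term has_sum X) (Sigma {S. finite S} inj_maps)"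
    by (rule has_sum_inverse_partial_bijection[rotated]) (rule big_term_eq_small_term)
  show ?thesis
  proof (rule that)
    show "(small_minor has_sum X) {J. finite J}"
      by (rule has_sum_SigmaD[OF X]) (use small_term_has_sum in auto)
    show "(big_minor has_sum X) {S. finite S}"
      by (rule has_sum_SigmaD[OF X']) (use big_term_has_sum in auto)
  qed
qed

end

context nuclear_operator
begin

definition kernel_minor :: "nat set \<Rightarrow> complex" where
  "kernel_minor J = (\<Sum>p | p permutes J. of_int (sign p) * (\<Prod>j\<in>J. a j * L2_inner M (g j) (h (p j))))"

text \<open>Expanding the nuclear vectors in \<open>e\<close>, the large matrix becomes that of
  \<open>T\<close>, while Parseval collapses the small one to <g_j, h_k>. The latter no longer
  involves the basis, so the same minors compute the determinant in every basis.\<close>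

lemma exterior_diagonal_has_sum:
  assumes e: "orthonormal_basis M e"
  obtains X where "(kernel_minor has_sum X) {J. finite J}" "(exterior_diagonal M e T has_sum X) {S. finite S}"
proof -
  have eL2: "e k \<in> L2 M" for k
    using e by (simp add: orthonormal_basis_def)
  define u v where "u j i = L2_inner M (g j) (e i)" and "v j q = L2_inner M (e q) (h j)" for j i q
  interpret matrix_of_series a u v "B\<^sup>2"
  proof
    fix j k
    show "summable (\<lambda>i. cmod (v k i) * cmod (u j i))"
      using sum_inner_basis_le(1)[OF e g_L2 h_L2, of j k] by (simp add: u_def v_def mult.commute)
    have "(\<Sum>i. cmod (v k i) * cmod (u j i)) \<le> L2_norm M (g j) * L2_norm M (h k)"
      using sum_inner_basis_le(2)[OF e g_L2 h_L2, of j k] by (simp add: u_def v_def mult.commute)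
    also have "\<dots> \<le> B * B"
      by (intro mult_mono g_norm h_norm B_nonneg L2_norm_nonneg)
    finally show "(\<Sum>i. cmod (v k i) * cmod (u j i)) \<le> B\<^sup>2"
      by (simp add: power2_eq_square)
  next
    fix i q
    show "summable (\<lambda>j. cmod (a j) * (cmod (v j q) * cmod (u j i)))"
      unfolding u_def v_def by (rule T_inner_abs_summable[OF eL2 eL2])
  qed (rule a_summable)
  have "(\<Sum>j. a j * v j q * u j i) = L2_inner M (T (e q)) (e i)" for i q
    unfolding u_def v_def using T_inner_sums[OF eL2 eL2] by (simp add: sums_iff)
  then have big: "big_minor = exterior_diagonal M e T"
    by (simp add: fun_eq_iff big_minor_def exterior_diagonal_def)
  have "(\<Sum>i. v k i * u j i) = L2_inner M (g j) (h k)" for j k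
    unfolding u_def v_def using Parseval_sums[OF e g_L2 h_L2] by (simp add: sums_iff mult.commute)
  then have small: "small_minor = kernel_minor"
    by (simp add: fun_eq_iff small_minor_def kernel_minor_def)
  show ?thesis
    using minors_has_sum that unfolding big small by blast
qed

text \<open>The premise only identifies the value; that the minors are summable at all is supplied
  by any orthonormal basis.\<close>

theorem has_fredholm_detI:
  assumes "\<And>X. (kernel_minor has_sum X) {J. finite J} \<Longrightarrow> X = d"
  shows "has_fredholm_det M T d"
  unfolding has_fredholm_det_def
proof (intro conjI allI impI T_trace_class)
  fix e assume "orthonormal_basis M e"
  then show "(exterior_diagonal M e T has_sum d) {S. finite S}"
    using exterior_diagonal_has_sum assms by metis
qed

end

section \<open>Sequence spaces and exponentials\<close>

subsection \<open>The space \<open>\<ell>\<^sup>2\<close>\<close>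

lemma L2_seq_iff: "\<alpha> \<in> L2 seq_measure \<longleftrightarrow> summable (\<lambda>j. (cmod (\<alpha> j))\<^sup>2)"
  by (simp add: L2_def integrable_count_space_nat_iff)

lemma L2_norm_seq_square:
  "\<alpha> \<in> L2 seq_measure \<Longrightarrow> (L2_norm seq_measure \<alpha>)\<^sup>2 = (\<Sum>j. (cmod (\<alpha> j))\<^sup>2)"
  using L2_integrable_square[of \<alpha> seq_measure] by (simp add: L2_norm_square integral_count_space_nat)

lemma L2_inner_seq_sums:
  assumes "\<alpha> \<in> L2 seq_measure" "\<beta> \<in> L2 seq_measure"
  shows "(\<lambda>j. \<alpha> j * cnj (\<beta> j)) sums L2_inner seq_measure \<alpha> \<beta>"
  unfolding L2_inner_def by (rule sums_integral_count_space_nat[OF L2_inner_integrable[OF assms]])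

lemma cmod_le_L2_norm_seq:
  assumes "\<alpha> \<in> L2 seq_measure"
  shows "cmod (\<alpha> j) \<le> L2_norm seq_measure \<alpha>"
proof (rule power2_le_imp_le)
  have "(cmod (\<alpha> j))\<^sup>2 = (\<Sum>i\<in>{j}. (cmod (\<alpha> i))\<^sup>2)" by simp
  also have "\<dots> \<le> (\<Sum>i. (cmod (\<alpha> i))\<^sup>2)"
    using assms by (intro sum_le_suminf) (auto simp: L2_seq_iff)
  finally show "(cmod (\<alpha> j))\<^sup>2 \<le> (L2_norm seq_measure \<alpha>)\<^sup>2"
    by (simp add: L2_norm_seq_square[OF assms])
qed simp

text \<open>Since c_j is at most the total, c_j^2 \<le> (sum c) c_j: domination by a summable
  sequence controls the l^2 norm by the l^1 norm of the majorant.\<close>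

lemma L2_seq_bound:
  fixes c :: "nat \<Rightarrow> real"
  assumes c: "summable c" and \<alpha>: "\<And>j. cmod (\<alpha> j) \<le> c j"
  shows "\<alpha> \<in> L2 seq_measure" "L2_norm seq_measure \<alpha> \<le> suminf c"
proof -
  have c0: "0 \<le> c j" for j using \<alpha>[of j] norm_ge_zero[of "\<alpha> j"] by linarith
  have le: "c j \<le> suminf c" for j
    using sum_le_suminf[OF c, of "{j}"] c0 by simp
  have bound: "(cmod (\<alpha> j))\<^sup>2 \<le> suminf c * c j" for j
    unfolding power2_eq_square
    by (intro mult_mono order_trans[OF \<alpha> le] \<alpha> order_trans[OF c0 le]) simp
  show \<alpha>L2: "\<alpha> \<in> L2 seq_measure"
    unfolding L2_seq_iff
    by (rule summable_comparison_test'[OF summable_mult[OF c, of "suminf c"], of 0]) (use bound in simp)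
  have "(\<Sum>j. (cmod (\<alpha> j))\<^sup>2) \<le> (\<Sum>j. suminf c * c j)"
    using \<alpha>L2 by (intro suminf_le bound summable_mult c) (simp add: L2_seq_iff)
  then have "(L2_norm seq_measure \<alpha>)\<^sup>2 \<le> (suminf c)\<^sup>2"
    by (simp only: L2_norm_seq_square[OF \<alpha>L2] suminf_mult[OF c] power2_eq_square[of "suminf c"])
  then show "L2_norm seq_measure \<alpha> \<le> suminf c"
    by (rule power2_le_imp_le) (rule order_trans[OF c0[of 0] le[of 0]])
qed

lemma L2_seq_finite_support:
  assumes "finite I"
  shows "(\<lambda>j. if j \<in> I then \<alpha> j else 0) \<in> L2 seq_measure"
    and "(L2_norm seq_measure (\<lambda>j. if j \<in> I then \<alpha> j else 0))\<^sup>2 = (\<Sum>j\<in>I. (cmod (\<alpha> j))\<^sup>2)"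
proof -
  have "(\<lambda>j. (cmod (if j \<in> I then \<alpha> j else 0))\<^sup>2) sums (\<Sum>j\<in>I. (cmod (if j \<in> I then \<alpha> j else 0))\<^sup>2)"
    by (rule sums_finite[OF assms]) auto
  then show "(\<lambda>j. if j \<in> I then \<alpha> j else 0) \<in> L2 seq_measure"
    and "(L2_norm seq_measure (\<lambda>j. if j \<in> I then \<alpha> j else 0))\<^sup>2 = (\<Sum>j\<in>I. (cmod (\<alpha> j))\<^sup>2)"
    by (simp_all add: L2_seq_iff L2_norm_seq_square sums_iff)
qed

lemma ell1_L2:
  assumes "\<alpha> \<in> ell1"
  shows "\<alpha> \<in> L2 seq_measure" "L2_norm seq_measure \<alpha> \<le> (\<Sum>j. cmod (\<alpha> j))"
  using L2_seq_bound[of "\<lambda>j. cmod (\<alpha> j)" \<alpha>] assms by (auto simp: ell1_def)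

lemma ell1_scale: "w \<in> ell1 \<Longrightarrow> (\<lambda>j. c * w j) \<in> ell1"
  unfolding ell1_def mem_Collect_eq norm_mult by (rule summable_mult)

lemma ell1_bound:
  "summable c \<Longrightarrow> (\<And>j. cmod (w j) \<le> c j) \<Longrightarrow> w \<in> ell1"
  unfolding ell1_def mem_Collect_eq by (rule summable_comparison_test'[of c 0]) auto

lemma ell1_summable: "w \<in> ell1 \<Longrightarrow> summable w"
  unfolding ell1_def mem_Collect_eq by (rule summable_norm_cancel)

lemma ell1_unit: "(\<lambda>j. if j = m then 1 else 0) \<in> ell1"
  unfolding ell1_def mem_Collect_eq by (rule summable_finite[of "{m}"]) auto

text \<open>Finite heads are handled by linearity, and the tails tend to 0 in l^1. The expansion
  into values at unit vectors later lets a functional pass through an integral as an exchange of sum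
  and integral.\<close>

lemma ell1_functional_sums:
  fixes F :: "(nat \<Rightarrow> complex) \<Rightarrow> complex"
  assumes add: "\<And>w w'. w \<in> ell1 \<Longrightarrow> w' \<in> ell1 \<Longrightarrow> F (\<lambda>j. w j + w' j) = F w + F w'"
    and scale: "\<And>c w. w \<in> ell1 \<Longrightarrow> F (\<lambda>j. c * w j) = c * F w"
    and bound: "\<And>w. w \<in> ell1 \<Longrightarrow> cmod (F w) \<le> C * (\<Sum>j. cmod (w j))"
    and w: "w \<in> ell1"
  shows "(\<lambda>m. w m * F (\<lambda>j. if j = m then 1 else 0)) sums F w"
proof -
  have summ: "summable (\<lambda>j. cmod (w j))" using w by (simp add: ell1_def)
  define head tail where "head n j = (if j < n then w j else 0)" and "tail n j = (if j < n then 0 else w j)" for n j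
  have head: "head n \<in> ell1" and tail: "tail n \<in> ell1" for n
    by (rule ell1_bound[OF summ]; simp add: head_def tail_def)+
  have F_head: "F (head n) = (\<Sum>m<n. w m * F (\<lambda>j. if j = m then 1 else 0))" for n
  proof (induction n)
    case 0
    then show ?case
      using scale[OF head, of 0 0] by (simp add: head_def[abs_def])
  next
    case (Suc n)
    have "head (Suc n) = (\<lambda>j. head n j + w n * (if j = n then 1 else 0))"
      by (auto simp: head_def fun_eq_iff less_Suc_eq)
    then show ?case
      using Suc by (simp add: add[OF head ell1_scale[OF ell1_unit]] scale[OF ell1_unit])
  qed
  have F_split: "F w = F (head n) + F (tail n)" for n
  proof -
    have "w = (\<lambda>j. head n j + tail n j)" by (auto simp: head_def tail_def)
    then show ?thesis using add[OF head tail] by metis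
  qed
  have tail_sum: "(\<Sum>j. cmod (tail n j)) = (\<Sum>j. cmod (w j)) - (\<Sum>j<n. cmod (w j))" for n
  proof -
    have h: "summable (\<lambda>j. cmod (head n j))" and t: "summable (\<lambda>j. cmod (tail n j))"
      using head[of n] tail[of n] by (auto simp: ell1_def)
    have "(\<Sum>j. cmod (head n j)) = (\<Sum>j<n. cmod (head n j))"
      by (rule suminf_finite) (auto simp: head_def)
    also have "\<dots> = (\<Sum>j<n. cmod (w j))" by (simp add: head_def)
    finally have "(\<Sum>j. cmod (head n j)) = (\<Sum>j<n. cmod (w j))" .
    moreover have "(\<Sum>j. cmod (head n j)) + (\<Sum>j. cmod (tail n j)) = (\<Sum>j. cmod (w j))"
      unfolding suminf_add[OF h t] by (intro suminf_cong) (simp add: head_def tail_def)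
    ultimately show ?thesis by simp
  qed
  have "(\<lambda>n. C * ((\<Sum>j. cmod (w j)) - (\<Sum>j<n. cmod (w j)))) \<longlonglongrightarrow> C * ((\<Sum>j. cmod (w j)) - (\<Sum>j. cmod (w j)))"
    by (intro tendsto_intros summable_LIMSEQ summ)
  then have lim: "(\<lambda>n. C * ((\<Sum>j. cmod (w j)) - (\<Sum>j<n. cmod (w j)))) \<longlonglongrightarrow> 0" by simp
  have "(\<lambda>n. F (tail n)) \<longlonglongrightarrow> 0"
    by (rule Lim_null_comparison[OF always_eventually lim]) (use bound[OF tail] in \<open>auto simp: tail_sum\<close>)
  then have "(\<lambda>n. F w - F (tail n)) \<longlonglongrightarrow> F w - 0"
    by (intro tendsto_intros)
  moreover have "F w - F (tail n) = (\<Sum>m<n. w m * F (\<lambda>j. if j = m then 1 else 0))" for n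
    using F_split[of n] F_head[of n] by simp
  ultimately show ?thesis by (simp add: sums_def)
qed

subsection \<open>Exponentials on the half line\<close>

lemma borel_measurable_half_line:
  "f \<in> borel_measurable borel \<Longrightarrow> f \<in> borel_measurable half_line"
  by (intro measurable_restrict_space1 measurable_completion) simp

text \<open>Translates the set integrals of the statement into integrals over
  \<open>half_line\<close> with an indicator, where the L^2 theory applies.\<close>

lemma half_line_set_integrable:
  fixes f :: "real \<Rightarrow> 'a::{banach, second_countable_topology}"
  assumes "0 \<le> x"
  shows "set_integrable lebesgue {x<..} f \<longleftrightarrow> integrable half_line (\<lambda>s. indicator {x<..} s *\<^sub>R f s)"
    and "(LINT s:{x<..}|lebesgue. f s) = (\<integral>s. indicator {x<..} s *\<^sub>R f s \<partial>half_line)"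
proof -
  have S: "{0<..} \<inter> space lebesgue \<in> sets (lebesgue :: real measure)" by simp
  have eq: "indicator {0<..} s *\<^sub>R (indicator {x<..} s *\<^sub>R f s) = indicator {x<..} s *\<^sub>R f s" for s
    using assms by (auto simp: indicator_def)
  show "set_integrable lebesgue {x<..} f \<longleftrightarrow> integrable half_line (\<lambda>s. indicator {x<..} s *\<^sub>R f s)"
    and "(LINT s:{x<..}|lebesgue. f s) = (\<integral>s. indicator {x<..} s *\<^sub>R f s \<partial>half_line)"
    by (simp_all only: set_integrable_def set_lebesgue_integral_def integrable_restrict_space[OF S]
        integral_restrict_space[OF S] eq)
qed

lemma set_integrable_real_exp:
  fixes a x :: real
  assumes "0 < a"
  shows "set_integrable lebesgue {x<..} (\<lambda>s. exp (- a * s))"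
proof -
  have "(\<lambda>s. exp (- a * s)) absolutely_integrable_on {x..}"
    using has_integral_exp_minus_to_infinity[OF assms, of x]
    by (intro nonnegative_absolutely_integrable_1) (auto simp: integrable_on_def)
  then show ?thesis
    by (rule set_integrable_subset) auto
qed

lemma
  fixes z :: complex and x :: real
  assumes z: "0 < Re z"
  shows set_integrable_exp: "set_integrable lebesgue {x<..} (\<lambda>s. exp (- z * of_real s))"
    and set_integral_exp: "(LINT s:{x<..}|lebesgue. exp (- z * of_real s)) = exp (- z * of_real x) / z"
proof -
  let ?f = "\<lambda>s::real. exp (- z * of_real s)"
  have [measurable]: "?f \<in> borel_measurable borel"
    by (intro borel_measurable_continuous_onI continuous_intros)
  have meas: "(\<lambda>s. indicator {x<..} s *\<^sub>R ?f s) \<in> borel_measurable lborel"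
    by measurable
  show int: "set_integrable lebesgue {x<..} ?f"
    using set_integrable_real_exp[OF z, of x] unfolding set_integrable_def
  proof (rule Bochner_Integration.integrable_bound)
    show "(\<lambda>s. indicator {x<..} s *\<^sub>R ?f s) \<in> borel_measurable lebesgue"
      by (rule measurable_completion[OF meas])
    show "AE s in lebesgue. norm (indicator {x<..} s *\<^sub>R ?f s) \<le> norm (indicator {x<..} s *\<^sub>R exp (- Re z * s))"
      by (auto simp: indicator_def)
  qed
  have ein: "einterval (ereal x) \<infinity> = {x<..}"
    by (auto simp: einterval_def)
  have int': "set_integrable lborel {x<..} ?f"
    using int integrable_completion[OF meas] by (simp add: set_integrable_def)
  have lim: "((\<lambda>s. - (?f s / z)) \<longlongrightarrow> 0) at_top"
  proof (rule tendsto_norm_zero_cancel)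
    have "((\<lambda>s::real. exp (- Re z * s) / cmod z) \<longlongrightarrow> 0 / cmod z) at_top"
    proof (rule tendsto_divide)
      have "LIM s at_top. - Re z * s :> at_bot"
        using z by (intro filterlim_tendsto_neg_mult_at_bot[OF tendsto_const _ filterlim_ident]) auto
      then show "((\<lambda>s::real. exp (- Re z * s)) \<longlongrightarrow> 0) at_top"
        by (rule filterlim_compose[OF exp_at_bot])
    qed (use z in auto)
    then show "((\<lambda>s. norm (- (?f s / z))) \<longlongrightarrow> 0) at_top"
      by (simp add: norm_divide)
  qed
  \<comment> \<open>Fundamental theorem with primitive - e^(-z s)/z on \<open>lborel\<close>;
    passing to the completion gives the same value for \<open>lebesgue\<close>.\<close>
  have "(LBINT s=ereal x..\<infinity>. ?f s) = 0 - (- (?f x / z))"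
  proof (rule interval_integral_FTC_integrable)
    show "((\<lambda>s. - (?f s / z)) has_vector_derivative ?f s) (at s)" for s
    proof -
      have "((\<lambda>w. - (exp (- z * w) / z)) has_field_derivative exp (- z * of_real s)) (at (of_real s))"
        using z by (auto intro!: derivative_eq_intros simp: field_simps)
      from has_vector_derivative_real_field[OF this] show ?thesis by simp
    qed
    show "isCont ?f s" for s by (intro continuous_intros)
    show "set_integrable lborel (einterval (ereal x) \<infinity>) ?f"
      unfolding ein by (rule int')
    have "((\<lambda>s. - (?f s / z)) \<longlongrightarrow> - (?f x / z)) (at_right x)"
      using z by (intro tendsto_intros) auto
    then show "(((\<lambda>s. - (?f s / z)) \<circ> real_of_ereal) \<longlongrightarrow> - (?f x / z)) (at_right (ereal x))"
      by (simp add: ereal_tendsto_simps)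
    show "(((\<lambda>s. - (?f s / z)) \<circ> real_of_ereal) \<longlongrightarrow> 0) (at_left \<infinity>)"
      using lim by (simp add: ereal_tendsto_simps)
  qed simp
  then have "(LINT s:{x<..}|lborel. ?f s) = ?f x / z"
    by (simp add: interval_lebesgue_integral_def ein)
  then show "(LINT s:{x<..}|lebesgue. ?f s) = ?f x / z"
    using integral_completion[OF meas] by (simp add: set_lebesgue_integral_def)
qed

lemma truncated_exp_L2:
  fixes z :: complex and x :: real
  assumes z: "0 < Re z" and x: "0 \<le> x"
  shows "(\<lambda>s. indicator {x<..} s * exp (- z * of_real s)) \<in> L2 half_line"
    and "(L2_norm half_line (\<lambda>s. indicator {x<..} s * exp (- z * of_real s)))\<^sup>2 = exp (- 2 * Re z * x) / (2 * Re z)"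
proof -
  have sq: "(cmod (indicator {x<..} s * exp (- z * of_real s)))\<^sup>2
      = indicator {x<..} s *\<^sub>R exp (- (2 * Re z) * s)" for s
  proof -
    have "(exp (- Re z * s))\<^sup>2 = exp (- (2 * Re z) * s)"
      by (simp add: exp_double[symmetric])
    then show ?thesis
      by (cases "s \<in> {x<..}") (simp_all add: norm_exp_eq_Re)
  qed
  have "set_integrable lebesgue {x<..} (\<lambda>s. exp (- (2 * Re z) * s))"
    by (rule set_integrable_real_exp) (use z in simp)
  then have int: "integrable half_line (\<lambda>s. indicator {x<..} s *\<^sub>R exp (- (2 * Re z) * s))"
    by (simp only: half_line_set_integrable(1)[OF x])
  show "(\<lambda>s. indicator {x<..} s * exp (- z * of_real s)) \<in> L2 half_line"
  proof (rule L2I)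
    show "(\<lambda>s. indicator {x<..} s * exp (- z * of_real s)) \<in> borel_measurable half_line"
      by (intro borel_measurable_half_line borel_measurable_times borel_measurable_indicator
          borel_measurable_continuous_onI continuous_intros) auto
    show "integrable half_line (\<lambda>s. (cmod (indicator {x<..} s * exp (- z * of_real s)))\<^sup>2)"
      unfolding sq by (rule int)
  qed
  have of_real_exp: "exp (- complex_of_real (2 * Re z) * of_real s) = complex_of_real (exp (- (2 * Re z) * s))" for s
    by (simp only: exp_of_real of_real_mult[symmetric] of_real_minus[symmetric])
  have "complex_of_real (LINT s:{x<..}|lebesgue. exp (- (2 * Re z) * s))
      = (LINT s:{x<..}|lebesgue. complex_of_real (exp (- (2 * Re z) * s)))"
    by (simp only: set_integral_complex_of_real)
  also have "\<dots> = exp (- complex_of_real (2 * Re z) * of_real x) / of_real (2 * Re z)"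
    unfolding of_real_exp[symmetric] by (rule set_integral_exp) (use z in simp)
  also have "\<dots> = complex_of_real (exp (- (2 * Re z) * x) / (2 * Re z))"
    unfolding of_real_exp by (simp only: of_real_divide)
  finally have "(LINT s:{x<..}|lebesgue. exp (- (2 * Re z) * s)) = exp (- 2 * Re z * x) / (2 * Re z)"
    by (simp only: of_real_eq_iff mult_minus_left)
  then show "(L2_norm half_line (\<lambda>s. indicator {x<..} s * exp (- z * of_real s)))\<^sup>2 = exp (- 2 * Re z * x) / (2 * Re z)"
    unfolding L2_norm_square sq half_line_set_integrable(2)[OF x] .
qed

lemma half_line_cong:
  assumes "\<And>s. 0 < s \<Longrightarrow> f s = g s"
  shows "L2_norm half_line f = L2_norm half_line g"
    and "L2_inner half_line f h = L2_inner half_line g h"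
    and "f \<in> L2 half_line \<longleftrightarrow> g \<in> L2 half_line"
proof -
  have space: "s \<in> space half_line \<longleftrightarrow> 0 < s" for s by simp
  show "L2_norm half_line f = L2_norm half_line g"
    unfolding L2_norm_def by (rule arg_cong[of _ _ sqrt], rule Bochner_Integration.integral_cong) (use assms in auto)
  show "L2_inner half_line f h = L2_inner half_line g h"
    unfolding L2_inner_def by (rule Bochner_Integration.integral_cong) (use assms in auto)
  have "f \<in> borel_measurable half_line \<longleftrightarrow> g \<in> borel_measurable half_line"
    by (rule measurable_cong) (use assms in auto)
  moreover have "integrable half_line (\<lambda>x. (cmod (f x))\<^sup>2) \<longleftrightarrow> integrable half_line (\<lambda>x. (cmod (g x))\<^sup>2)"
    by (rule Bochner_Integration.integrable_cong) (use assms in auto)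
  ultimately show "f \<in> L2 half_line \<longleftrightarrow> g \<in> L2 half_line"
    by (simp add: L2_def)
qed

section \<open>The operators of the linear system\<close>

text \<open>\<open>K\<close> is a norm bound for \<open>\<Theta>\<close>. Fixing it as a constant
  keeps all later estimates explicit and uniform in the parameter x.\<close>

locale linear_system =
  fixes l \<xi> :: "nat \<Rightarrow> complex" and \<delta> K :: real
  assumes \<delta>: "0 < \<delta>" and Re_l: "\<And>j. \<delta> \<le> Re (l j)"
    and K: "0 \<le> K" and Theta_L2: "\<And>f. f \<in> L2 half_line \<Longrightarrow> Theta_op l f \<in> L2 seq_measure"
    and Theta_norm: "\<And>f. f \<in> L2 half_line \<Longrightarrow> L2_norm seq_measure (Theta_op l f) \<le> K * L2_norm half_line f"
    and \<xi>: "\<xi> \<in> ell1"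
begin

abbreviation E :: "real \<Rightarrow> nat \<Rightarrow> complex" where
  "E s j \<equiv> exp (- l j * of_real s)"

definition \<xi>_norm :: real where "\<xi>_norm = (\<Sum>j. cmod (\<xi> j))"

lemma \<xi>_summable: "summable (\<lambda>j. cmod (\<xi> j))"
  using \<xi> by (simp add: ell1_def)

lemma \<xi>_norm_nonneg: "0 \<le> \<xi>_norm"
  unfolding \<xi>_norm_def by (rule suminf_nonneg[OF \<xi>_summable]) simp

lemma Re_l_pos: "0 < Re (l j)"
  using \<delta> Re_l[of j] by linarith

lemma Re_l_sum_pos: "0 < Re (l j + l k)"
  using Re_l_pos[of j] Re_l_pos[of k] by simp

lemma l_sum_nz: "l j + l k \<noteq> 0"
  using Re_l_sum_pos[of j k] by (metis less_irrefl zero_complex.sel(1))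

lemma E_bound: "0 \<le> s \<Longrightarrow> cmod (E s j) \<le> exp (- \<delta> * s)"
  using mult_right_mono[OF Re_l[of j], of s] by simp

lemma E_le_1: "0 \<le> s \<Longrightarrow> cmod (E s j) \<le> 1"
  using Re_l_pos[of j] by simp

lemma semigroup_eq: "semigroup_op l s \<alpha> j = E s j * \<alpha> j"
  by (simp add: semigroup_op_def mult.commute)

lemma truncated_E_L2: "0 \<le> x \<Longrightarrow> (\<lambda>s. indicator {x<..} s * E s j) \<in> L2 half_line"
  by (rule truncated_exp_L2[OF Re_l_pos])

lemma truncated_E_norm:
  assumes "0 \<le> x"
  shows "L2_norm half_line (\<lambda>s. indicator {x<..} s * E s j) \<le> exp (- \<delta> * x) / sqrt (2 * \<delta>)"
proof (rule power2_le_imp_le)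
  have "(L2_norm half_line (\<lambda>s. indicator {x<..} s * E s j))\<^sup>2 = exp (- 2 * Re (l j) * x) / (2 * Re (l j))"
    by (rule truncated_exp_L2[OF Re_l_pos assms])
  also have "\<dots> \<le> exp (- 2 * \<delta> * x) / (2 * \<delta>)"
    using \<delta> Re_l[of j] mult_right_mono[OF Re_l[of j] assms] by (intro frac_le) auto
  also have "\<dots> = (exp (- \<delta> * x) / sqrt (2 * \<delta>))\<^sup>2"
    using \<delta> by (simp add: power_divide exp_double[symmetric] mult.assoc)
  finally show "(L2_norm half_line (\<lambda>s. indicator {x<..} s * E s j))\<^sup>2 \<le> (exp (- \<delta> * x) / sqrt (2 * \<delta>))\<^sup>2" .
qed (use \<delta> in simp)

lemma E_L2: "(\<lambda>s. E s j) \<in> L2 half_line"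
  using truncated_E_L2[of 0 j] half_line_cong(3)[of "\<lambda>s. indicator {0<..} s * E s j" "\<lambda>s. E s j"] by simp

lemma E_norm: "L2_norm half_line (\<lambda>s. E s j) \<le> 1 / sqrt (2 * \<delta>)"
  using truncated_E_norm[of 0 j] half_line_cong(1)[of "\<lambda>s. indicator {0<..} s * E s j" "\<lambda>s. E s j"] by simp

text \<open>The matrix of R_x without the factor \<open>\<xi> j\<close>. It is the bilinear Gram
  matrix of the exponentials on (x, \<infinity>).\<close>

definition row :: "real \<Rightarrow> nat \<Rightarrow> nat \<Rightarrow> complex" where
  "row x j k = exp (- (l j + l k) * of_real x) / (l j + l k)"

lemma truncated_E_inner:
  assumes x: "0 \<le> x"
  shows "(\<integral>s. indicator {x<..} s * (E s k * E s j) \<partial>half_line) = row x j k"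
proof -
  have "(\<integral>s. indicator {x<..} s * (E s k * E s j) \<partial>half_line)
      = (\<integral>s. indicator {x<..} s *\<^sub>R exp (- (l j + l k) * of_real s) \<partial>half_line)"
  proof (rule Bochner_Integration.integral_cong[OF refl])
    show "indicator {x<..} s * (E s k * E s j) = indicator {x<..} s *\<^sub>R exp (- (l j + l k) * of_real s)" for s
      by (simp add: indicator_def algebra_simps flip: exp_add)
  qed
  also have "\<dots> = (LINT s:{x<..}|lebesgue. exp (- (l j + l k) * of_real s))"
    by (rule half_line_set_integrable(2)[OF x, symmetric])
  also have "\<dots> = row x j k"
    unfolding row_def by (rule set_integral_exp[OF Re_l_sum_pos])
  finally show ?thesis .
qed

lemma row_0_inner: "L2_inner half_line (\<lambda>s. E s j) (\<lambda>s. cnj (E s k)) = 1 / (l j + l k)"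
proof -
  have "L2_inner half_line (\<lambda>s. E s j) (\<lambda>s. cnj (E s k)) = (\<integral>s. indicator {0<..} s * (E s k * E s j) \<partial>half_line)"
    unfolding L2_inner_def by (rule Bochner_Integration.integral_cong) auto
  then show ?thesis
    using truncated_E_inner[of 0 k j] by (simp add: row_def)
qed

text \<open>Boundedness of \<open>\<Theta>\<close> controls the rows of \<open>R\<^sub>x\<close>: they are images of truncated exponentials.\<close>

lemma row_eq_Theta:
  assumes x: "0 \<le> x"
  shows "row x j = (\<lambda>k. cnj (Theta_op l (\<lambda>s. cnj (indicator {x<..} s * E s j)) k))"
proof
  fix k
  have "cnj (Theta_op l (\<lambda>s. cnj (indicator {x<..} s * E s j)) k)
      = (\<integral>s. cnj (exp (- cnj (l k) * of_real s) * cnj (indicator {x<..} s * E s j)) \<partial>half_line)"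
    unfolding Theta_op_def by (simp only: Bochner_Integration.integral_cnj)
  also have "\<dots> = (\<integral>s. indicator {x<..} s * (E s k * E s j) \<partial>half_line)"
    by (rule Bochner_Integration.integral_cong[OF refl]) (simp add: exp_cnj mult_ac)
  also have "\<dots> = row x j k"
    by (rule truncated_E_inner[OF x])
  finally show "row x j k = cnj (Theta_op l (\<lambda>s. cnj (indicator {x<..} s * E s j)) k)" ..
qed

lemma row_L2: "0 \<le> x \<Longrightarrow> row x j \<in> L2 seq_measure"
  unfolding row_eq_Theta by (intro L2_cnj Theta_L2 truncated_E_L2)

text \<open>\<open>K\<close> times the bound 1 / sqrt (2 \<delta>) for the L^2 norm of an
  exponential: the uniform l^2 bound for the rows at x = 0.\<close>

definition K' :: real where "K' = K / sqrt (2 * \<delta>)"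

lemma K'_nonneg: "0 \<le> K'"
  using K \<delta> by (simp add: K'_def)

lemma row_norm:
  assumes x: "0 \<le> x"
  shows "L2_norm seq_measure (row x j) \<le> K' * exp (- \<delta> * x)"
proof -
  have "L2_norm seq_measure (row x j) = L2_norm seq_measure (Theta_op l (\<lambda>s. cnj (indicator {x<..} s * E s j)))"
    by (simp only: row_eq_Theta[OF x] L2_norm_cnj)
  also have "\<dots> \<le> K * L2_norm half_line (\<lambda>s. cnj (indicator {x<..} s * E s j))"
    by (rule Theta_norm[OF L2_cnj[OF truncated_E_L2[OF x]]])
  also have "\<dots> \<le> K * (exp (- \<delta> * x) / sqrt (2 * \<delta>))"
    unfolding L2_norm_cnj by (intro mult_left_mono truncated_E_norm x K)
  finally show ?thesis by (simp add: K'_def)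
qed

lemma Theta_diff:
  assumes f: "f \<in> L2 half_line" and g: "g \<in> L2 half_line"
  shows "Theta_op l (\<lambda>s. f s - g s) j = Theta_op l f j - Theta_op l g j"
proof -
  have cE: "exp (- cnj (l j) * of_real s) = cnj (E s j)" for s by (simp add: exp_cnj)
  show ?thesis
    unfolding Theta_op_def right_diff_distrib cE
    by (intro Bochner_Integration.integral_diff L2_mult_integrable L2_cnj E_L2 f g)
qed

text \<open>The two truncated exponentials differ only on (x, y], where they are at most 1 in
  modulus, so their L^2 distance is at most sqrt (y - x); \<open>\<Theta>\<close> transports this to
  the rows.\<close>

lemma row_diff_norm_aux:
  assumes x: "0 \<le> x" and y: "x \<le> y"
  shows "L2_norm seq_measure (\<lambda>k. row x j k - row y j k) \<le> K * sqrt (y - x)"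
proof -
  let ?f = "\<lambda>x s. cnj (indicator {x<..} s * E s j)"
  have L2: "?f z \<in> L2 half_line" if "0 \<le> z" for z
    by (intro L2_cnj truncated_E_L2 that)
  have y0: "0 \<le> y" using x y by simp
  have "(\<lambda>k. row x j k - row y j k) = (\<lambda>k. cnj (Theta_op l (\<lambda>s. ?f x s - ?f y s) k))"
    by (simp only: row_eq_Theta[OF x] row_eq_Theta[OF y0] Theta_diff[OF L2[OF x] L2[OF y0]] complex_cnj_diff)
  then have "L2_norm seq_measure (\<lambda>k. row x j k - row y j k) \<le> K * L2_norm half_line (\<lambda>s. ?f x s - ?f y s)"
    using Theta_norm[OF L2_diff[OF L2[OF x] L2[OF y0]]] by (simp only: L2_norm_cnj)
  also have "\<dots> \<le> K * sqrt (y - x)"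
  proof (rule mult_left_mono[OF _ K])
    have "(\<integral>s. (cmod (?f x s - ?f y s))\<^sup>2 \<partial>half_line) \<le> (\<integral>s. indicator {x<..y} s \<partial>half_line)"
    proof (rule integral_mono)
      show "integrable half_line (\<lambda>s. (cmod (?f x s - ?f y s))\<^sup>2)"
        by (rule L2_integrable_square[OF L2_diff[OF L2[OF x] L2[OF y0]]])
      have "{x<..y} \<subseteq> {0<..}" using x by auto
      then show "integrable half_line (indicator {x<..y} :: real \<Rightarrow> real)"
        by (intro integrable_real_indicator)
          (use y in \<open>auto simp: sets_restrict_space emeasure_restrict_space intro!: image_eqI[of _ _ "{x<..y}"]\<close>)
      show "(cmod (?f x s - ?f y s))\<^sup>2 \<le> indicator {x<..y} s" if "s \<in> space half_line" for s
        using that E_le_1[of s j] x y by (auto simp: indicator_def power_le_one)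
    qed
    also have "\<dots> = y - x"
    proof -
      have sub: "{x<..y} \<subseteq> {0<..}" using x by auto
      have "measure half_line {x<..y} = measure lebesgue {x<..y}"
        by (rule measure_restrict_space) (use sub in auto)
      moreover have "{x<..y} \<inter> {0<..} = {x<..y}" using x by auto
      ultimately show ?thesis
        using y by simp
    qed
    finally show "L2_norm half_line (\<lambda>s. ?f x s - ?f y s) \<le> sqrt (y - x)"
      unfolding L2_norm_def by (rule real_sqrt_le_mono)
  qed
  finally show ?thesis .
qed

lemma row_diff_norm:
  assumes "0 \<le> x" "0 \<le> y"
  shows "L2_norm seq_measure (\<lambda>k. row x j k - row y j k) \<le> K * sqrt \<bar>x - y\<bar>"
  using row_diff_norm_aux[of x y j] row_diff_norm_aux[of y x j] assms
    L2_norm_minus_commute[of seq_measure "row x j" "row y j"]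
  by (cases "x \<le> y") (auto simp: abs_if)

subsection \<open>The operator \<open>R\<^sub>x\<close>\<close>

lemma row_mult_summable:
  assumes "0 \<le> x" "\<alpha> \<in> L2 seq_measure"
  shows "(\<lambda>k. row x j k * \<alpha> k) sums L2_inner seq_measure \<alpha> (\<lambda>k. cnj (row x j k))"
  using L2_inner_seq_sums[OF assms(2) L2_cnj[OF row_L2[OF assms(1)]], of j] by (simp add: mult.commute)

lemma R_op_eq:
  assumes "0 \<le> x" "\<alpha> \<in> L2 seq_measure"
  shows "R_op l \<xi> x \<alpha> j = \<xi> j * L2_inner seq_measure \<alpha> (\<lambda>k. cnj (row x j k))"
proof -
  have "R_op l \<xi> x \<alpha> j = (\<Sum>k. \<xi> j * (row x j k * \<alpha> k))"
    unfolding R_op_def row_def by (intro suminf_cong) simp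
  then show ?thesis
    using sums_mult[OF row_mult_summable[OF assms], of "\<xi> j" j] by (simp add: sums_iff)
qed

text \<open>The bound keeps the factor |\<open>\<xi> j\<close>| of each coordinate. This is why R_x
  maps l^2 into l^1, so that \<open>C\<close> can be applied after a resolvent.\<close>

lemma R_op_bound:
  assumes x: "0 \<le> x" and \<alpha>: "\<alpha> \<in> L2 seq_measure"
  shows "cmod (R_op l \<xi> x \<alpha> j) \<le> cmod (\<xi> j) * (K' * exp (- \<delta> * x) * L2_norm seq_measure \<alpha>)"
proof -
  have "cmod (L2_inner seq_measure \<alpha> (\<lambda>k. cnj (row x j k))) \<le> L2_norm seq_measure \<alpha> * L2_norm seq_measure (row x j)"
    using L2_Cauchy_Schwarz[OF \<alpha> L2_cnj[OF row_L2[OF x]]] by simp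
  also have "\<dots> \<le> L2_norm seq_measure \<alpha> * (K' * exp (- \<delta> * x))"
    by (intro mult_left_mono row_norm x) simp
  finally show ?thesis
    unfolding R_op_eq[OF assms] norm_mult by (intro mult_left_mono) (auto simp: mult_ac)
qed

lemma R_op_norm:
  assumes x: "0 \<le> x" and \<alpha>: "\<alpha> \<in> L2 seq_measure"
  shows "L2_norm seq_measure (R_op l \<xi> x \<alpha>) \<le> \<xi>_norm * K' * exp (- \<delta> * x) * L2_norm seq_measure \<alpha>"
  using L2_seq_bound(2)[OF summable_mult2[OF \<xi>_summable] R_op_bound[OF assms]]
  by (simp only: \<xi>_norm_def suminf_mult2[OF \<xi>_summable, symmetric] mult.assoc)

lemma R_op_ell1: "0 \<le> x \<Longrightarrow> \<alpha> \<in> L2 seq_measure \<Longrightarrow> R_op l \<xi> x \<alpha> \<in> ell1"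
  by (rule ell1_bound[OF summable_mult2[OF \<xi>_summable] R_op_bound])

text \<open>Norm continuity in the parameter with exponent 1/2, inherited from the rows; it drives
  the compactness argument for I - R_u.\<close>

lemma R_op_diff_norm:
  assumes x: "0 \<le> x" and y: "0 \<le> y" and \<alpha>: "\<alpha> \<in> L2 seq_measure"
  shows "L2_norm seq_measure (\<lambda>j. R_op l \<xi> x \<alpha> j - R_op l \<xi> y \<alpha> j)
    \<le> \<xi>_norm * K * sqrt \<bar>x - y\<bar> * L2_norm seq_measure \<alpha>"
proof -
  have "cmod (R_op l \<xi> x \<alpha> j - R_op l \<xi> y \<alpha> j)
      \<le> cmod (\<xi> j) * (K * sqrt \<bar>x - y\<bar> * L2_norm seq_measure \<alpha>)" for j
  proof -
    have "R_op l \<xi> x \<alpha> j - R_op l \<xi> y \<alpha> j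
        = \<xi> j * L2_inner seq_measure \<alpha> (\<lambda>k. cnj (row x j k) - cnj (row y j k))"
      by (simp add: R_op_eq x y \<alpha> L2_inner_diff_right L2_cnj row_L2 right_diff_distrib)
    moreover have "cmod (L2_inner seq_measure \<alpha> (\<lambda>k. cnj (row x j k) - cnj (row y j k)))
        \<le> L2_norm seq_measure \<alpha> * L2_norm seq_measure (\<lambda>k. cnj (row x j k - row y j k))"
      using L2_Cauchy_Schwarz[OF \<alpha> L2_cnj[OF L2_diff[OF row_L2[OF x] row_L2[OF y]]]] by simp
    moreover have "\<dots> \<le> L2_norm seq_measure \<alpha> * (K * sqrt \<bar>x - y\<bar>)"
      unfolding L2_norm_cnj by (intro mult_left_mono row_diff_norm x y) simp
    ultimately show ?thesis
      unfolding norm_mult by (metis (no_types, lifting) mult.commute mult_left_mono norm_ge_zero norm_mult order_trans)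
  qed
  from L2_seq_bound(2)[OF summable_mult2[OF \<xi>_summable] this]
  show ?thesis
    by (simp only: \<xi>_norm_def suminf_mult2[OF \<xi>_summable, symmetric] mult.assoc)
qed

text \<open>The coefficient is \<open>\<xi> j\<close>, the output vector the j-th unit vector, the
  input vector the j-th row. The conjugate undoes the one in the sesquilinear inner product.\<close>

lemma R_op_nuclear:
  assumes x: "0 \<le> x"
  shows "nuclear_operator seq_measure (R_op l \<xi> x) \<xi> (\<lambda>m j. if j = m then 1 else 0)
    (\<lambda>j k. cnj (row x j k)) (max 1 K')"
proof
  fix j :: nat
  have "(\<lambda>i. if i = j then 1 else 0 :: complex) = (\<lambda>i. if i \<in> {j} then 1 else 0)" by auto
  then show "(\<lambda>i. if i = j then 1 else 0 :: complex) \<in> L2 seq_measure"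
    and "L2_norm seq_measure (\<lambda>i. if i = j then 1 else 0 :: complex) \<le> max 1 K'"
    using L2_seq_finite_support[of "{j}" "\<lambda>_. 1"]
    by (auto simp: power2_eq_1_iff intro: order_trans[of _ 1])
  show "(\<lambda>k. cnj (row x j k)) \<in> L2 seq_measure"
    by (intro L2_cnj row_L2 x)
  have "K' * exp (- \<delta> * x) \<le> K' * 1"
    using \<delta> x by (intro mult_left_mono K'_nonneg) simp
  then show "L2_norm seq_measure (\<lambda>k. cnj (row x j k)) \<le> max 1 K'"
    unfolding L2_norm_cnj using row_norm[OF x, of j] by simp
next
  fix \<alpha> :: "nat \<Rightarrow> complex" and j assume \<alpha>: "\<alpha> \<in> L2 seq_measure"
  have "(\<lambda>m. \<xi> m * L2_inner seq_measure \<alpha> (\<lambda>k. cnj (row x m k)) * (if j = m then 1 else 0))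
      sums (\<Sum>m\<in>{j}. \<xi> m * L2_inner seq_measure \<alpha> (\<lambda>k. cnj (row x m k)) * (if j = m then 1 else 0))"
    by (rule sums_finite) auto
  then show "R_op l \<xi> x \<alpha> j
      = (\<Sum>m. \<xi> m * L2_inner seq_measure \<alpha> (\<lambda>k. cnj (row x m k)) * (if j = m then 1 else 0))"
    by (simp add: R_op_eq[OF x \<alpha>] sums_iff)
qed (use \<xi>_summable in auto)

lemma R_op_trace_class: "0 \<le> x \<Longrightarrow> trace_class seq_measure (R_op l \<xi> x)"
  using nuclear_operator.T_trace_class[OF R_op_nuclear] .

lemma R_op_bounded: "0 \<le> x \<Longrightarrow> bounded_operator seq_measure seq_measure (R_op l \<xi> x)"
  using nuclear_operator.T_bounded[OF R_op_nuclear] .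

end

context linear_system
begin

subsection \<open>The Hankel operator\<close>

lemma symbol_eq: "symbol_phi l \<xi> z = (\<Sum>j. \<xi> j * E z j)"
  unfolding symbol_phi_def C_op_def semigroup_eq B_op_def by (simp add: mult.commute)

lemma symbol_summable:
  assumes "0 \<le> z"
  shows "summable (\<lambda>j. cmod (\<xi> j * E z j))"
proof (rule summable_comparison_test'[OF \<xi>_summable, of 0])
  show "norm (cmod (\<xi> j * E z j)) \<le> cmod (\<xi> j)" for j
    unfolding norm_mult real_norm_def abs_mult abs_norm_cancel by (rule mult_left_le[OF E_le_1[OF assms] norm_ge_zero])
qed

lemma symbol_bound:
  assumes "0 \<le> z"
  shows "cmod (symbol_phi l \<xi> z) \<le> \<xi>_norm * exp (- \<delta> * z)"
proof -
  have "cmod (symbol_phi l \<xi> z) \<le> (\<Sum>j. cmod (\<xi> j * E z j))"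
    unfolding symbol_eq by (rule summable_norm[OF symbol_summable[OF assms]])
  also have "\<dots> \<le> (\<Sum>j. cmod (\<xi> j) * exp (- \<delta> * z))"
    unfolding norm_mult
    by (intro suminf_le mult_left_mono E_bound assms summable_mult2 \<xi>_summable norm_ge_zero)
      (use symbol_summable[OF assms] in \<open>simp add: norm_mult\<close>)
  finally show ?thesis
    by (simp only: \<xi>_norm_def suminf_mult2[OF \<xi>_summable, symmetric])
qed

lemma E_measurable [measurable]: "(\<lambda>s. E s j) \<in> borel_measurable borel"
  by (intro borel_measurable_continuous_onI continuous_intros)

lemma E_add: "E (s + t) j = E s j * E t j"
  by (simp add: distrib_left exp_add[symmetric])

text \<open>The exponential splits as E (x + y + 2 t) = E x E y E (2 t). The whole shift is put into
  the coefficient, so the vectors of the nuclear series do not depend on \<open>t\<close>.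
  Cauchy-Schwarz bounds the j-th integral by a multiple of |\<open>\<xi> j\<close>|, which permits
  termwise integration.\<close>

lemma hankel_sums:
  assumes h: "h \<in> L2 half_line" and x: "0 < x" and t: "0 \<le> t"
  shows "(\<lambda>j. (\<xi> j * E (2 * t) j) * L2_inner half_line h (\<lambda>s. cnj (E s j)) * E x j)
    sums hankel_op (\<lambda>z. symbol_phi l \<xi> (z + 2 * t)) h x"
proof -
  define f where "f j y = \<xi> j * E (2 * t) j * E x j * (h y * E y j)" for j y
  have hE: "integrable half_line (\<lambda>y. h y * E y j)" for j
    by (rule L2_mult_integrable[OF h E_L2])
  have f_int: "integrable half_line (f j)" for j
    unfolding f_def[abs_def] by (intro integrable_mult_right hE)
  have coeff: "cmod (\<xi> j * E (2 * t) j * E x j) \<le> cmod (\<xi> j)" for j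
    using E_le_1[of "2 * t" j] E_le_1[of x j] x t unfolding norm_mult mult.assoc
    by (intro mult_left_le mult_le_one) auto
  have "(\<lambda>j. integral\<^sup>L half_line (f j)) sums (\<integral>y. (\<Sum>j. f j y) \<partial>half_line)"
  proof (rule sums_integral[OF f_int])
    show "AE y in half_line. summable (\<lambda>j. norm (f j y))"
    proof (rule AE_I2)
      fix y assume "y \<in> space half_line"
      then have y: "0 \<le> y" by simp
      show "summable (\<lambda>j. norm (f j y))"
      proof (rule summable_comparison_test'[OF summable_mult2[OF \<xi>_summable, of "cmod (h y)"], of 0])
        show "norm (norm (f j y)) \<le> cmod (\<xi> j) * cmod (h y)" for j
          using mult_mono[OF coeff[of j] mult_left_le[OF E_le_1[OF y, of j] norm_ge_zero[of "h y"]]]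
          by (simp add: f_def norm_mult)
      qed
    qed
    show "summable (\<lambda>j. \<integral>y. norm (f j y) \<partial>half_line)"
    proof (rule summable_comparison_test'[OF summable_mult2[OF \<xi>_summable, of "L2_norm half_line h * (1 / sqrt (2 * \<delta>))"], of 0])
      fix j
      have "(\<integral>y. norm (f j y) \<partial>half_line) = cmod (\<xi> j * E (2 * t) j * E x j) * (\<integral>y. cmod (h y) * cmod (E y j) \<partial>half_line)"
        unfolding f_def norm_mult by (simp only: integral_mult_right_zero)
      also have "\<dots> \<le> cmod (\<xi> j) * (L2_norm half_line h * (1 / sqrt (2 * \<delta>)))"
        by (intro mult_mono coeff order_trans[OF L2_Cauchy_Schwarz_abs[OF h E_L2]] mult_left_mono E_norm)
          (auto intro!: integral_nonneg_AE)
      finally show "norm (\<integral>y. norm (f j y) \<partial>half_line) \<le> cmod (\<xi> j) * (L2_norm half_line h * (1 / sqrt (2 * \<delta>)))"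
        by (simp add: integral_nonneg_AE)
    qed
  qed
  moreover have "integral\<^sup>L half_line (f j) = (\<xi> j * E (2 * t) j) * L2_inner half_line h (\<lambda>s. cnj (E s j)) * E x j" for j
  proof -
    have "integral\<^sup>L half_line (f j) = \<xi> j * E (2 * t) j * E x j * (\<integral>y. h y * E y j \<partial>half_line)"
      unfolding f_def by (rule integral_mult_right_zero)
    then show ?thesis
      unfolding L2_inner_def complex_cnj_cnj by (simp only: mult_ac)
  qed
  moreover have "(\<integral>y. (\<Sum>j. f j y) \<partial>half_line) = hankel_op (\<lambda>z. symbol_phi l \<xi> (z + 2 * t)) h x"
    unfolding hankel_op_def
  proof (rule Bochner_Integration.integral_cong[OF refl])
    fix y assume "y \<in> space half_line"
    then have pos: "0 \<le> x + y + 2 * t" using x t by simp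
    have "symbol_phi l \<xi> (x + y + 2 * t) * h y = (\<Sum>j. \<xi> j * E (x + y + 2 * t) j * h y)"
      unfolding symbol_eq by (rule suminf_mult2[OF summable_norm_cancel[OF symbol_summable[OF pos]]])
    also have "\<dots> = (\<Sum>j. f j y)"
      unfolding f_def E_add by (simp only: mult_ac)
    finally show "(\<Sum>j. f j y) = symbol_phi l \<xi> (x + y + 2 * t) * h y" by simp
  qed
  ultimately show ?thesis by simp
qed

text \<open>The scalar \<open>c\<close> covers both the Hankel operator (c = 1) and its negative (c
  = -1), whose determinant is required. The input vectors are conjugated because the Hankel kernel
  is bilinear.\<close>

lemma hankel_nuclear:
  assumes t: "0 \<le> t"
  shows "nuclear_operator half_line (\<lambda>h x. c * hankel_op (\<lambda>z. symbol_phi l \<xi> (z + 2 * t)) h x)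
    (\<lambda>j. c * (\<xi> j * E (2 * t) j)) (\<lambda>j s. E s j) (\<lambda>j s. cnj (E s j)) (max 1 (1 / sqrt (2 * \<delta>)))"
proof
  show "summable (\<lambda>j. cmod (c * (\<xi> j * E (2 * t) j)))"
    unfolding norm_mult[of c] using t by (intro summable_mult symbol_summable) simp
  fix j
  show "(\<lambda>s. E s j) \<in> L2 half_line" by (rule E_L2)
  then show "(\<lambda>s. cnj (E s j)) \<in> L2 half_line" by (rule L2_cnj)
  show "L2_norm half_line (\<lambda>s. E s j) \<le> max 1 (1 / sqrt (2 * \<delta>))"
    by (rule order_trans[OF E_norm]) simp
  then show "L2_norm half_line (\<lambda>s. cnj (E s j)) \<le> max 1 (1 / sqrt (2 * \<delta>))"
    by (simp only: L2_norm_cnj)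
  show "cmod (E x j) \<le> max 1 (1 / sqrt (2 * \<delta>))" if "x \<in> space half_line" for x
    by (rule order_trans[OF E_le_1]) (use that in auto)
next
  fix f x assume f: "f \<in> L2 half_line" and "x \<in> space half_line"
  then have x: "0 < x" by simp
  have "(\<lambda>j. c * (\<xi> j * E (2 * t) j) * L2_inner half_line f (\<lambda>s. cnj (E s j)) * E x j)
      sums (c * hankel_op (\<lambda>z. symbol_phi l \<xi> (z + 2 * t)) f x)"
    using sums_mult[OF hankel_sums[OF f x t], of c] by (simp only: mult.assoc)
  then show "c * hankel_op (\<lambda>z. symbol_phi l \<xi> (z + 2 * t)) f x
      = (\<Sum>j. c * (\<xi> j * E (2 * t) j) * L2_inner half_line f (\<lambda>s. cnj (E s j)) * E x j)"
    by (simp only: sums_iff)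
qed

lemma hankel_trace_class: "trace_class half_line (hankel_op (symbol_phi l \<xi>))"
  using nuclear_operator.T_trace_class[OF hankel_nuclear[of 0 1]] by simp

subsection \<open>The integral formula for \<open>R\<^sub>x\<close>\<close>

text \<open>The function is the image of the finite sequence \<beta> under the adjoint of
  \<open>\<Theta>\<close>, so it obeys the same bound \<open>K\<close>. The proof pairs it with
  itself and moves \<open>\<Theta>\<close> to the other side.\<close>

lemma exponential_sum_norm:
  assumes I: "finite I"
  shows "L2_norm half_line (\<lambda>s. \<Sum>k\<in>I. \<beta> k * E s k) \<le> K * sqrt (\<Sum>k\<in>I. (cmod (\<beta> k))\<^sup>2)"
proof -
  let ?g = "\<lambda>s. \<Sum>k\<in>I. \<beta> k * E s k"
  have g: "?g \<in> L2 half_line" by (intro L2_sum L2_scale E_L2)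
  have inner: "L2_inner half_line (\<lambda>s. E s k) ?g = cnj (Theta_op l ?g k)" for k
  proof -
    have "L2_inner half_line ?g (\<lambda>s. E s k) = Theta_op l ?g k"
      unfolding L2_inner_def Theta_op_def
      by (rule Bochner_Integration.integral_cong[OF refl]) (simp add: exp_cnj mult.commute)
    then show ?thesis by (subst L2_inner_commute) simp
  qed
  have "(L2_norm half_line ?g)\<^sup>2 = cmod (L2_inner half_line ?g ?g)"
    by (simp only: L2_inner_self norm_of_real abs_of_nonneg[OF zero_le_power2])
  also have "L2_inner half_line ?g ?g = (\<Sum>k\<in>I. \<beta> k * cnj (Theta_op l ?g k))"
    unfolding L2_inner_sum_left[OF L2_scale[OF E_L2] g] L2_inner_scale_left inner ..
  also have "cmod \<dots> \<le> (\<Sum>k\<in>I. \<bar>cmod (\<beta> k)\<bar> * \<bar>cmod (Theta_op l ?g k)\<bar>)"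
    by (rule order_trans[OF norm_sum]) (simp add: norm_mult)
  also have "\<dots> \<le> L2_set (\<lambda>k. cmod (\<beta> k)) I * L2_set (\<lambda>k. cmod (Theta_op l ?g k)) I"
    by (rule L2_set_mult_ineq)
  also have "\<dots> \<le> L2_set (\<lambda>k. cmod (\<beta> k)) I * (K * L2_norm half_line ?g)"
  proof (rule mult_left_mono)
    have T: "Theta_op l ?g \<in> L2 seq_measure" by (rule Theta_L2[OF g])
    have "(\<Sum>k\<in>I. (cmod (Theta_op l ?g k))\<^sup>2) \<le> (L2_norm seq_measure (Theta_op l ?g))\<^sup>2"
      unfolding L2_norm_seq_square[OF T]
      by (rule sum_le_suminf) (use T I in \<open>auto simp: L2_seq_iff\<close>)
    then have "L2_set (\<lambda>k. cmod (Theta_op l ?g k)) I \<le> L2_norm seq_measure (Theta_op l ?g)"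
      unfolding L2_set_def by (rule real_le_lsqrt[OF L2_norm_nonneg])
    then show "L2_set (\<lambda>k. cmod (Theta_op l ?g k)) I \<le> K * L2_norm half_line ?g"
      using Theta_norm[OF g] by linarith
  qed simp
  finally have "L2_norm half_line ?g * L2_norm half_line ?g
      \<le> K * L2_set (\<lambda>k. cmod (\<beta> k)) I * L2_norm half_line ?g"
    by (simp only: power2_eq_square mult_ac)
  then have le: "L2_norm half_line ?g * L2_norm half_line ?g
      \<le> K * sqrt (\<Sum>k\<in>I. (cmod (\<beta> k))\<^sup>2) * L2_norm half_line ?g"
    by (simp only: L2_set_def)
  show ?thesis
  proof (cases "0 < L2_norm half_line ?g")
    case True
    show ?thesis by (rule mult_right_le_imp_le[OF le True])
  next
    case False
    have "0 \<le> K * sqrt (\<Sum>k\<in>I. (cmod (\<beta> k))\<^sup>2)"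
      by (intro mult_nonneg_nonneg K real_sqrt_ge_zero sum_nonneg) simp
    with False show ?thesis by linarith
  qed
qed

context
  fixes x :: real and \<alpha> :: "nat \<Rightarrow> complex"
  assumes x: "0 \<le> x" and \<alpha>: "\<alpha> \<in> L2 seq_measure"
    and conv: "\<And>s. x < s \<Longrightarrow> semigroup_op l s \<alpha> \<in> ell1"
begin

definition c_fun :: "real \<Rightarrow> complex" where
  "c_fun s = C_op (semigroup_op l s \<alpha>)"

definition part :: "nat \<Rightarrow> real \<Rightarrow> complex" where
  "part n s = (\<Sum>k<n. \<alpha> k * E s k)"

lemma c_fun_measurable [measurable]: "c_fun \<in> borel_measurable borel"
  unfolding c_fun_def[abs_def] C_op_def semigroup_eq by measurable

lemma part_L2: "part n \<in> L2 half_line"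
  unfolding part_def[abs_def] by (intro L2_sum L2_scale E_L2)

lemma part_tendsto:
  assumes "x < s"
  shows "(\<lambda>n. part n s) \<longlonglongrightarrow> c_fun s"
proof -
  have "part n s = (\<Sum>k<n. semigroup_op l s \<alpha> k)" for n
    unfolding part_def semigroup_eq by (rule sum.cong) (rule refl, rule mult.commute)
  then show ?thesis
    using summable_LIMSEQ[OF ell1_summable[OF conv[OF assms]]] by (simp only: c_fun_def C_op_def)
qed

lemma truncation_L2:
  assumes f: "f \<in> L2 half_line"
  shows "(\<lambda>s. indicator {x<..} s * f s) \<in> L2 half_line"
    and "L2_norm half_line (\<lambda>s. indicator {x<..} s * f s) \<le> L2_norm half_line f"
proof -
  have le: "cmod (indicator {x<..} s * f s) \<le> cmod (f s)" for s
    by (simp add: indicator_def)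
  have [measurable]: "f \<in> borel_measurable half_line" by (rule L2_measurable[OF f])
  have ind [measurable]: "(indicator {x<..} :: real \<Rightarrow> complex) \<in> borel_measurable half_line"
    by (intro borel_measurable_half_line borel_measurable_indicator) simp
  show "(\<lambda>s. indicator {x<..} s * f s) \<in> L2 half_line"
  proof (rule L2_bound[OF _ L2_integrable_square[OF f]])
    show "(\<lambda>s. indicator {x<..} s * f s) \<in> borel_measurable half_line"
      using ind \<open>f \<in> borel_measurable half_line\<close> by (rule borel_measurable_times)
  qed (use le in \<open>auto intro!: power_mono\<close>)
  show "L2_norm half_line (\<lambda>s. indicator {x<..} s * f s) \<le> L2_norm half_line f"
    by (rule L2_norm_mono[OF f le])
qed

lemma part_diff_norm:
  assumes "n \<le> k"
  shows "L2_norm half_line (\<lambda>s. part k s - part n s)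
    \<le> K * sqrt ((\<Sum>j. (cmod (\<alpha> j))\<^sup>2) - (\<Sum>j<n. (cmod (\<alpha> j))\<^sup>2))"
proof -
  have split: "{..<k} = {..<n} \<union> {n..<k}" "{..<n} \<inter> {n..<k} = {}" using assms by auto
  have "part k s - part n s = (\<Sum>j\<in>{n..<k}. \<alpha> j * E s j)" for s
    unfolding part_def split(1) by (subst sum.union_disjoint) (use split in auto)
  then have "L2_norm half_line (\<lambda>s. part k s - part n s) \<le> K * sqrt (\<Sum>j\<in>{n..<k}. (cmod (\<alpha> j))\<^sup>2)"
    using exponential_sum_norm[of "{n..<k}" \<alpha>] by simp
  also have "(\<Sum>j\<in>{n..<k}. (cmod (\<alpha> j))\<^sup>2) = (\<Sum>j<k. (cmod (\<alpha> j))\<^sup>2) - (\<Sum>j<n. (cmod (\<alpha> j))\<^sup>2)"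
    unfolding split(1) by (subst sum.union_disjoint) (use split in auto)
  also have "K * sqrt ((\<Sum>j<k. (cmod (\<alpha> j))\<^sup>2) - (\<Sum>j<n. (cmod (\<alpha> j))\<^sup>2))
      \<le> K * sqrt ((\<Sum>j. (cmod (\<alpha> j))\<^sup>2) - (\<Sum>j<n. (cmod (\<alpha> j))\<^sup>2))"
    using \<alpha> by (intro mult_left_mono real_sqrt_le_mono diff_right_mono sum_le_suminf K) (auto simp: L2_seq_iff)
  finally show ?thesis .
qed

text \<open>On (x, \<infinity>) the partial sums converge pointwise to C e^(-sA) \<alpha>, and the
  adjoint bound makes them Cauchy in L^2. \<open>L2_Fatou\<close> joins the two, although
  \<open>C\<close> itself is unbounded on l^2.\<close>

lemma c_fun_minus_part:
  shows "(\<lambda>s. indicator {x<..} s * (c_fun s - part n s)) \<in> L2 half_line"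
    and "L2_norm half_line (\<lambda>s. indicator {x<..} s * (c_fun s - part n s))
      \<le> K * sqrt ((\<Sum>j. (cmod (\<alpha> j))\<^sup>2) - (\<Sum>j<n. (cmod (\<alpha> j))\<^sup>2))"
proof -
  have L2: "(\<lambda>s. part k s - part n s) \<in> L2 half_line" for k
    by (intro L2_diff part_L2)
  have meas: "(\<lambda>s. indicator {x<..} s * (c_fun s - part n s)) \<in> borel_measurable half_line"
    unfolding part_def by (rule borel_measurable_half_line) measurable
  have lim: "AE s in half_line. (\<lambda>k. indicator {x<..} s * (part k s - part n s))
      \<longlonglongrightarrow> indicator {x<..} s * (c_fun s - part n s)"
  proof (rule AE_I2)
    fix s
    show "(\<lambda>k. indicator {x<..} s * (part k s - part n s)) \<longlonglongrightarrow> indicator {x<..} s * (c_fun s - part n s)"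
      by (cases "x < s") (auto intro!: tendsto_intros part_tendsto)
  qed
  have bound: "L2_norm half_line (\<lambda>s. indicator {x<..} s * (part k s - part n s))
      \<le> K * sqrt ((\<Sum>j. (cmod (\<alpha> j))\<^sup>2) - (\<Sum>j<n. (cmod (\<alpha> j))\<^sup>2))" if "n \<le> k" for k
    by (rule order_trans[OF truncation_L2(2)[OF L2] part_diff_norm[OF that]])
  note F = L2_Fatou[OF truncation_L2(1)[OF L2] meas lim bound]
  show "(\<lambda>s. indicator {x<..} s * (c_fun s - part n s)) \<in> L2 half_line" by (rule F)
  show "L2_norm half_line (\<lambda>s. indicator {x<..} s * (c_fun s - part n s))
      \<le> K * sqrt ((\<Sum>j. (cmod (\<alpha> j))\<^sup>2) - (\<Sum>j<n. (cmod (\<alpha> j))\<^sup>2))" by (rule F)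
qed

lemma truncated_c_fun_L2: "(\<lambda>s. indicator {x<..} s * c_fun s) \<in> L2 half_line"
  using c_fun_minus_part(1)[of 0] by (simp add: part_def)

text \<open>Both sides are limits of the pairings of the partial sums: by L^2 convergence on the
  left, and on the right because a truncated pairing is a partial sum of row times \<alpha>.\<close>

lemma c_fun_inner:
  "L2_inner half_line (\<lambda>s. indicator {x<..} s * c_fun s) (\<lambda>s. cnj (E s j))
    = L2_inner seq_measure \<alpha> (\<lambda>k. cnj (row x j k))"
proof (rule LIMSEQ_unique)
  let ?H = "\<lambda>s. indicator {x<..} s * c_fun s"
  let ?P = "\<lambda>n s. indicator {x<..} s * part n s"
  have norm: "(\<lambda>n. L2_norm half_line (\<lambda>s. ?P n s - ?H s)) \<longlonglongrightarrow> 0"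
  proof (rule tendsto_sandwich[OF _ _ tendsto_const])
    show "\<forall>\<^sub>F n in sequentially. L2_norm half_line (\<lambda>s. ?P n s - ?H s)
        \<le> K * sqrt ((\<Sum>j. (cmod (\<alpha> j))\<^sup>2) - (\<Sum>j<n. (cmod (\<alpha> j))\<^sup>2))"
      using c_fun_minus_part(2)
      by (subst L2_norm_minus_commute) (simp add: right_diff_distrib)
    have "(\<lambda>n. K * sqrt ((\<Sum>j. (cmod (\<alpha> j))\<^sup>2) - (\<Sum>j<n. (cmod (\<alpha> j))\<^sup>2)))
        \<longlonglongrightarrow> K * sqrt ((\<Sum>j. (cmod (\<alpha> j))\<^sup>2) - (\<Sum>j. (cmod (\<alpha> j))\<^sup>2))"
      using \<alpha> by (intro tendsto_intros summable_LIMSEQ) (simp add: L2_seq_iff)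
    then show "(\<lambda>n. K * sqrt ((\<Sum>j. (cmod (\<alpha> j))\<^sup>2) - (\<Sum>j<n. (cmod (\<alpha> j))\<^sup>2))) \<longlonglongrightarrow> 0"
      by simp
  qed simp
  show "(\<lambda>n. L2_inner half_line (?P n) (\<lambda>s. cnj (E s j))) \<longlonglongrightarrow> L2_inner half_line ?H (\<lambda>s. cnj (E s j))"
    by (rule L2_inner_tendsto[OF truncation_L2(1)[OF part_L2] truncated_c_fun_L2 L2_cnj[OF E_L2] norm])
  have "L2_inner half_line (?P n) (\<lambda>s. cnj (E s j)) = (\<Sum>k<n. row x j k * \<alpha> k)" for n
  proof -
    have "?P n = (\<lambda>s. \<Sum>k<n. \<alpha> k * (indicator {x<..} s * E s k))"
      by (simp add: part_def sum_distrib_left mult_ac)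
    then have "L2_inner half_line (?P n) (\<lambda>s. cnj (E s j))
        = (\<Sum>k<n. \<alpha> k * L2_inner half_line (\<lambda>s. indicator {x<..} s * E s k) (\<lambda>s. cnj (E s j)))"
      by (simp only: L2_inner_sum_left[OF L2_scale[OF truncated_E_L2[OF x]] L2_cnj[OF E_L2]] L2_inner_scale_left)
    moreover have "L2_inner half_line (\<lambda>s. indicator {x<..} s * E s k) (\<lambda>s. cnj (E s j)) = row x j k" for k
      using truncated_E_inner[OF x, of k j] by (simp add: L2_inner_def mult.assoc)
    ultimately show ?thesis by (simp add: mult.commute)
  qed
  then show "(\<lambda>n. L2_inner half_line (?P n) (\<lambda>s. cnj (E s j))) \<longlonglongrightarrow> L2_inner seq_measure \<alpha> (\<lambda>k. cnj (row x j k))"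
    using row_mult_summable[OF x \<alpha>, of j] by (simp add: sums_def)
qed

lemma integrand_eq: "semigroup_op l s (B_op \<xi> (C_op (semigroup_op l s \<alpha>))) j = \<xi> j * (c_fun s * E s j)"
  by (simp add: semigroup_eq B_op_def c_fun_def mult_ac)

lemma R_op_integrable:
  "set_integrable lebesgue {x<..} (\<lambda>s. semigroup_op l s (B_op \<xi> (C_op (semigroup_op l s \<alpha>))) j)"
proof -
  have "integrable half_line (\<lambda>s. \<xi> j * ((indicator {x<..} s * c_fun s) * E s j))"
    by (intro integrable_mult_right L2_mult_integrable truncated_c_fun_L2 E_L2)
  moreover have "\<xi> j * ((indicator {x<..} s * c_fun s) * E s j) = indicator {x<..} s *\<^sub>R (\<xi> j * (c_fun s * E s j))" for s
    by (simp add: indicator_def)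
  ultimately show ?thesis
    by (simp only: half_line_set_integrable(1)[OF x] integrand_eq)
qed

lemma R_op_integral:
  "R_op l \<xi> x \<alpha> j = (LINT s:{x<..}|lebesgue. semigroup_op l s (B_op \<xi> (C_op (semigroup_op l s \<alpha>))) j)"
proof -
  have "(LINT s:{x<..}|lebesgue. semigroup_op l s (B_op \<xi> (C_op (semigroup_op l s \<alpha>))) j)
      = (\<integral>s. \<xi> j * ((indicator {x<..} s * c_fun s) * cnj (cnj (E s j))) \<partial>half_line)"
    unfolding half_line_set_integrable(2)[OF x] integrand_eq
    by (rule Bochner_Integration.integral_cong[OF refl]) (simp add: indicator_def)
  also have "\<dots> = \<xi> j * L2_inner half_line (\<lambda>s. indicator {x<..} s * c_fun s) (\<lambda>s. cnj (E s j))"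
    unfolding L2_inner_def by (simp only: integral_mult_right_zero)
  finally show ?thesis
    by (simp only: c_fun_inner R_op_eq[OF x \<alpha>])
qed

text \<open>The l^2 norm of the integrand is |C e^(-sA) \<alpha>| times the norm of e^(-sA) \<xi>.
  The first factor is square integrable on (x, \<infinity>), the second decays like e^(-\<delta>
  s).\<close>

lemma R_op_norm_integrable:
  "set_integrable lebesgue {x<..} (\<lambda>s. L2_norm seq_measure (semigroup_op l s (B_op \<xi> (C_op (semigroup_op l s \<alpha>)))))"
proof -
  \<comment> \<open>The norm is written as the root of a series so that measurability in s is
    immediate; the two agree for s \<ge> 0.\<close>
  define N where "N s = sqrt (\<Sum>j. (cmod (E s j * \<xi> j))\<^sup>2)" for s
  have [measurable]: "N \<in> borel_measurable borel"
    unfolding N_def[abs_def] by measurable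
  have b: "(\<lambda>j. E s j * \<xi> j) \<in> L2 seq_measure"
    "L2_norm seq_measure (\<lambda>j. E s j * \<xi> j) \<le> \<xi>_norm * exp (- \<delta> * s)" if s: "0 \<le> s" for s
  proof -
    have "cmod (E s j * \<xi> j) \<le> cmod (\<xi> j) * exp (- \<delta> * s)" for j
      unfolding norm_mult using mult_right_mono[OF E_bound[OF s, of j] norm_ge_zero[of "\<xi> j"]] by (simp add: mult.commute)
    from L2_seq_bound[OF summable_mult2[OF \<xi>_summable] this]
    show "(\<lambda>j. E s j * \<xi> j) \<in> L2 seq_measure"
      "L2_norm seq_measure (\<lambda>j. E s j * \<xi> j) \<le> \<xi>_norm * exp (- \<delta> * s)"
      by (simp_all only: \<xi>_norm_def suminf_mult2[OF \<xi>_summable, symmetric])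
  qed
  have N: "N s = L2_norm seq_measure (\<lambda>j. E s j * \<xi> j)" if "0 \<le> s" for s
    unfolding N_def L2_norm_seq_square[OF b(1)[OF that], symmetric] by simp
  have eq: "L2_norm seq_measure (semigroup_op l s (B_op \<xi> (C_op (semigroup_op l s \<alpha>)))) = cmod (c_fun s) * N s"
    if "0 \<le> s" for s
  proof -
    have "semigroup_op l s (B_op \<xi> (C_op (semigroup_op l s \<alpha>))) = (\<lambda>j. c_fun s * (E s j * \<xi> j))"
      by (simp add: integrand_eq fun_eq_iff mult_ac)
    then show ?thesis by (simp only: L2_norm_scale N[OF that])
  qed
  have "integrable half_line (\<lambda>s. (indicator {x<..} s * c_fun s) * exp (- of_real \<delta> * of_real s))"
    using truncated_exp_L2(1)[of "of_real \<delta>" 0] half_line_cong(3)[of "\<lambda>s. indicator {0<..} s * exp (- of_real \<delta> * of_real s)" "\<lambda>s. exp (- of_real \<delta> * of_real s)"] \<delta>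
    by (intro L2_mult_integrable truncated_c_fun_L2) simp
  then have int: "integrable half_line (\<lambda>s. \<xi>_norm * norm ((indicator {x<..} s * c_fun s) * exp (- of_real \<delta> * of_real s)))"
    by (intro integrable_mult_right integrable_norm)
  have "integrable half_line (\<lambda>s. indicator {x<..} s * (cmod (c_fun s) * N s))"
  proof (rule Bochner_Integration.integrable_bound[OF int])
    show "(\<lambda>s. indicator {x<..} s * (cmod (c_fun s) * N s)) \<in> borel_measurable half_line"
      by (rule borel_measurable_half_line) measurable
    show "AE s in half_line. norm (indicator {x<..} s * (cmod (c_fun s) * N s))
        \<le> norm (\<xi>_norm * norm ((indicator {x<..} s * c_fun s) * exp (- of_real \<delta> * of_real s)))"
    proof (rule AE_I2)
      fix s assume "s \<in> space half_line"
      then have s: "0 \<le> s" by simp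
      have "cmod (c_fun s) * N s \<le> cmod (c_fun s) * (\<xi>_norm * exp (- \<delta> * s))"
        using b(2)[OF s] N[OF s] by (intro mult_left_mono) auto
      moreover have "0 \<le> N s" using N[OF s] by simp
      ultimately show "norm (indicator {x<..} s * (cmod (c_fun s) * N s))
        \<le> norm (\<xi>_norm * norm ((indicator {x<..} s * c_fun s) * exp (- of_real \<delta> * of_real s)))"
        using \<xi>_norm_nonneg by (simp add: indicator_def norm_mult norm_exp_eq_Re mult_ac)
    qed
  qed
  moreover have "integrable half_line (\<lambda>s. indicator {x<..} s * (cmod (c_fun s) * N s)) \<longleftrightarrow>
      integrable half_line (\<lambda>s. indicator {x<..} s *\<^sub>R L2_norm seq_measure (semigroup_op l s (B_op \<xi> (C_op (semigroup_op l s \<alpha>)))))"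
    by (rule Bochner_Integration.integrable_cong[OF refl]) (simp add: eq)
  ultimately show ?thesis
    by (simp only: half_line_set_integrable(1)[OF x])
qed

end

subsection \<open>Resolvents and the integral equation\<close>

lemma input_ell1:
  assumes "0 \<le> y"
  shows "semigroup_op l y (B_op \<xi> 1) \<in> ell1"
  unfolding ell1_def mem_Collect_eq semigroup_eq B_op_def
  using symbol_summable[OF assms] by (simp only: mult_1 mult.commute)

lemma semigroup_ell1:
  assumes t: "0 \<le> t" and w: "w \<in> ell1"
  shows "semigroup_op l t w \<in> ell1"
proof (rule ell1_bound)
  show "summable (\<lambda>j. cmod (w j))" using w by (simp add: ell1_def)
  show "cmod (semigroup_op l t w j) \<le> cmod (w j)" for j
    unfolding semigroup_eq norm_mult by (rule mult_left_le_one_le[OF norm_ge_zero norm_ge_zero E_le_1[OF t]])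
qed

lemma input_norm:
  assumes "0 \<le> y"
  shows "L2_norm seq_measure (semigroup_op l y (B_op \<xi> 1)) \<le> \<xi>_norm * exp (- \<delta> * y)"
proof -
  have "cmod (semigroup_op l y (B_op \<xi> 1) j) \<le> cmod (\<xi> j) * exp (- \<delta> * y)" for j
    unfolding semigroup_eq B_op_def norm_mult
    using mult_left_mono[OF E_bound[OF assms, of j] norm_ge_zero[of "\<xi> j"]]
    by (simp only: norm_one mult_1 mult.commute)
  from L2_seq_bound(2)[OF summable_mult2[OF \<xi>_summable] this] show ?thesis
    by (simp only: \<xi>_norm_def suminf_mult2[OF \<xi>_summable, symmetric])
qed

lemma C_semigroup_input: "C_op (semigroup_op l s (semigroup_op l y (B_op \<xi> 1))) = symbol_phi l \<xi> (s + y)"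
  unfolding C_op_def semigroup_eq B_op_def symbol_eq E_add by (simp only: mult_1 mult_ac)

text \<open>The bound for R_x at x = 0 dominates that for every later x, so one disc of parameters
  \<mu> works for all x.\<close>

lemma resolvent_exists:
  assumes x: "0 \<le> x" and \<mu>: "cmod \<mu> * (\<xi>_norm * K') < 1"
  shows "invertible_operator seq_measure (\<lambda>\<alpha> j. \<alpha> j + \<mu> * R_op l \<xi> x \<alpha> j)"
proof (rule Neumann_invertible[OF R_op_bounded[OF x] _ \<mu>])
  show "0 \<le> \<xi>_norm * K'"
    by (intro mult_nonneg_nonneg \<xi>_norm_nonneg K'_nonneg)
  fix \<alpha> assume \<alpha>: "\<alpha> \<in> L2 seq_measure"
  have "\<xi>_norm * K' * exp (- \<delta> * x) \<le> \<xi>_norm * K' * 1"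
    using \<delta> x by (intro mult_left_mono mult_nonneg_nonneg \<xi>_norm_nonneg K'_nonneg) simp
  then have "\<xi>_norm * K' * exp (- \<delta> * x) * L2_norm seq_measure \<alpha> \<le> \<xi>_norm * K' * L2_norm seq_measure \<alpha>"
    by (intro mult_right_mono) auto
  then show "L2_norm seq_measure (R_op l \<xi> x \<alpha>) \<le> \<xi>_norm * K' * L2_norm seq_measure \<alpha>"
    using R_op_norm[OF x \<alpha>] by linarith
qed

context
  fixes x :: real and \<mu> :: complex and S
  assumes x: "0 \<le> x"
    and S: "inverse_operator seq_measure (\<lambda>\<alpha> j. \<alpha> j + \<mu> * R_op l \<xi> x \<alpha> j) S"
begin

lemma S_bounded: "bounded_operator seq_measure seq_measure S"
  using S by (simp add: inverse_operator_def)

lemma S_L2: "w \<in> L2 seq_measure \<Longrightarrow> S w \<in> L2 seq_measure"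
  by (rule bounded_operator_L2[OF S_bounded])

lemma S_right: "w \<in> L2 seq_measure \<Longrightarrow> S w j + \<mu> * R_op l \<xi> x (S w) j = w j"
  using S by (simp add: inverse_operator_def AE_count_space)

lemma S_left: "w \<in> L2 seq_measure \<Longrightarrow> S (\<lambda>j. w j + \<mu> * R_op l \<xi> x w j) j = w j"
  using S by (simp add: inverse_operator_def AE_count_space)

lemma S_add: "w \<in> L2 seq_measure \<Longrightarrow> w' \<in> L2 seq_measure \<Longrightarrow> S (\<lambda>j. w j + w' j) j = S w j + S w' j"
  using bounded_operator_add[OF S_bounded, of w w'] by (simp add: AE_count_space)

lemma S_scale: "w \<in> L2 seq_measure \<Longrightarrow> S (\<lambda>j. c * w j) j = c * S w j"
  using bounded_operator_scale[OF S_bounded, of w c] by (simp add: AE_count_space)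

text \<open>From S w = w - \<mu> R_x (S w) and the fact that R_x maps l^2 into l^1, the l^2-bounded
  inverse also preserves l^1 and is bounded there.\<close>

lemma S_ell1:
  obtains C where "0 \<le> C" "\<And>w. w \<in> ell1 \<Longrightarrow> S w \<in> ell1"
    "\<And>w. w \<in> ell1 \<Longrightarrow> (\<Sum>j. cmod (S w j)) \<le> C * (\<Sum>j. cmod (w j))"
proof -
  obtain B where B: "0 \<le> B" "\<And>w. w \<in> L2 seq_measure \<Longrightarrow> L2_norm seq_measure (S w) \<le> B * L2_norm seq_measure w"
    using bounded_operator_bound[OF S_bounded] by blast
  define C where "C = 1 + \<xi>_norm * (cmod \<mu> * (K' * exp (- \<delta> * x) * B))"
  have C0: "0 \<le> cmod \<mu> * (K' * exp (- \<delta> * x) * B)"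
    using B K'_nonneg by (intro mult_nonneg_nonneg) auto
  have *: "S w \<in> ell1 \<and> (\<Sum>j. cmod (S w j)) \<le> C * (\<Sum>j. cmod (w j))" if w: "w \<in> ell1" for w
  proof -
    let ?n = "\<Sum>j. cmod (w j)"
    note wL2 = ell1_L2[OF w]
    have summ: "summable (\<lambda>j. cmod (w j))" using w by (simp add: ell1_def)
    have le: "cmod (S w j) \<le> cmod (w j) + cmod (\<xi> j) * (cmod \<mu> * (K' * exp (- \<delta> * x) * B) * ?n)" for j
    proof -
      have "S w j = w j - \<mu> * R_op l \<xi> x (S w) j"
        using S_right[OF wL2(1), of j] by (simp add: algebra_simps)
      then have "cmod (S w j) \<le> cmod (w j) + cmod \<mu> * cmod (R_op l \<xi> x (S w) j)"
        using norm_triangle_ineq4[of "w j" "\<mu> * R_op l \<xi> x (S w) j"] by (simp add: norm_mult)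
      also have "\<dots> \<le> cmod (w j) + cmod \<mu> * (cmod (\<xi> j) * (K' * exp (- \<delta> * x) * (B * ?n)))"
      proof (intro add_left_mono mult_left_mono order_trans[OF R_op_bound[OF x S_L2[OF wL2(1)]]])
        show "L2_norm seq_measure (S w) \<le> B * ?n"
          using B(2)[OF wL2(1)] mult_left_mono[OF wL2(2) B(1)] by linarith
      qed (use K'_nonneg in auto)
      finally show ?thesis by (simp only: mult_ac)
    qed
    have summ': "summable (\<lambda>j. cmod (w j) + cmod (\<xi> j) * (cmod \<mu> * (K' * exp (- \<delta> * x) * B) * ?n))"
      by (intro summable_add summ summable_mult2 \<xi>_summable)
    have mem: "S w \<in> ell1"
      by (rule ell1_bound[OF summ' le])
    have "(\<Sum>j. cmod (S w j)) \<le> (\<Sum>j. cmod (w j) + cmod (\<xi> j) * (cmod \<mu> * (K' * exp (- \<delta> * x) * B) * ?n))"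
      by (rule suminf_le[OF le _ summ']) (use mem in \<open>simp add: ell1_def\<close>)
    also have "\<dots> = ?n + \<xi>_norm * (cmod \<mu> * (K' * exp (- \<delta> * x) * B) * ?n)"
      unfolding \<xi>_norm_def suminf_mult2[OF \<xi>_summable]
      by (rule suminf_add[symmetric]) (intro summ summable_mult2 \<xi>_summable)+
    also have "\<dots> = C * ?n"
      by (simp add: C_def algebra_simps)
    finally show ?thesis using mem by simp
  qed
  show ?thesis
    by (rule that[of C]) (use * C0 \<xi>_norm_nonneg in \<open>auto simp: C_def\<close>)
qed

text \<open>The row functional C e^(-xA) (I + \<mu> R_x)^(-1), considered on l^1. The kernel
  T_\<mu>(x, y) is - \<mu> times its value at e^(-yA) \<xi>.\<close>

definition psi :: "(nat \<Rightarrow> complex) \<Rightarrow> complex" where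
  "psi w = C_op (semigroup_op l x (S w))"

lemma psi_bound:
  obtains C where "0 \<le> C" "\<And>w. w \<in> ell1 \<Longrightarrow> cmod (psi w) \<le> C * (\<Sum>j. cmod (w j))"
proof -
  obtain C where C: "0 \<le> C" "\<And>w. w \<in> ell1 \<Longrightarrow> S w \<in> ell1"
    "\<And>w. w \<in> ell1 \<Longrightarrow> (\<Sum>j. cmod (S w j)) \<le> C * (\<Sum>j. cmod (w j))"
    using S_ell1 by blast
  have "cmod (psi w) \<le> C * (\<Sum>j. cmod (w j))" if w: "w \<in> ell1" for w
  proof -
    have summ: "summable (\<lambda>j. cmod (semigroup_op l x (S w) j))"
      using semigroup_ell1[OF x C(2)[OF w]] by (simp add: ell1_def)
    have "cmod (psi w) \<le> (\<Sum>j. cmod (semigroup_op l x (S w) j))"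
      unfolding psi_def C_op_def by (rule summable_norm[OF summ])
    also have "\<dots> \<le> (\<Sum>j. cmod (S w j))"
    proof (rule suminf_le[OF _ summ])
      show "cmod (semigroup_op l x (S w) j) \<le> cmod (S w j)" for j
        unfolding semigroup_eq norm_mult by (rule mult_left_le_one_le[OF norm_ge_zero norm_ge_zero E_le_1[OF x]])
      show "summable (\<lambda>j. cmod (S w j))" using C(2)[OF w] by (simp add: ell1_def)
    qed
    finally show ?thesis using C(3)[OF w] by linarith
  qed
  with C(1) show ?thesis by (rule that)
qed

lemma psi_add:
  assumes "w \<in> ell1" "w' \<in> ell1"
  shows "psi (\<lambda>j. w j + w' j) = psi w + psi w'"
proof -
  obtain C where C: "\<And>w. w \<in> ell1 \<Longrightarrow> S w \<in> ell1" using S_ell1 by blast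
  have "psi (\<lambda>j. w j + w' j) = (\<Sum>j. semigroup_op l x (S w) j + semigroup_op l x (S w') j)"
    unfolding psi_def C_op_def semigroup_eq S_add[OF ell1_L2(1)[OF assms(1)] ell1_L2(1)[OF assms(2)]] distrib_left ..
  also have "\<dots> = psi w + psi w'"
    unfolding psi_def C_op_def
    by (rule suminf_add[symmetric]) (intro ell1_summable semigroup_ell1 x C assms)+
  finally show ?thesis .
qed

lemma psi_scale:
  assumes "w \<in> ell1"
  shows "psi (\<lambda>j. c * w j) = c * psi w"
proof -
  obtain C where C: "\<And>w. w \<in> ell1 \<Longrightarrow> S w \<in> ell1" using S_ell1 by blast
  have "psi (\<lambda>j. c * w j) = (\<Sum>j. c * semigroup_op l x (S w) j)"
    unfolding psi_def C_op_def semigroup_eq S_scale[OF ell1_L2(1)[OF assms]] by (simp only: mult.left_commute)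
  also have "\<dots> = c * psi w"
    unfolding psi_def C_op_def by (rule suminf_mult) (intro ell1_summable semigroup_ell1 x C assms)
  finally show ?thesis .
qed

abbreviation unit_value :: "nat \<Rightarrow> complex" where
  "unit_value m \<equiv> psi (\<lambda>j. if j = m then 1 else 0)"

lemma psi_sums:
  assumes "w \<in> ell1"
  shows "(\<lambda>m. w m * unit_value m) sums psi w"
proof -
  obtain C where "\<And>w. w \<in> ell1 \<Longrightarrow> cmod (psi w) \<le> C * (\<Sum>j. cmod (w j))"
    using psi_bound by blast
  from ell1_functional_sums[OF psi_add psi_scale this assms] show ?thesis by blast
qed

text \<open>The left inverse property read through the functional: \<open>psi\<close> composed with
  I + \<mu> R_x is C e^(-xA). At w = e^(-yA) \<xi> this is the integral equation, once the R_x term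
  is recognised as an integral.\<close>

lemma psi_left:
  assumes w: "w \<in> ell1"
  shows "psi w + \<mu> * psi (R_op l \<xi> x w) = C_op (semigroup_op l x w)"
proof -
  note wL2 = ell1_L2(1)[OF w]
  note Rw = R_op_ell1[OF x wL2]
  have "psi w + \<mu> * psi (R_op l \<xi> x w) = psi (\<lambda>j. w j + \<mu> * R_op l \<xi> x w j)"
    by (simp only: psi_add[OF w ell1_scale[OF Rw]] psi_scale[OF Rw])
  also have "\<dots> = C_op (semigroup_op l x w)"
    unfolding psi_def C_op_def semigroup_eq S_left[OF wL2] ..
  finally show ?thesis .
qed

text \<open>On e^(-yA) \<xi> the integral formula for R_x has integrand \<phi>(z + y) e^(-zA) \<xi>.
  Applying \<open>psi\<close> under the integral turns it into a multiple of T_\<mu>(x, z) \<phi>(z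
  + y), and \<open>psi_left\<close> finishes. The exchange is a dominated one of sum and integral
  after expanding \<open>psi\<close> at unit vectors.\<close>

lemma kernel_equation:
  assumes y: "0 \<le> y"
    and \<tau>: "\<And>z. \<tau> z = - \<mu> * psi (semigroup_op l z (B_op \<xi> 1))"
  shows "set_integrable lebesgue {x<..} (\<lambda>z. \<tau> z * symbol_phi l \<xi> (z + y))"
    and "\<tau> y + \<mu> * symbol_phi l \<xi> (x + y) + \<mu> * (LINT z:{x<..}|lebesgue. \<tau> z * symbol_phi l \<xi> (z + y)) = 0"
proof -
  let ?b = "semigroup_op l y (B_op \<xi> 1)"
  have b: "?b \<in> ell1" by (rule input_ell1[OF y])
  have conv: "semigroup_op l s ?b \<in> ell1" if "x < s" for s
    using that x by (intro semigroup_ell1 b) simp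
  obtain C where C: "0 \<le> C" "\<And>w. w \<in> ell1 \<Longrightarrow> cmod (psi w) \<le> C * (\<Sum>j. cmod (w j))"
    using psi_bound by blast
  have unit: "cmod (unit_value m) \<le> C" for m
  proof -
    have "(\<Sum>j. cmod (if j = m then 1 else 0)) = (\<Sum>j\<in>{m}. cmod (if j = m then 1 else 0))"
      by (rule suminf_finite) auto
    then show ?thesis using C(2)[OF ell1_unit, of m] by simp
  qed
  define g where "g j z = \<xi> j * (symbol_phi l \<xi> (z + y) * E z j)" for j z
  have g_eq: "semigroup_op l z (B_op \<xi> (C_op (semigroup_op l z ?b))) j = g j z" for z j
    unfolding C_semigroup_input g_def by (subst semigroup_eq) (simp only: B_op_def mult_ac)
  have g_int: "integrable half_line (\<lambda>z. indicator {x<..} z *\<^sub>R g j z)" for j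
    using R_op_integrable[OF x ell1_L2(1)[OF b] conv, of j]
    unfolding g_eq half_line_set_integrable(1)[OF x] .
  have g_val: "(\<integral>z. indicator {x<..} z *\<^sub>R g j z \<partial>half_line) = R_op l \<xi> x ?b j" for j
    using R_op_integral[OF x ell1_L2(1)[OF b] conv, of j]
    unfolding g_eq half_line_set_integrable(2)[OF x] by simp
  define f where "f j z = - \<mu> * unit_value j * (indicator {x<..} z *\<^sub>R g j z)" for j z
  have f_int: "integrable half_line (f j)" for j
    unfolding f_def[abs_def] by (intro integrable_mult_right g_int)
  \<comment> \<open>A majorant that is a product of |\<open>\<xi> j\<close>| and an integrable
    function of z: it serves both for pointwise summability and for summability of the
    integrals.\<close>
  have f_norm: "norm (f j z) \<le> cmod (\<xi> j) * (cmod \<mu> * C * (\<xi>_norm * exp (- \<delta> * z)))" if z: "0 < z" for j z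
  proof -
    have "cmod (g j z) \<le> cmod (\<xi> j) * ((\<xi>_norm * exp (- \<delta> * (z + y))) * 1)"
      unfolding g_def norm_mult using z y
      by (intro mult_mono symbol_bound E_le_1 mult_nonneg_nonneg \<xi>_norm_nonneg) auto
    also have "\<dots> \<le> cmod (\<xi> j) * ((\<xi>_norm * exp (- \<delta> * z)) * 1)"
      using \<delta> y by (intro mult_left_mono mult_right_mono \<xi>_norm_nonneg) (auto simp: distrib_left)
    finally have "cmod (indicator {x<..} z *\<^sub>R g j z) \<le> cmod (\<xi> j) * (\<xi>_norm * exp (- \<delta> * z))"
      using \<xi>_norm_nonneg by (simp add: indicator_def)
    then have "norm (f j z) \<le> (cmod \<mu> * C) * (cmod (\<xi> j) * (\<xi>_norm * exp (- \<delta> * z)))"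
      unfolding f_def norm_mult norm_minus_cancel by (intro mult_mono unit mult_nonneg_nonneg C) auto
    then show ?thesis by (simp only: mult_ac)
  qed
  have exp_int: "integrable half_line (\<lambda>z. exp (- \<delta> * z))"
    using set_integrable_real_exp[OF \<delta>, of 0] half_line_set_integrable(1)[of 0 "\<lambda>z. exp (- \<delta> * z)"]
      Bochner_Integration.integrable_cong[OF refl, of half_line "\<lambda>z. indicator {0<..} z *\<^sub>R exp (- \<delta> * z)" "\<lambda>z. exp (- \<delta> * z)"]
    by simp
  have AE_summ: "AE z in half_line. summable (\<lambda>j. norm (f j z))"
  proof (rule AE_I2)
    fix z assume "z \<in> space half_line"
    then have z: "0 < z" by simp
    show "summable (\<lambda>j. norm (f j z))"
      by (rule summable_comparison_test'[OF summable_mult2[OF \<xi>_summable], of 0])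
        (use f_norm[OF z] in simp)
  qed
  have int_summ: "summable (\<lambda>j. \<integral>z. norm (f j z) \<partial>half_line)"
  proof (rule summable_comparison_test'[OF summable_mult2[OF \<xi>_summable], of 0])
    fix j
    have "(\<integral>z. norm (f j z) \<partial>half_line) \<le> (\<integral>z. cmod (\<xi> j) * (cmod \<mu> * C * (\<xi>_norm * exp (- \<delta> * z))) \<partial>half_line)"
      by (intro integral_mono integrable_norm f_int integrable_mult_right exp_int f_norm) simp
    also have "\<dots> = cmod (\<xi> j) * (cmod \<mu> * C * (\<xi>_norm * (\<integral>z. exp (- \<delta> * z) \<partial>half_line)))"
      by (simp only: integral_mult_right_zero)
    finally show "norm (\<integral>z. norm (f j z) \<partial>half_line)
        \<le> cmod (\<xi> j) * (cmod \<mu> * C * (\<xi>_norm * (\<integral>z. exp (- \<delta> * z) \<partial>half_line)))"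
      by (simp add: integral_nonneg_AE)
  qed
  have sum_f: "(\<Sum>j. f j z) = indicator {x<..} z *\<^sub>R (\<tau> z * symbol_phi l \<xi> (z + y))" if z: "0 < z" for z
  proof -
    let ?c = "- \<mu> * symbol_phi l \<xi> (z + y) * indicator {x<..} z"
    have "f j z = ?c * (semigroup_op l z (B_op \<xi> 1) j * unit_value j)" for j
      unfolding f_def g_def semigroup_eq B_op_def by (simp add: indicator_def)
    moreover have "(\<lambda>j. ?c * (semigroup_op l z (B_op \<xi> 1) j * unit_value j)) sums (?c * psi (semigroup_op l z (B_op \<xi> 1)))"
      using z by (intro sums_mult psi_sums input_ell1) simp
    ultimately have "(\<Sum>j. f j z) = ?c * psi (semigroup_op l z (B_op \<xi> 1))"
      by (simp only: sums_iff)
    then show ?thesis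
      unfolding \<tau> by (simp add: indicator_def)
  qed
  have cong: "integrable half_line (\<lambda>z. \<Sum>j. f j z) \<longleftrightarrow>
      integrable half_line (\<lambda>z. indicator {x<..} z *\<^sub>R (\<tau> z * symbol_phi l \<xi> (z + y)))"
    by (rule Bochner_Integration.integrable_cong[OF refl]) (simp add: sum_f)
  show "set_integrable lebesgue {x<..} (\<lambda>z. \<tau> z * symbol_phi l \<xi> (z + y))"
    unfolding half_line_set_integrable(1)[OF x] cong[symmetric]
    by (rule integrable_suminf[OF f_int AE_summ int_summ])
  have "(LINT z:{x<..}|lebesgue. \<tau> z * symbol_phi l \<xi> (z + y)) = (\<integral>z. (\<Sum>j. f j z) \<partial>half_line)"
    unfolding half_line_set_integrable(2)[OF x]
    by (rule Bochner_Integration.integral_cong[OF refl]) (simp add: sum_f)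
  also have "\<dots> = (\<Sum>j. integral\<^sup>L half_line (f j))"
    by (rule integral_suminf[OF f_int AE_summ int_summ])
  also have "\<dots> = (\<Sum>j. - \<mu> * (R_op l \<xi> x ?b j * unit_value j))"
    unfolding f_def[abs_def] integral_mult_right_zero g_val by (simp only: mult_ac)
  also have "\<dots> = - \<mu> * psi (R_op l \<xi> x ?b)"
    using sums_mult[OF psi_sums[OF R_op_ell1[OF x ell1_L2(1)[OF b]]], of "- \<mu>"] by (simp only: sums_iff)
  finally have int: "(LINT z:{x<..}|lebesgue. \<tau> z * symbol_phi l \<xi> (z + y)) = - \<mu> * psi (R_op l \<xi> x ?b)" .
  have "psi ?b + \<mu> * psi (R_op l \<xi> x ?b) = symbol_phi l \<xi> (x + y)"
    using psi_left[OF b] by (simp only: C_semigroup_input)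
  then have phi: "symbol_phi l \<xi> (x + y) = psi ?b + \<mu> * psi (R_op l \<xi> x ?b)" ..
  show "\<tau> y + \<mu> * symbol_phi l \<xi> (x + y) + \<mu> * (LINT z:{x<..}|lebesgue. \<tau> z * symbol_phi l \<xi> (z + y)) = 0"
    unfolding int \<tau>[of y] phi by (simp add: algebra_simps)
qed

end

lemma resolvent_ell1:
  assumes "0 \<le> x" "0 \<le> y" and "invertible_operator seq_measure (\<lambda>\<alpha> j. \<alpha> j + \<mu> * R_op l \<xi> x \<alpha> j)"
  shows "resolvent_vector l \<xi> \<mu> x y \<in> ell1"
proof -
  have S: "inverse_operator seq_measure (\<lambda>\<alpha> j. \<alpha> j + \<mu> * R_op l \<xi> x \<alpha> j)
      (operator_inv seq_measure (\<lambda>\<alpha> j. \<alpha> j + \<mu> * R_op l \<xi> x \<alpha> j))"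
    by (rule inverse_operator_inv[OF assms(3)])
  obtain C where C: "\<And>w. w \<in> ell1 \<Longrightarrow> operator_inv seq_measure (\<lambda>\<alpha> j. \<alpha> j + \<mu> * R_op l \<xi> x \<alpha> j) w \<in> ell1"
    using S_ell1[OF assms(1) S] by blast
  show ?thesis
    unfolding resolvent_vector_def by (intro semigroup_ell1 assms(1) C input_ell1 assms(2))
qed

lemma integral_equation:
  assumes x: "0 \<le> x" and y: "0 \<le> y"
    and inv: "invertible_operator seq_measure (\<lambda>\<alpha> j. \<alpha> j + \<mu> * R_op l \<xi> x \<alpha> j)"
  shows "set_integrable lebesgue {x<..} (\<lambda>z. T_kernel l \<xi> \<mu> x z * symbol_phi l \<xi> (z + y))"
    and "T_kernel l \<xi> \<mu> x y + \<mu> * symbol_phi l \<xi> (x + y)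
      + \<mu> * (LINT z:{x<..}|lebesgue. T_kernel l \<xi> \<mu> x z * symbol_phi l \<xi> (z + y)) = 0"
proof -
  have S: "inverse_operator seq_measure (\<lambda>\<alpha> j. \<alpha> j + \<mu> * R_op l \<xi> x \<alpha> j)
      (operator_inv seq_measure (\<lambda>\<alpha> j. \<alpha> j + \<mu> * R_op l \<xi> x \<alpha> j))"
    by (rule inverse_operator_inv[OF inv])
  have T: "T_kernel l \<xi> \<mu> x z = - \<mu> * psi x (operator_inv seq_measure (\<lambda>\<alpha> j. \<alpha> j + \<mu> * R_op l \<xi> x \<alpha> j))
      (semigroup_op l z (B_op \<xi> 1))" for z
    unfolding T_kernel_def resolvent_vector_def psi_def[OF x S] ..
  show "set_integrable lebesgue {x<..} (\<lambda>z. T_kernel l \<xi> \<mu> x z * symbol_phi l \<xi> (z + y))"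
    by (rule kernel_equation(1)[OF x S y T])
  show "T_kernel l \<xi> \<mu> x y + \<mu> * symbol_phi l \<xi> (x + y)
      + \<mu> * (LINT z:{x<..}|lebesgue. T_kernel l \<xi> \<mu> x z * symbol_phi l \<xi> (z + y)) = 0"
    by (rule kernel_equation(2)[OF x S y T])
qed

end

section \<open>Finite determinants\<close>

text \<open>The determinant of the leading n-by-n corner of an infinite matrix, so that one function
  serves for all \<open>n\<close>.\<close>

definition fdet :: "nat \<Rightarrow> (nat \<Rightarrow> nat \<Rightarrow> complex) \<Rightarrow> complex" where
  "fdet n f = det (mat n n (\<lambda>(i, j). f i j))"

definition fcof :: "nat \<Rightarrow> (nat \<Rightarrow> nat \<Rightarrow> complex) \<Rightarrow> nat \<Rightarrow> nat \<Rightarrow> complex" where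
  "fcof n f i j = cofactor (mat n n (\<lambda>(i, j). f i j)) i j"

lemma fdet_permutations:
  "fdet n f = (\<Sum>p | p permutes {..<n}. of_int (sign p) * (\<Prod>i<n. f i (p i)))"
proof -
  have "fdet n f = (\<Sum>p | p permutes {0..<n}. of_int (sign p) * (\<Prod>i=0..<n. mat n n (\<lambda>(i, j). f i j) $$ (i, p i)))"
    unfolding fdet_def by (rule det_def') simp
  also have "\<dots> = (\<Sum>p | p permutes {..<n}. of_int (sign p) * (\<Prod>i<n. f i (p i)))"
    unfolding atLeast0LessThan
  proof (intro sum.cong refl arg_cong2[of _ _ _ _ "(*)"] prod.cong)
    fix p i assume "p \<in> {p. p permutes {..<n}}" "i \<in> {..<n}"
    then have "p i < n" "i < n" using permutes_in_image[of p "{..<n}" i] by auto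
    then show "mat n n (\<lambda>(i, j). f i j) $$ (i, p i) = f i (p i)" by simp
  qed
  finally show ?thesis .
qed

lemma fdet_cong: "(\<And>i j. i < n \<Longrightarrow> j < n \<Longrightarrow> f i j = g i j) \<Longrightarrow> fdet n f = fdet n g"
  unfolding fdet_def by (intro arg_cong[of _ _ det]) auto

text \<open>Expressing cofactors again through \<open>fdet\<close> transfers the permutation formula
  to them, in particular continuity in the entries.\<close>

lemma fcof_eq_fdet:
  assumes "i < n" "j < n"
  shows "fcof n f i j = (- 1) ^ (i + j) *
    fdet (n - 1) (\<lambda>a b. f (if a < i then a else Suc a) (if b < j then b else Suc b))"
proof -
  have "mat_delete (mat n n (\<lambda>(i, j). f i j)) i j
      = mat (n - 1) (n - 1) (\<lambda>(a, b). f (if a < i then a else Suc a) (if b < j then b else Suc b))"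
    using assms by (auto simp: mat_delete_def)
  then show ?thesis
    by (simp add: fcof_def cofactor_def fdet_def)
qed

lemma fcof_row_independent:
  assumes "i < n" "j < n" "\<And>a b. a \<noteq> i \<Longrightarrow> f a b = g a b"
  shows "fcof n f i j = fcof n g i j"
  unfolding fcof_eq_fdet[OF assms(1,2)]
  by (intro arg_cong2[of _ _ _ _ "(*)"] refl fdet_cong assms(3)) auto

lemma fdet_expand_row:
  assumes "i < n"
  shows "fdet n f = (\<Sum>j<n. f i j * fcof n f i j)"
  unfolding fdet_def fcof_def
  by (subst laplace_expansion_row[of _ n i]) (use assms in auto)

text \<open>The adjugate identity A adj(A) = det(A) I, entry by entry.\<close>

lemma fcof_fdet:
  assumes "j < n" "k < n"
  shows "(\<Sum>i<n. f j i * fcof n f k i) = (if j = k then fdet n f else 0)"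
proof -
  let ?A = "mat n n (\<lambda>(i, j). f i j)"
  have A: "?A \<in> carrier_mat n n" by simp
  have "(?A * adj_mat ?A) $$ (j, k) = (\<Sum>i<n. f j i * fcof n f k i)"
    using assms by (simp add: times_mat_def scalar_prod_def adj_mat_def fcof_def atLeast0LessThan)
  then show "(\<Sum>i<n. f j i * fcof n f k i) = (if j = k then fdet n f else 0)"
    using adj_mat(2)[OF A] assms by (auto simp: fdet_def split: if_splits)
qed

lemma fdet_zero_kernel:
  assumes "fdet n f = 0"
  obtains v where "\<And>i. i < n \<Longrightarrow> (\<Sum>j<n. f i j * v j) = 0" "\<exists>j<n. v j \<noteq> 0" "\<And>j. j \<ge> n \<Longrightarrow> v j = 0"
proof -
  let ?A = "mat n n (\<lambda>(i, j). f i j)"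
  have A: "?A \<in> carrier_mat n n" by simp
  obtain v where v: "v \<in> carrier_vec n" "v \<noteq> 0\<^sub>v n" "?A *\<^sub>v v = 0\<^sub>v n"
    using assms det_0_iff_vec_prod_zero[OF A] by (auto simp: fdet_def)
  show ?thesis
  proof (rule that[of "\<lambda>j. if j < n then v $ j else 0"])
    fix i assume i: "i < n"
    have "(?A *\<^sub>v v) $ i = (\<Sum>j<n. f i j * (v $ j))"
      using i v(1) by (simp add: scalar_prod_def atLeast0LessThan)
    then show "(\<Sum>j<n. f i j * (if j < n then v $ j else 0)) = 0"
      using v(3) i by simp
  next
    show "\<exists>j<n. (if j < n then v $ j else 0) \<noteq> 0"
      using v(1,2) by (metis (mono_tags, lifting) carrier_vecD eq_vecI index_zero_vec(1) index_zero_vec(2))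
  qed simp
qed

lemma tendsto_fdet:
  assumes "\<And>i j. i < n \<Longrightarrow> j < n \<Longrightarrow> ((\<lambda>s. f s i j) \<longlongrightarrow> g i j) F"
  shows "((\<lambda>s. fdet n (f s)) \<longlongrightarrow> fdet n g) F"
  unfolding fdet_permutations
proof (intro tendsto_sum tendsto_mult tendsto_const tendsto_prod)
  fix p i assume "p \<in> {p. p permutes {..<n}}" "i \<in> {..<n}"
  then have "p i < n" "i < n" using permutes_in_image[of p "{..<n}" i] by auto
  then show "((\<lambda>s. f s i (p i)) \<longlongrightarrow> g i (p i)) F" by (intro assms)
qed

lemma fdet_identity: "fdet n (\<lambda>i j. if i = j then 1 else 0) = 1"
proof -
  have "mat n n (\<lambda>(i, j). if i = j then 1 else 0) = (1\<^sub>m n :: complex mat)"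
    by (auto simp: one_mat_def)
  then show ?thesis by (simp add: fdet_def)
qed

text \<open>Jacobi's formula in cofactor form, which stays meaningful where the determinant
  vanishes.\<close>

lemma fdet_has_vector_derivative:
  fixes f :: "real \<Rightarrow> nat \<Rightarrow> nat \<Rightarrow> complex"
  assumes f: "\<And>i j. i < n \<Longrightarrow> j < n \<Longrightarrow> ((\<lambda>s. f s i j) has_vector_derivative f' i j) (at s)"
  shows "((\<lambda>s. fdet n (f s)) has_vector_derivative (\<Sum>i<n. \<Sum>j<n. f' i j * fcof n (f s) i j)) (at s)"
proof -
  \<comment> \<open>Row i replaced by its derivative: the product rule gives the sum of these
    determinants, and each is expanded along the replaced row, whose cofactors do not see the
    replacement.\<close>
  define g where "g i = (\<lambda>a b. if a = i then f' i b else f s a b)" for i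
  have prod: "((\<lambda>s. \<Prod>i<n. f s i (p i)) has_vector_derivative (\<Sum>i<n. \<Prod>k<n. g i k (p k))) (at s)"
    if p: "p permutes {..<n}" for p
  proof -
    have "((\<lambda>s. \<Prod>i\<in>{..<n}. f s i (p i)) has_derivative
        (\<lambda>h. \<Sum>i\<in>{..<n}. (h *\<^sub>R f' i (p i)) * (\<Prod>k\<in>{..<n} - {i}. f s k (p k)))) (at s)"
    proof (rule has_derivative_prod)
      fix i assume "i \<in> {..<n}"
      then show "((\<lambda>s. f s i (p i)) has_derivative (\<lambda>h. h *\<^sub>R f' i (p i))) (at s)"
        using f[of i "p i"] permutes_in_image[OF p, of i] by (simp add: has_vector_derivative_def)
    qed
    moreover have "(\<Sum>i\<in>{..<n}. (h *\<^sub>R f' i (p i)) * (\<Prod>k\<in>{..<n} - {i}. f s k (p k)))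
        = h *\<^sub>R (\<Sum>i<n. \<Prod>k<n. g i k (p k))" for h
      unfolding scaleR_sum_right
    proof (rule sum.cong[OF refl])
      fix i assume i: "i \<in> {..<n}"
      have "(\<Prod>k<n. g i k (p k)) = g i i (p i) * (\<Prod>k\<in>{..<n} - {i}. g i k (p k))"
        using i by (intro prod.remove) auto
      also have "(\<Prod>k\<in>{..<n} - {i}. g i k (p k)) = (\<Prod>k\<in>{..<n} - {i}. f s k (p k))"
        by (rule prod.cong) (auto simp: g_def)
      finally show "(h *\<^sub>R f' i (p i)) * (\<Prod>k\<in>{..<n} - {i}. f s k (p k)) = h *\<^sub>R (\<Prod>k<n. g i k (p k))"
        by (simp add: g_def)
    qed
    ultimately show ?thesis
      by (simp add: has_vector_derivative_def)
  qed
  have "((\<lambda>s. fdet n (f s)) has_vector_derivative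
      (\<Sum>p | p permutes {..<n}. of_int (sign p) * (\<Sum>i<n. \<Prod>k<n. g i k (p k)))) (at s)"
    unfolding fdet_permutations
    by (intro has_vector_derivative_sum has_vector_derivative_mult_right prod) simp
  also have "(\<Sum>p | p permutes {..<n}. of_int (sign p) * (\<Sum>i<n. \<Prod>k<n. g i k (p k))) = (\<Sum>i<n. fdet n (g i))"
    unfolding fdet_permutations sum_distrib_left by (rule sum.swap)
  also have "\<dots> = (\<Sum>i<n. \<Sum>j<n. f' i j * fcof n (f s) i j)"
  proof (rule sum.cong[OF refl])
    fix i assume "i \<in> {..<n}"
    then have i: "i < n" by simp
    show "fdet n (g i) = (\<Sum>j<n. f' i j * fcof n (f s) i j)"
      unfolding fdet_expand_row[OF i]
    proof (rule sum.cong[OF refl])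
      fix j assume "j \<in> {..<n}"
      then have "fcof n (g i) i j = fcof n (f s) i j"
        by (intro fcof_row_independent i) (auto simp: g_def)
      then show "g i i j * fcof n (g i) i j = f' i j * fcof n (f s) i j"
        by (simp add: g_def)
    qed
  qed
  finally show ?thesis .
qed

text \<open>Multiply out each product by choosing Y on the rows in J and the identity on the others.
  The identity factors vanish unless the permutation fixes every index outside J, which leaves the
  principal minor of J.\<close>

lemma fdet_principal_minors:
  "fdet n (\<lambda>i j. (if i = j then 1 else 0) + Y i j)
    = (\<Sum>J\<in>Pow {..<n}. \<Sum>p | p permutes J. of_int (sign p) * (\<Prod>j\<in>J. Y j (p j)))"
proof -
  let ?\<delta> = "\<lambda>i j :: nat. if i = j then 1 else 0 :: complex"
  have "fdet n (\<lambda>i j. ?\<delta> i j + Y i j) = (\<Sum>p | p permutes {..<n}. of_int (sign p) *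
      (\<Sum>J\<in>Pow {..<n}. (\<Prod>i\<in>J. Y i (p i)) * (\<Prod>i\<in>{..<n} - J. ?\<delta> i (p i))))"
    unfolding fdet_permutations by (subst prod_add[symmetric]) (simp_all add: add.commute)
  also have "\<dots> = (\<Sum>J\<in>Pow {..<n}. \<Sum>p | p permutes {..<n}. of_int (sign p) *
      ((\<Prod>i\<in>J. Y i (p i)) * (\<Prod>i\<in>{..<n} - J. ?\<delta> i (p i))))"
    unfolding sum_distrib_left by (rule sum.swap)
  also have "\<dots> = (\<Sum>J\<in>Pow {..<n}. \<Sum>p | p permutes J. of_int (sign p) * (\<Prod>j\<in>J. Y j (p j)))"
  proof (rule sum.cong[OF refl])
    fix J assume "J \<in> Pow {..<n}"
    then have J: "J \<subseteq> {..<n}" by simp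
    show "(\<Sum>p | p permutes {..<n}. of_int (sign p) * ((\<Prod>i\<in>J. Y i (p i)) * (\<Prod>i\<in>{..<n} - J. ?\<delta> i (p i))))
        = (\<Sum>p | p permutes J. of_int (sign p) * (\<Prod>j\<in>J. Y j (p j)))"
    proof (rule sum.mono_neutral_cong_right)
      show "finite {p. p permutes {..<n}}" by (rule finite_permutations) simp
      show "{p. p permutes J} \<subseteq> {p. p permutes {..<n}}"
        using permutes_subset[OF _ J] by blast
      show "\<forall>p\<in>{p. p permutes {..<n}} - {p. p permutes J}.
          of_int (sign p) * ((\<Prod>i\<in>J. Y i (p i)) * (\<Prod>i\<in>{..<n} - J. ?\<delta> i (p i))) = 0"
      proof
        fix p assume p: "p \<in> {p. p permutes {..<n}} - {p. p permutes J}"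
        then obtain i where "i \<in> {..<n} - J" "p i \<noteq> i"
          using permutes_superset[of p "{..<n}" J] by blast
        then have "(\<Prod>i\<in>{..<n} - J. ?\<delta> i (p i)) = 0"
          by (intro prod_zero bexI[of _ i]) auto
        then show "of_int (sign p) * ((\<Prod>i\<in>J. Y i (p i)) * (\<Prod>i\<in>{..<n} - J. ?\<delta> i (p i))) = 0" by simp
      qed
      fix p assume "p \<in> {p. p permutes J}"
      then have "(\<Prod>i\<in>{..<n} - J. ?\<delta> i (p i)) = 1"
        by (intro prod.neutral) (auto simp: permutes_not_in)
      then show "of_int (sign p) * ((\<Prod>i\<in>J. Y i (p i)) * (\<Prod>i\<in>{..<n} - J. ?\<delta> i (p i)))
          = of_int (sign p) * (\<Prod>j\<in>J. Y j (p j))" by simp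
    qed
  qed
  finally show ?thesis .
qed

text \<open>F times exp of minus the integral of \<tau> from t has derivative 0, hence is constant,
  and its value is found by letting the upper limit tend to infinity. No complex logarithm has to be
  chosen.\<close>

lemma exp_integral_log_derivative:
  fixes F \<tau> :: "real \<Rightarrow> complex"
  assumes deriv: "\<And>s. t \<le> s \<Longrightarrow> (F has_vector_derivative F s * \<tau> s) (at s)"
    and cont: "continuous_on {t..} \<tau>"
    and int: "set_integrable lebesgue {t<..} \<tau>"
    and lim: "(F \<longlongrightarrow> 1) at_top"
  shows "F t = exp (- (LINT s:{t<..}|lebesgue. \<tau> s))"
proof -
  define I where "I s = integral {t..s} \<tau>" for s
  have const: "F T * exp (- I T) = F t" if T: "t \<le> T" for T
  proof -
    have deriv0: "((\<lambda>s. F s * exp (- I s)) has_vector_derivative 0) (at s within {t..T})" if s: "s \<in> {t..T}" for s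
    proof -
      have "(I has_vector_derivative \<tau> s) (at s within {t..T})"
        unfolding I_def
        by (rule integral_has_vector_derivative[OF continuous_on_subset[OF cont] s]) auto
      then have "((\<lambda>s. - I s) has_vector_derivative - \<tau> s) (at s within {t..T})"
        by (rule has_vector_derivative_minus)
      from field_vector_diff_chain_within[OF this, of exp "exp (- I s)"]
      have "((\<lambda>s. exp (- I s)) has_vector_derivative - \<tau> s * exp (- I s)) (at s within {t..T})"
        by (simp add: o_def has_field_derivative_at_within DERIV_exp)
      from has_vector_derivative_mult[OF has_vector_derivative_at_within[OF deriv] this]
      have "((\<lambda>s. F s * exp (- I s)) has_vector_derivative
          F s * (- \<tau> s * exp (- I s)) + F s * \<tau> s * exp (- I s)) (at s within {t..T})"
        using s by simp
      then show ?thesis by (simp add: mult.assoc)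
    qed
    have "F T * exp (- I T) = F t * exp (- I t)"
      by (rule has_derivative_zero_unique[OF convex_real_interval(5), of t T "\<lambda>s. F s * exp (- I s)"])
        (use deriv0 T in \<open>auto simp: has_vector_derivative_def\<close>)
    then show ?thesis by (simp add: I_def)
  qed
  have sub: "set_integrable lebesgue {t<..t + real k} \<tau>" for k
    by (rule set_integrable_subset[OF int]) auto
  have I_eq: "I (t + real k) = (\<integral>s. indicator {t<..t + real k} s *\<^sub>R \<tau> s \<partial>lebesgue)" for k
  proof -
    have "I (t + real k) = integral {t<..t + real k} \<tau>"
      unfolding I_def by (rule integral_spike_set; rule negligible_subset[of "{t}"]) auto
    also have "\<dots> = (LINT s:{t<..t + real k}|lebesgue. \<tau> s)"
      by (rule set_lebesgue_integral_eq_integral(2)[OF sub, symmetric])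
    finally show ?thesis by (simp add: set_lebesgue_integral_def)
  qed
  have "(\<lambda>k. \<integral>s. indicator {t<..t + real k} s *\<^sub>R \<tau> s \<partial>lebesgue)
      \<longlonglongrightarrow> (\<integral>s. indicator {t<..} s *\<^sub>R \<tau> s \<partial>lebesgue)"
  proof (rule integral_dominated_convergence[where w = "\<lambda>s. norm (indicator {t<..} s *\<^sub>R \<tau> s)"])
    show "(\<lambda>s. indicator {t<..} s *\<^sub>R \<tau> s) \<in> borel_measurable lebesgue"
      using int unfolding set_integrable_def by (rule borel_measurable_integrable)
    show "(\<lambda>s. indicator {t<..t + real k} s *\<^sub>R \<tau> s) \<in> borel_measurable lebesgue" for k
      using sub unfolding set_integrable_def by (rule borel_measurable_integrable)
    show "integrable lebesgue (\<lambda>s. norm (indicator {t<..} s *\<^sub>R \<tau> s))"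
      using int unfolding set_integrable_def by (rule integrable_norm)
    show "AE s in lebesgue. (\<lambda>k. indicator {t<..t + real k} s *\<^sub>R \<tau> s) \<longlonglongrightarrow> indicator {t<..} s *\<^sub>R \<tau> s"
    proof (rule AE_I2)
      fix s
      obtain N where N: "s - t \<le> real N" using real_arch_simple by blast
      have "\<forall>\<^sub>F k in sequentially. indicator {t<..t + real k} s *\<^sub>R \<tau> s = indicator {t<..} s *\<^sub>R \<tau> s"
        using eventually_ge_at_top[of N]
      proof eventually_elim
        fix k assume "N \<le> k"
        then have "s \<le> t + real k" using N by simp
        then show "indicator {t<..t + real k} s *\<^sub>R \<tau> s = indicator {t<..} s *\<^sub>R \<tau> s"
          by (simp add: indicator_def)
      qed
      then show "(\<lambda>k. indicator {t<..t + real k} s *\<^sub>R \<tau> s) \<longlonglongrightarrow> indicator {t<..} s *\<^sub>R \<tau> s"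
        by (rule tendsto_eventually)
    qed
  qed (auto simp: indicator_def)
  then have I_lim: "(\<lambda>k. I (t + real k)) \<longlonglongrightarrow> (LINT s:{t<..}|lebesgue. \<tau> s)"
    by (simp only: I_eq set_lebesgue_integral_def)
  have "filterlim (\<lambda>k. t + real k) at_top sequentially"
    by (intro filterlim_tendsto_add_at_top[OF tendsto_const] filterlim_real_sequentially)
  then have "(\<lambda>k. F (t + real k)) \<longlonglongrightarrow> 1"
    by (rule filterlim_compose[OF lim])
  then have "(\<lambda>k. F (t + real k) * exp (- I (t + real k))) \<longlonglongrightarrow> 1 * exp (- (LINT s:{t<..}|lebesgue. \<tau> s))"
    by (intro tendsto_mult tendsto_exp tendsto_minus I_lim)
  moreover have "F (t + real k) * exp (- I (t + real k)) = F t" for k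
    by (rule const) simp
  ultimately show ?thesis
    by (simp add: LIMSEQ_const_iff)
qed

context linear_system
begin

section \<open>The determinant formula\<close>

subsection \<open>Lower bounds for \<open>I - R\<^sub>u\<close>\<close>

definition defect :: "real \<Rightarrow> (nat \<Rightarrow> complex) \<Rightarrow> nat \<Rightarrow> complex" where
  "defect u \<alpha> j = \<alpha> j - R_op l \<xi> u \<alpha> j"

definition bounded_below :: "real \<Rightarrow> real \<Rightarrow> bool" where
  "bounded_below \<kappa> u \<longleftrightarrow> 0 < \<kappa> \<and>
    (\<forall>\<alpha>\<in>L2 seq_measure. L2_norm seq_measure \<alpha> \<le> \<kappa> * L2_norm seq_measure (defect u \<alpha>))"

lemma R_op_L2: "0 \<le> u \<Longrightarrow> \<alpha> \<in> L2 seq_measure \<Longrightarrow> R_op l \<xi> u \<alpha> \<in> L2 seq_measure"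
  by (rule bounded_operator_L2[OF R_op_bounded])

lemma defect_L2: "0 \<le> u \<Longrightarrow> \<alpha> \<in> L2 seq_measure \<Longrightarrow> defect u \<alpha> \<in> L2 seq_measure"
  unfolding defect_def[abs_def] by (intro L2_diff R_op_L2)

lemma bounded_belowD:
  "bounded_below \<kappa> u \<Longrightarrow> \<alpha> \<in> L2 seq_measure \<Longrightarrow> L2_norm seq_measure \<alpha> \<le> \<kappa> * L2_norm seq_measure (defect u \<alpha>)"
  by (simp add: bounded_below_def)

lemma bounded_below_mono: "bounded_below \<kappa> u \<Longrightarrow> \<kappa> \<le> \<kappa>' \<Longrightarrow> bounded_below \<kappa>' u"
  unfolding bounded_below_def
  by (auto intro: order_trans mult_right_mono[OF _ L2_norm_nonneg])

lemma invertible_bounded_below: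
  assumes "invertible_operator seq_measure (\<lambda>\<alpha> j. \<alpha> j - R_op l \<xi> u \<alpha> j)" and u: "0 \<le> u"
  obtains \<kappa> where "bounded_below \<kappa> u"
proof -
  obtain S where S: "inverse_operator seq_measure (\<lambda>\<alpha> j. \<alpha> j - R_op l \<xi> u \<alpha> j) S"
    using assms(1) by (auto simp: invertible_operator_def)
  then have bS: "bounded_operator seq_measure seq_measure S" by (simp add: inverse_operator_def)
  obtain B where B: "0 \<le> B" "\<And>w. w \<in> L2 seq_measure \<Longrightarrow> L2_norm seq_measure (S w) \<le> B * L2_norm seq_measure w"
    using bounded_operator_bound[OF bS] by blast
  have "L2_norm seq_measure \<alpha> \<le> (B + 1) * L2_norm seq_measure (defect u \<alpha>)" if \<alpha>: "\<alpha> \<in> L2 seq_measure" for \<alpha>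
  proof -
    have "S (defect u \<alpha>) = \<alpha>"
      using S \<alpha> by (simp add: inverse_operator_def AE_count_space defect_def[abs_def] fun_eq_iff)
    then have "L2_norm seq_measure \<alpha> \<le> B * L2_norm seq_measure (defect u \<alpha>)"
      using B(2)[OF defect_L2[OF u \<alpha>]] by simp
    then show ?thesis
      by (simp add: distrib_right add_increasing2)
  qed
  then have "bounded_below (B + 1) u" using B(1) by (simp add: bounded_below_def)
  then show ?thesis by (rule that)
qed

text \<open>Replacing R_u by R_s costs at most half of the norm on the left, and absorbing that half
  doubles the constant.\<close>

lemma bounded_below_nearby:
  assumes below: "bounded_below \<kappa> u" and u: "0 \<le> u" and s: "0 \<le> s"
    and close: "\<kappa> * (\<xi>_norm * K * sqrt \<bar>s - u\<bar>) \<le> 1 / 2"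
  shows "bounded_below (2 * \<kappa>) s"
proof -
  have \<kappa>: "0 < \<kappa>" using below by (simp add: bounded_below_def)
  have "L2_norm seq_measure \<alpha> \<le> 2 * \<kappa> * L2_norm seq_measure (defect s \<alpha>)" if \<alpha>: "\<alpha> \<in> L2 seq_measure" for \<alpha>
  proof -
    let ?d = "\<lambda>j. R_op l \<xi> s \<alpha> j - R_op l \<xi> u \<alpha> j"
    have "defect u \<alpha> = (\<lambda>j. defect s \<alpha> j + ?d j)"
      by (simp add: defect_def fun_eq_iff)
    then have "L2_norm seq_measure (defect u \<alpha>) \<le> L2_norm seq_measure (defect s \<alpha>) + L2_norm seq_measure ?d"
      using L2_norm_triangle[OF defect_L2[OF s \<alpha>] L2_diff[OF R_op_L2[OF s \<alpha>] R_op_L2[OF u \<alpha>]]] by simp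
    also have "\<dots> \<le> L2_norm seq_measure (defect s \<alpha>) + \<xi>_norm * K * sqrt \<bar>s - u\<bar> * L2_norm seq_measure \<alpha>"
      by (intro add_left_mono R_op_diff_norm s u \<alpha>)
    finally have "\<kappa> * L2_norm seq_measure (defect u \<alpha>)
        \<le> \<kappa> * (L2_norm seq_measure (defect s \<alpha>) + \<xi>_norm * K * sqrt \<bar>s - u\<bar> * L2_norm seq_measure \<alpha>)"
      using \<kappa> by (intro mult_left_mono) auto
    also have "\<dots> = \<kappa> * L2_norm seq_measure (defect s \<alpha>)
        + \<kappa> * (\<xi>_norm * K * sqrt \<bar>s - u\<bar>) * L2_norm seq_measure \<alpha>"
      by (simp add: algebra_simps)
    also have "\<dots> \<le> \<kappa> * L2_norm seq_measure (defect s \<alpha>) + 1 / 2 * L2_norm seq_measure \<alpha>"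
      by (intro add_left_mono mult_right_mono close) simp
    finally show ?thesis
      using bounded_belowD[OF below \<alpha>] by simp
  qed
  then show ?thesis using \<kappa> by (simp add: bounded_below_def)
qed

lemma bounded_below_small:
  assumes u: "0 \<le> u" and small: "\<xi>_norm * K' * exp (- \<delta> * u) \<le> 1 / 2"
  shows "bounded_below 2 u"
proof -
  have "L2_norm seq_measure \<alpha> \<le> 2 * L2_norm seq_measure (defect u \<alpha>)" if \<alpha>: "\<alpha> \<in> L2 seq_measure" for \<alpha>
  proof -
    have "L2_norm seq_measure \<alpha> \<le> L2_norm seq_measure (R_op l \<xi> u \<alpha>) + L2_norm seq_measure (defect u \<alpha>)"
      unfolding defect_def[abs_def] by (rule L2_norm_triangle_sub[OF \<alpha> R_op_L2[OF u \<alpha>]])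
    moreover have "L2_norm seq_measure (R_op l \<xi> u \<alpha>) \<le> 1 / 2 * L2_norm seq_measure \<alpha>"
      using R_op_norm[OF u \<alpha>] mult_right_mono[OF small L2_norm_nonneg[of seq_measure \<alpha>]] by linarith
    ultimately show ?thesis by simp
  qed
  then show ?thesis by (simp add: bounded_below_def)
qed

text \<open>Compactness of \<open>[t, T]\<close> handles a bounded range of parameters, decay of \<open>R\<^sub>u\<close> the rest.\<close>

lemma uniformly_bounded_below:
  assumes t: "0 < t"
    and inv: "\<And>u. 0 < u \<Longrightarrow> invertible_operator seq_measure (\<lambda>\<alpha> j. \<alpha> j - R_op l \<xi> u \<alpha> j)"
  obtains \<kappa> where "\<And>u. t \<le> u \<Longrightarrow> bounded_below \<kappa> u"
proof -
  obtain T where T: "\<And>u. T \<le> u \<Longrightarrow> \<xi>_norm * K' * exp (- \<delta> * u) \<le> 1 / 2"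
  proof -
    have "LIM s at_top. - \<delta> * s :> at_bot"
      using \<delta> by (intro filterlim_tendsto_neg_mult_at_bot[OF tendsto_const _ filterlim_ident]) auto
    then have "((\<lambda>s. \<xi>_norm * K' * exp (- \<delta> * s)) \<longlongrightarrow> \<xi>_norm * K' * 0) at_top"
      by (intro tendsto_mult_left filterlim_compose[OF exp_at_bot])
    then have "\<forall>\<^sub>F s in at_top. \<xi>_norm * K' * exp (- \<delta> * s) < 1 / 2"
      by (rule order_tendstoD) simp
    then obtain T where "\<And>u. T \<le> u \<Longrightarrow> \<xi>_norm * K' * exp (- \<delta> * u) < 1 / 2"
      by (auto simp: eventually_at_top_linorder)
    then show ?thesis by (intro that[of T] less_imp_le)
  qed
  have "\<exists>k. bounded_below k u" if "u \<in> {t..T}" for u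
    using invertible_bounded_below[OF inv, of u] that t by force
  then obtain k where k: "\<And>u. u \<in> {t..T} \<Longrightarrow> bounded_below (k u) u" by metis
  \<comment> \<open>The radius is the square of the admissible size of sqrt |s - u|. Adding 1 keeps
    the denominator positive even if \<xi> or \<open>K\<close> is 0.\<close>
  define r where "r u = (1 / (2 * k u * (\<xi>_norm * K + 1)))\<^sup>2" for u
  have pos: "0 < \<xi>_norm * K + 1"
    using mult_nonneg_nonneg[OF \<xi>_norm_nonneg K] by linarith
  have kpos: "0 < k u" if "u \<in> {t..T}" for u using k[OF that] by (simp add: bounded_below_def)
  have rpos: "0 < r u" if "u \<in> {t..T}" for u
    using kpos[OF that] pos by (simp add: r_def)
  have near: "bounded_below (2 * k u) s" if u: "u \<in> {t..T}" and s: "s \<in> ball u (r u)" "0 \<le> s" for u s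
  proof (rule bounded_below_nearby[OF k[OF u] _ s(2)])
    show "0 \<le> u" using u t by simp
    have "sqrt \<bar>s - u\<bar> \<le> 1 / (2 * k u * (\<xi>_norm * K + 1))"
      using s(1) kpos[OF u] pos unfolding r_def
      by (intro real_le_lsqrt) (auto simp: dist_real_def abs_minus_commute)
    then have "k u * (\<xi>_norm * K * sqrt \<bar>s - u\<bar>) \<le> k u * ((\<xi>_norm * K + 1) * (1 / (2 * k u * (\<xi>_norm * K + 1))))"
      using kpos[OF u] pos mult_nonneg_nonneg[OF \<xi>_norm_nonneg K] by (intro mult_left_mono mult_mono) auto
    also have "\<dots> = 1 / 2"
    proof -
      have "a * (b * (1 / (2 * a * b))) = 1 / 2" if "0 < a" "0 < b" for a b :: real
        using that by (simp add: field_simps)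
      then show ?thesis using kpos[OF u] pos by blast
    qed
    finally show "k u * (\<xi>_norm * K * sqrt \<bar>s - u\<bar>) \<le> 1 / 2" .
  qed
  have "{t..T} \<subseteq> (\<Union>u\<in>{t..T}. ball u (r u))"
  proof
    fix u assume u: "u \<in> {t..T}"
    then show "u \<in> (\<Union>u\<in>{t..T}. ball u (r u))"
      using rpos[OF u] by (intro UN_I[OF u]) simp
  qed
  then obtain C where C: "C \<subseteq> {t..T}" "finite C" "{t..T} \<subseteq> (\<Union>u\<in>C. ball u (r u))"
    by (rule compactE_image[OF compact_Icc open_ball])
  have Cpos: "0 \<le> k c" if "c \<in> C" for c using kpos C(1) that by (intro less_imp_le) auto
  \<comment> \<open>Every constant 2 k c of the finite subcover is at most the sum of all of them;
    the extra 2 is the constant valid beyond T and keeps the total positive when the cover is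
    empty.\<close>
  show ?thesis
  proof (rule that[of "(\<Sum>c\<in>C. 2 * k c) + 2"])
    fix u assume u: "t \<le> u"
    show "bounded_below ((\<Sum>c\<in>C. 2 * k c) + 2) u"
    proof (cases "u \<le> T")
      case True
      then obtain c where c: "c \<in> C" "u \<in> ball c (r c)" using C(3) u by auto
      then have "bounded_below (2 * k c) u" using near C(1) u t by auto
      then show ?thesis
      proof (rule bounded_below_mono)
        show "2 * k c \<le> (\<Sum>c\<in>C. 2 * k c) + 2"
          using member_le_sum[of c C "\<lambda>c. 2 * k c"] c(1) C(2) Cpos by fastforce
      qed
    next
      case False
      then have "bounded_below 2 u" using u t T by (intro bounded_below_small) auto
      then show ?thesis
        by (rule bounded_below_mono) (use Cpos in \<open>auto intro!: sum_nonneg\<close>)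
    qed
  qed
qed

subsection \<open>Truncation\<close>

definition tail :: "nat \<Rightarrow> real" where
  "tail n = \<xi>_norm - (\<Sum>j<n. cmod (\<xi> j))"

lemma tail_sums: "(\<lambda>j. if j < n then 0 else cmod (\<xi> j)) sums tail n"
proof -
  have "(\<lambda>j. cmod (\<xi> j)) sums \<xi>_norm"
    unfolding \<xi>_norm_def by (rule summable_sums[OF \<xi>_summable])
  moreover have "(\<lambda>j. if j \<in> {..<n} then cmod (\<xi> j) else 0) sums (\<Sum>j\<in>{..<n}. cmod (\<xi> j))"
    by (rule sums_If_finite_set) simp
  ultimately have "(\<lambda>j. cmod (\<xi> j) - (if j \<in> {..<n} then cmod (\<xi> j) else 0)) sums (\<xi>_norm - (\<Sum>j\<in>{..<n}. cmod (\<xi> j)))"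
    by (rule sums_diff)
  moreover have "(\<lambda>j. cmod (\<xi> j) - (if j \<in> {..<n} then cmod (\<xi> j) else 0)) = (\<lambda>j. if j < n then 0 else cmod (\<xi> j))"
    by auto
  ultimately show ?thesis by (simp only: tail_def)
qed

lemma tail_tendsto: "tail \<longlonglongrightarrow> 0"
proof -
  have "(\<lambda>n. \<xi>_norm - (\<Sum>j<n. cmod (\<xi> j))) \<longlonglongrightarrow> \<xi>_norm - \<xi>_norm"
    unfolding \<xi>_norm_def by (intro tendsto_intros summable_LIMSEQ \<xi>_summable)
  then show ?thesis by (simp add: tail_def[abs_def])
qed

lemma tail_nonneg: "0 \<le> tail n"
  using suminf_nonneg[OF sums_summable[OF tail_sums[of n]]] sums_unique[OF tail_sums[of n]] by auto

lemma tail_le: "tail n \<le> \<xi>_norm"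
  unfolding tail_def by (simp add: sum_nonneg)

text \<open>For sequences that vanish in the first \<open>n\<close> coordinates and carry the factor
  |\<open>\<xi> j\<close>| in the others. Truncation residuals have exactly this shape.\<close>

lemma tail_bound:
  assumes "\<And>j. cmod (\<alpha> j) \<le> (if j < n then 0 else cmod (\<xi> j)) * c"
  shows "L2_norm seq_measure \<alpha> \<le> tail n * c"
  using L2_seq_bound(2)[OF summable_mult2[OF sums_summable[OF tail_sums]] assms]
  by (simp only: suminf_mult2[OF sums_summable[OF tail_sums], symmetric] sums_unique[OF tail_sums, symmetric])

lemma R_op_bound':
  assumes "0 \<le> u" "\<alpha> \<in> L2 seq_measure"
  shows "cmod (R_op l \<xi> u \<alpha> j) \<le> cmod (\<xi> j) * (K' * L2_norm seq_measure \<alpha>)"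
proof -
  have "K' * exp (- \<delta> * u) \<le> K' * 1"
    using \<delta> assms(1) K'_nonneg by (intro mult_left_mono) auto
  then show ?thesis
    using R_op_bound[OF assms, of j]
    by (elim order_trans) (intro mult_left_mono mult_right_mono, auto)
qed

lemma R_op_finite:
  assumes "\<And>j. n \<le> j \<Longrightarrow> v j = 0"
  shows "R_op l \<xi> u v i = (\<Sum>k<n. \<xi> i * row u i k * v k)"
proof -
  have "(\<Sum>k. \<xi> i * row u i k * v k) = (\<Sum>k<n. \<xi> i * row u i k * v k)"
    by (rule suminf_finite) (use assms in auto)
  then show ?thesis by (simp add: R_op_def row_def)
qed

lemma finite_support_L2:
  assumes "\<And>j. n \<le> j \<Longrightarrow> v j = 0"
  shows "v \<in> L2 seq_measure"
proof -
  have "v = (\<lambda>j. if j \<in> {..<n} then v j else 0)" using assms by (auto simp: not_less)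
  then show ?thesis using L2_seq_finite_support(1)[of "{..<n}" v] by simp
qed

section \<open>Truncated determinants and their logarithmic derivatives\<close>

definition A_mat :: "real \<Rightarrow> nat \<Rightarrow> nat \<Rightarrow> complex" where
  "A_mat u i j = (if i = j then 1 else 0) + - (\<xi> i * row u i j)"

definition D :: "nat \<Rightarrow> real \<Rightarrow> complex" where
  "D n u = fdet n (A_mat u)"

lemma A_mat_mult:
  assumes v: "\<And>j. n \<le> j \<Longrightarrow> v j = 0" and i: "i < n"
  shows "(\<Sum>k<n. A_mat u i k * v k) = defect u v i"
proof -
  have "(\<Sum>k<n. A_mat u i k * v k) = (\<Sum>k<n. (if k = i then v k else 0) - \<xi> i * row u i k * v k)"
    by (rule sum.cong) (auto simp: A_mat_def algebra_simps)
  also have "\<dots> = v i - (\<Sum>k<n. \<xi> i * row u i k * v k)"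
    using i by (simp add: sum_subtractf)
  finally show ?thesis
    by (simp only: defect_def R_op_finite[OF v])
qed

text \<open>Extend a kernel vector of the corner by zeros. Its image under I - R_u vanishes in the
  first \<open>n\<close> coordinates and is - R_u v in the others, so its norm is at most
  \<open>tail n\<close> K' |v|, which contradicts the lower bound for large
  \<open>n\<close>.\<close>

lemma D_nonzero:
  assumes below: "bounded_below \<kappa> u" and u: "0 \<le> u" and small: "\<kappa> * (K' * tail n) < 1"
  shows "D n u \<noteq> 0"
proof
  assume "D n u = 0"
  then obtain v where v: "\<And>i. i < n \<Longrightarrow> (\<Sum>j<n. A_mat u i j * v j) = 0" "\<exists>j<n. v j \<noteq> 0" "\<And>j. j \<ge> n \<Longrightarrow> v j = 0"
    unfolding D_def by (rule fdet_zero_kernel) blast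
  have vL2: "v \<in> L2 seq_measure" by (rule finite_support_L2[OF v(3)])
  have \<kappa>: "0 < \<kappa>" using below by (simp add: bounded_below_def)
  have "cmod (defect u v j) \<le> (if j < n then 0 else cmod (\<xi> j)) * (K' * L2_norm seq_measure v)" for j
  proof (cases "j < n")
    case True
    then show ?thesis using v(1)[OF True] A_mat_mult[OF v(3) True, where u = u] by simp
  next
    case False
    then show ?thesis
      using R_op_bound'[OF u vL2, of j] v(3)[of j] by (simp add: defect_def)
  qed
  from tail_bound[OF this]
  have "\<kappa> * L2_norm seq_measure (defect u v) \<le> \<kappa> * (tail n * (K' * L2_norm seq_measure v))"
    using \<kappa> by (intro mult_left_mono) auto
  with bounded_belowD[OF below vL2]
  have "L2_norm seq_measure v \<le> \<kappa> * (K' * tail n) * L2_norm seq_measure v"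
    by (simp only: mult_ac)
  moreover obtain j where "v j \<noteq> 0" using v(2) by blast
  then have "0 < L2_norm seq_measure v"
    using cmod_le_L2_norm_seq[OF vL2, of j] by (meson less_le_trans zero_less_norm_iff)
  ultimately show False
    using mult_strict_right_mono[OF small, of "L2_norm seq_measure v"] by simp
qed

abbreviation input :: "real \<Rightarrow> nat \<Rightarrow> complex" where
  "input u \<equiv> semigroup_op l u (B_op \<xi> 1)"

text \<open>Cramer's solution of the n-by-n corner of (I - R_u) w = e^(-uA) \<xi>, extended by
  zeros.\<close>

definition sol :: "nat \<Rightarrow> real \<Rightarrow> nat \<Rightarrow> complex" where
  "sol n u j = (if j < n then (\<Sum>i<n. fcof n (A_mat u) i j * input u i) / D n u else 0)"

definition \<tau> :: "nat \<Rightarrow> real \<Rightarrow> complex" where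
  "\<tau> n u = (\<Sum>j<n. E u j * sol n u j)"

lemma sol_defect:
  assumes "D n u \<noteq> 0" "i < n"
  shows "defect u (sol n u) i = input u i"
proof -
  have "defect u (sol n u) i = (\<Sum>k<n. A_mat u i k * sol n u k)"
    by (rule A_mat_mult[symmetric]) (use assms in \<open>auto simp: sol_def\<close>)
  also have "\<dots> = (\<Sum>k<n. \<Sum>m<n. A_mat u i k * fcof n (A_mat u) m k * input u m) / D n u"
    unfolding sum_divide_distrib
    by (rule sum.cong) (auto simp: sol_def sum_distrib_left mult.assoc sum_divide_distrib)
  also have "(\<Sum>k<n. \<Sum>m<n. A_mat u i k * fcof n (A_mat u) m k * input u m)
      = (\<Sum>m<n. (\<Sum>k<n. A_mat u i k * fcof n (A_mat u) m k) * input u m)"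
    by (subst sum.swap) (simp add: sum_distrib_right)
  also have "\<dots> = (\<Sum>m<n. if m = i then D n u * input u i else 0)"
    by (rule sum.cong) (use assms(2) in \<open>auto simp: fcof_fdet D_def\<close>)
  also have "\<dots> = D n u * input u i"
    using assms(2) by simp
  finally show ?thesis using assms(1) by simp
qed

lemma row_has_vector_derivative: "((\<lambda>u. row u i j) has_vector_derivative - (E u i * E u j)) (at u)"
proof -
  have "((\<lambda>w. exp (- z * w) / z) has_field_derivative - exp (- z * w)) (at w)" if "z \<noteq> 0" for z w :: complex
    using that by (auto intro!: derivative_eq_intros)
  from has_vector_derivative_real_field[OF this[OF l_sum_nz[of i j]]]
  have "((\<lambda>u. row u i j) has_vector_derivative - exp (- (l i + l j) * of_real u)) (at u)"
    by (simp add: row_def)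
  moreover have "exp (- (l i + l j) * of_real u) = E u i * E u j"
    by (simp add: exp_add[symmetric] algebra_simps)
  ultimately show ?thesis by simp
qed

text \<open>The entry derivative \<open>\<xi>_i E_i E_j\<close> has rank one, so Jacobi's double sum
  factors into the row E, the adjugate and the column e^(-uA) \<xi>. Dividing by D gives E paired
  with Cramer's solution, that is \<open>\<tau> n u\<close>.\<close>

lemma D_has_vector_derivative:
  assumes "D n u \<noteq> 0"
  shows "(D n has_vector_derivative D n u * \<tau> n u) (at u)"
proof -
  have "((\<lambda>u. A_mat u i j) has_vector_derivative \<xi> i * (E u i * E u j)) (at u)" for i j
  proof -
    have "((\<lambda>u. (if i = j then 1 else 0) + - (\<xi> i * row u i j)) has_vector_derivative
        0 + - (\<xi> i * - (E u i * E u j))) (at u)"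
      by (intro has_vector_derivative_add has_vector_derivative_const has_vector_derivative_minus
          has_vector_derivative_mult_right row_has_vector_derivative)
    then show ?thesis by (simp add: A_mat_def)
  qed
  then have "((\<lambda>u. fdet n (A_mat u)) has_vector_derivative
      (\<Sum>i<n. \<Sum>j<n. \<xi> i * (E u i * E u j) * fcof n (A_mat u) i j)) (at u)"
    by (rule fdet_has_vector_derivative)
  moreover have "(\<Sum>i<n. \<Sum>j<n. \<xi> i * (E u i * E u j) * fcof n (A_mat u) i j)
      = (\<Sum>j<n. E u j * (\<Sum>i<n. fcof n (A_mat u) i j * input u i))"
    by (subst sum.swap) (simp add: sum_distrib_left semigroup_eq B_op_def mult_ac)
  moreover have "\<dots> = D n u * \<tau> n u"
    unfolding \<tau>_def sum_distrib_left[of "D n u"]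
    by (rule sum.cong) (use assms in \<open>auto simp: sol_def\<close>)
  ultimately show ?thesis by (simp add: D_def[abs_def])
qed

lemma A_mat_continuous: "((\<lambda>s. A_mat s i j) \<longlongrightarrow> A_mat u i j) (at u within S)"
  unfolding A_mat_def row_def using l_sum_nz[of i j] by (intro tendsto_intros) auto

lemma D_continuous: "(D n \<longlongrightarrow> D n u) (at u within S)"
  unfolding D_def[abs_def] by (intro tendsto_fdet A_mat_continuous)

lemma \<tau>_continuous:
  assumes "D n u \<noteq> 0"
  shows "(\<tau> n \<longlongrightarrow> \<tau> n u) (at u within S)"
proof -
  have fcof: "((\<lambda>s. fcof n (A_mat s) i j) \<longlongrightarrow> fcof n (A_mat u) i j) (at u within S)" if "i < n" "j < n" for i j
    unfolding fcof_eq_fdet[OF that] by (intro tendsto_intros tendsto_fdet A_mat_continuous)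
  have "((\<lambda>s. \<Sum>j<n. E s j * ((\<Sum>i<n. fcof n (A_mat s) i j * (E s i * (1 * \<xi> i))) / D n s))
      \<longlongrightarrow> (\<Sum>j<n. E u j * ((\<Sum>i<n. fcof n (A_mat u) i j * (E u i * (1 * \<xi> i))) / D n u))) (at u within S)"
    by (intro tendsto_sum tendsto_mult tendsto_divide tendsto_intros fcof D_continuous assms) auto
  then show ?thesis
    by (simp add: \<tau>_def[abs_def] sol_def semigroup_eq B_op_def)
qed

text \<open>Fixes the constant of integration for the logarithmic derivative: the rows decay
  exponentially, so the corner tends to the identity matrix.\<close>

lemma D_tendsto_1: "(D n \<longlongrightarrow> 1) at_top"
proof -
  have row0: "((\<lambda>s. row s i j) \<longlongrightarrow> 0) at_top" for i j
  proof (rule Lim_null_comparison)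
    show "\<forall>\<^sub>F s in at_top. norm (row s i j) \<le> exp (- Re (l i + l j) * s) / cmod (l i + l j)"
      by (simp add: row_def norm_divide)
    have "LIM s at_top. - Re (l i + l j) * s :> at_bot"
      using Re_l_sum_pos[of i j] by (intro filterlim_tendsto_neg_mult_at_bot[OF tendsto_const _ filterlim_ident]) auto
    then have "((\<lambda>s. exp (- Re (l i + l j) * s) / cmod (l i + l j)) \<longlongrightarrow> 0 / cmod (l i + l j)) at_top"
      using l_sum_nz[of i j] by (intro tendsto_divide filterlim_compose[OF exp_at_bot] tendsto_const) auto
    then show "((\<lambda>s. exp (- Re (l i + l j) * s) / cmod (l i + l j)) \<longlongrightarrow> 0) at_top" by simp
  qed
  have "((\<lambda>s. fdet n (A_mat s)) \<longlongrightarrow> fdet n (\<lambda>i j. if i = j then 1 else 0)) at_top"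
  proof (rule tendsto_fdet)
    fix i j
    have "((\<lambda>s. (if i = j then 1 else 0) + - (\<xi> i * row s i j)) \<longlongrightarrow> (if i = j then 1 else 0) + - (\<xi> i * 0)) at_top"
      by (intro tendsto_intros row0)
    then show "((\<lambda>s. A_mat s i j) \<longlongrightarrow> (if i = j then 1 else 0)) at_top"
      by (simp add: A_mat_def)
  qed
  then show ?thesis by (simp add: D_def[abs_def] fdet_identity)
qed

lemma R_op_diff:
  assumes "0 \<le> u" "\<alpha> \<in> L2 seq_measure" "\<beta> \<in> L2 seq_measure"
  shows "R_op l \<xi> u (\<lambda>j. \<alpha> j - \<beta> j) j = R_op l \<xi> u \<alpha> j - R_op l \<xi> u \<beta> j"
  using bounded_operator_diff[OF R_op_bounded[OF assms(1)] assms(2,3)] by (simp add: AE_count_space)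

lemma input_bound:
  assumes "0 \<le> u"
  shows "cmod (input u j) \<le> cmod (\<xi> j) * exp (- \<delta> * u)" "cmod (input u j) \<le> cmod (\<xi> j)"
proof -
  have eq: "cmod (input u j) = cmod (\<xi> j) * cmod (E u j)"
    by (simp add: semigroup_eq B_op_def norm_mult)
  show "cmod (input u j) \<le> cmod (\<xi> j) * exp (- \<delta> * u)"
    unfolding eq by (intro mult_left_mono E_bound assms) simp
  show "cmod (input u j) \<le> cmod (\<xi> j)"
    unfolding eq by (rule mult_left_le[OF E_le_1[OF assms] norm_ge_zero])
qed

section \<open>Comparison of truncated and exact solutions, uniform in the parameter\<close>

context
  fixes \<kappa> u :: real and w :: "nat \<Rightarrow> complex" and n :: nat
  assumes below: "bounded_below \<kappa> u" and u: "0 \<le> u"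
    and w: "w \<in> L2 seq_measure" "\<And>j. defect u w j = input u j"
    and small: "\<kappa> * (K' * tail n) \<le> 1 / 2"
begin

lemma \<kappa>_pos: "0 < \<kappa>"
  using below by (simp add: bounded_below_def)

lemma D_nz: "D n u \<noteq> 0"
  by (rule D_nonzero[OF below u]) (use small in linarith)

lemma sol_L2: "sol n u \<in> L2 seq_measure"
  by (rule finite_support_L2[of n]) (simp add: sol_def)

lemma w_norm: "L2_norm seq_measure w \<le> \<kappa> * \<xi>_norm"
proof -
  have "defect u w = input u" using w(2) by auto
  then have "L2_norm seq_measure w \<le> \<kappa> * L2_norm seq_measure (input u)"
    using bounded_belowD[OF below w(1)] by simp
  also have "\<dots> \<le> \<kappa> * (\<xi>_norm * 1)"
    using \<kappa>_pos u \<delta> \<xi>_norm_nonneg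
    by (intro mult_left_mono order_trans[OF input_norm[OF u]]) auto
  finally show ?thesis by simp
qed

text \<open>The two solutions leave the same residual in the first \<open>n\<close> coordinates. In
  the others the difference of residuals is the input plus R_u sol, of size |\<open>\<xi> j\<close>|
  (1 + K' |sol|), so the lower bound applies with a tail factor.\<close>

lemma diff_norm: "L2_norm seq_measure (\<lambda>j. w j - sol n u j) \<le> \<kappa> * (tail n * (1 + K' * L2_norm seq_measure (sol n u)))"
proof -
  have d: "(\<lambda>j. w j - sol n u j) \<in> L2 seq_measure" by (rule L2_diff[OF w(1) sol_L2])
  have "cmod (defect u (\<lambda>j. w j - sol n u j) j)
      \<le> (if j < n then 0 else cmod (\<xi> j)) * (1 + K' * L2_norm seq_measure (sol n u))" for j
  proof -
    have eq: "defect u (\<lambda>j. w j - sol n u j) j = input u j - defect u (sol n u) j"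
      using w(2)[of j] by (simp add: defect_def R_op_diff[OF u w(1) sol_L2])
    show ?thesis
    proof (cases "j < n")
      case True
      then show ?thesis using sol_defect[OF D_nz True] eq by simp
    next
      case False
      then have "defect u (\<lambda>j. w j - sol n u j) j = input u j + R_op l \<xi> u (sol n u) j"
        unfolding eq by (simp add: defect_def sol_def)
      then have "cmod (defect u (\<lambda>j. w j - sol n u j) j) \<le> cmod (\<xi> j) + cmod (\<xi> j) * (K' * L2_norm seq_measure (sol n u))"
        using norm_triangle_ineq[of "input u j" "R_op l \<xi> u (sol n u) j"] input_bound(2)[OF u, of j]
          R_op_bound'[OF u sol_L2, of j] by simp
      then show ?thesis using False by (simp add: distrib_left)
    qed
  qed
  from tail_bound[OF this] have "\<kappa> * L2_norm seq_measure (defect u (\<lambda>j. w j - sol n u j))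
      \<le> \<kappa> * (tail n * (1 + K' * L2_norm seq_measure (sol n u)))"
    using \<kappa>_pos by (intro mult_left_mono) auto
  with bounded_belowD[OF below d] show ?thesis by linarith
qed

text \<open>Solves |sol| \<le> 2 \<kappa> \<open>\<xi>_norm\<close> + |sol|/2, the inequality
  obtained from the estimates for w and w - sol. It depends on neither n nor u.\<close>

definition V :: real where "V = 4 * (\<kappa> * \<xi>_norm)"

lemma sol_norm: "L2_norm seq_measure (sol n u) \<le> V"
proof -
  let ?s = "L2_norm seq_measure (sol n u)"
  have "?s \<le> L2_norm seq_measure w + L2_norm seq_measure (\<lambda>j. sol n u j - w j)"
    by (rule L2_norm_triangle_sub[OF sol_L2 w(1)])
  also have "L2_norm seq_measure (\<lambda>j. sol n u j - w j) = L2_norm seq_measure (\<lambda>j. w j - sol n u j)"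
    by (rule L2_norm_minus_commute)
  also have "L2_norm seq_measure w + \<dots> \<le> \<kappa> * \<xi>_norm + \<kappa> * (tail n * (1 + K' * ?s))"
    by (intro add_mono w_norm diff_norm)
  also have "\<dots> = \<kappa> * \<xi>_norm + \<kappa> * tail n + \<kappa> * (K' * tail n) * ?s"
    by (simp add: algebra_simps)
  also have "\<dots> \<le> \<kappa> * \<xi>_norm + \<kappa> * \<xi>_norm + 1 / 2 * ?s"
    using \<kappa>_pos by (intro add_mono mult_right_mono small mult_left_mono tail_le) auto
  finally show ?thesis by (simp add: V_def)
qed

lemma V_nonneg: "0 \<le> V"
  using sol_norm L2_norm_nonneg[of seq_measure "sol n u"] by linarith

lemma diff_norm_tail: "L2_norm seq_measure (\<lambda>j. w j - sol n u j) \<le> tail n * (\<kappa> * (1 + K' * V))"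
proof -
  have "\<kappa> * (tail n * (1 + K' * L2_norm seq_measure (sol n u))) \<le> \<kappa> * (tail n * (1 + K' * V))"
    using \<kappa>_pos tail_nonneg K'_nonneg sol_norm by (intro mult_left_mono add_left_mono) auto
  then show ?thesis using diff_norm by (simp add: mult_ac)
qed

text \<open>The identity sol = input + R_u sol on the first \<open>n\<close> coordinates bounds them
  by multiples of |\<open>\<xi> j\<close>|, and E contributes e^(-\<delta> u). The result is
  integrable in u and free of n: the majorant for dominated convergence.\<close>

lemma \<tau>_bound: "cmod (\<tau> n u) \<le> \<xi>_norm * (1 + K' * V) * exp (- \<delta> * u)"
proof -
  have "cmod (sol n u j) \<le> cmod (\<xi> j) * (1 + K' * V)" if j: "j < n" for j
  proof -
    have "sol n u j = input u j + R_op l \<xi> u (sol n u) j"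
      using sol_defect[OF D_nz j] by (simp add: defect_def algebra_simps)
    then have "cmod (sol n u j) \<le> cmod (\<xi> j) + cmod (\<xi> j) * (K' * L2_norm seq_measure (sol n u))"
      using norm_triangle_ineq[of "input u j" "R_op l \<xi> u (sol n u) j"] input_bound(2)[OF u, of j]
          R_op_bound'[OF u sol_L2, of j] by simp
    also have "\<dots> \<le> cmod (\<xi> j) + cmod (\<xi> j) * (K' * V)"
      by (intro add_left_mono mult_left_mono sol_norm K'_nonneg) simp
    finally show ?thesis by (simp add: distrib_left)
  qed
  then have "cmod (\<tau> n u) \<le> (\<Sum>j<n. exp (- \<delta> * u) * (cmod (\<xi> j) * (1 + K' * V)))"
    unfolding \<tau>_def
    by (intro order_trans[OF norm_sum] sum_mono)
      (auto simp only: norm_mult lessThan_iff intro!: mult_mono E_bound u exp_ge_zero norm_ge_zero)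
  also have "\<dots> = (\<Sum>j<n. cmod (\<xi> j)) * ((1 + K' * V) * exp (- \<delta> * u))"
    unfolding sum_distrib_right by (rule sum.cong[OF refl]) (simp only: mult_ac)
  also have "\<dots> \<le> \<xi>_norm * ((1 + K' * V) * exp (- \<delta> * u))"
  proof (rule mult_right_mono)
    show "(\<Sum>j<n. cmod (\<xi> j)) \<le> \<xi>_norm"
      unfolding \<xi>_norm_def by (rule sum_le_suminf[OF \<xi>_summable]) auto
    show "0 \<le> (1 + K' * V) * exp (- \<delta> * u)"
      using K'_nonneg V_nonneg by (intro mult_nonneg_nonneg add_nonneg_nonneg) auto
  qed
  finally show ?thesis by (simp add: mult.assoc)
qed

text \<open>\<open>C\<close> sums coordinates, so an l^1 estimate of w - sol is needed. For j < n
  both satisfy the fixed point equation, so the difference is R_u (w - sol), where l^2 closeness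
  gains the factor |\<open>\<xi> j\<close>|; for j \<ge> n the additional terms carry a tail of
  \<xi>.\<close>

lemma \<tau>_diff:
  "cmod (C_op (semigroup_op l u w) - \<tau> n u) \<le> tail n * (\<xi>_norm * K' * (\<kappa> * (1 + K' * V)) + (1 + K' * V))"
proof -
  let ?d = "L2_norm seq_measure (\<lambda>j. w j - sol n u j)"
  \<comment> \<open>The first summand accounts for R_u (w - sol) in all coordinates, the second for
    the input and R_u sol in the coordinates that the truncation drops.\<close>
  define c where "c j = cmod (\<xi> j) * (K' * ?d) + (if j < n then 0 else cmod (\<xi> j)) * (1 + K' * V)" for j
  have cs: "c sums (\<xi>_norm * (K' * ?d) + tail n * (1 + K' * V))"
    unfolding c_def \<xi>_norm_def by (intro sums_add sums_mult2 tail_sums summable_sums[OF \<xi>_summable])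
  have Rd: "cmod (R_op l \<xi> u w j - R_op l \<xi> u (sol n u) j) \<le> cmod (\<xi> j) * (K' * ?d)" for j
    using R_op_bound'[OF u L2_diff[OF w(1) sol_L2], of j] by (simp only: R_op_diff[OF u w(1) sol_L2])
  have weq: "w j = input u j + R_op l \<xi> u w j" for j
    using w(2)[of j] by (simp only: defect_def diff_eq_eq)
  have le: "cmod (w j - sol n u j) \<le> c j" for j
  proof (cases "j < n")
    case True
    have seq: "sol n u j = input u j + R_op l \<xi> u (sol n u) j"
      using sol_defect[OF D_nz True] by (simp only: defect_def diff_eq_eq)
    have eq: "w j - sol n u j = R_op l \<xi> u w j - R_op l \<xi> u (sol n u) j"
      by (subst weq, subst seq) (rule add_diff_cancel_left)
    have cj: "c j = cmod (\<xi> j) * (K' * ?d)"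
      using True by (simp only: c_def if_True mult_zero_left add_0_right)
    show ?thesis unfolding eq cj by (rule Rd)
  next
    case False
    have sol0: "sol n u j = 0" using False by (simp only: sol_def if_False)
    have alg: "x + y - 0 = (y - z) + (x + z)" for x y z :: complex by simp
    have eq: "w j - sol n u j = (R_op l \<xi> u w j - R_op l \<xi> u (sol n u) j) + (input u j + R_op l \<xi> u (sol n u) j)"
      unfolding sol0 by (subst weq) (rule alg)
    have "cmod (w j - sol n u j) \<le> cmod (\<xi> j) * (K' * ?d) + (cmod (\<xi> j) + cmod (\<xi> j) * (K' * L2_norm seq_measure (sol n u)))"
      unfolding eq by (rule norm_triangle_mono[OF Rd norm_triangle_mono[OF input_bound(2)[OF u] R_op_bound'[OF u sol_L2]]])
    also have "\<dots> \<le> cmod (\<xi> j) * (K' * ?d) + (cmod (\<xi> j) + cmod (\<xi> j) * (K' * V))"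
      by (intro add_left_mono mult_left_mono sol_norm K'_nonneg norm_ge_zero)
    also have "\<dots> = c j"
      using False by (simp only: c_def if_False distrib_left mult_1_right)
    finally show ?thesis .
  qed
  have le': "cmod (E u j * (w j - sol n u j)) \<le> c j" for j
    unfolding norm_mult by (rule order_trans[OF mult_left_le_one_le[OF norm_ge_zero norm_ge_zero E_le_1[OF u]] le])
  have summ: "summable (\<lambda>j. cmod (E u j * (w j - sol n u j)))"
    by (rule summable_comparison_test'[OF sums_summable[OF cs], of 0])
      (simp only: real_norm_def abs_norm_cancel le')
  have fin: "(\<lambda>j. E u j * sol n u j) sums \<tau> n u"
    unfolding \<tau>_def by (rule sums_finite) (auto simp: sol_def)
  have "(\<lambda>j. E u j * (w j - sol n u j) + E u j * sol n u j) sums ((\<Sum>j. E u j * (w j - sol n u j)) + \<tau> n u)"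
    by (intro sums_add summable_sums[OF summable_norm_cancel[OF summ]] fin)
  then have "(\<lambda>j. E u j * w j) sums ((\<Sum>j. E u j * (w j - sol n u j)) + \<tau> n u)"
    by (simp only: right_diff_distrib diff_add_cancel)
  then have eq: "C_op (semigroup_op l u w) - \<tau> n u = (\<Sum>j. E u j * (w j - sol n u j))"
    unfolding C_op_def semigroup_eq by (simp only: sums_iff add_diff_cancel_right')
  have "cmod (C_op (semigroup_op l u w) - \<tau> n u) \<le> (\<Sum>j. cmod (E u j * (w j - sol n u j)))"
    unfolding eq by (rule summable_norm[OF summ])
  also have "\<dots> \<le> suminf c"
    by (rule suminf_le[OF le' summ sums_summable[OF cs]])
  also have "\<dots> = \<xi>_norm * (K' * ?d) + tail n * (1 + K' * V)"
    by (rule sums_unique[OF cs, symmetric])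
  also have "\<dots> \<le> \<xi>_norm * (K' * (tail n * (\<kappa> * (1 + K' * V)))) + tail n * (1 + K' * V)"
    by (intro add_right_mono mult_left_mono diff_norm_tail K'_nonneg \<xi>_norm_nonneg)
  also have "\<dots> = tail n * (\<xi>_norm * K' * (\<kappa> * (1 + K' * V)) + (1 + K' * V))"
  proof -
    have "a * (b * (m * (k * q))) + m * q = m * (a * b * (k * q) + q)" for a b m k q :: real
      by (simp add: algebra_simps)
    then show ?thesis .
  qed
  finally show ?thesis .
qed

end

subsection \<open>Passing to the limit\<close>

text \<open>In the product over J, the factors E t (p j) run through all E t j again. Hence e^(-(l_j
  + l_k) t) can be replaced by e^(-2 l_j t), which gives the minors of the negated Hankel
  kernel.\<close>

lemma D_minors:
  "D n t = (\<Sum>J\<in>Pow {..<n}. \<Sum>p | p permutes J. of_int (sign p) *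
    (\<Prod>j\<in>J. (- 1) * (\<xi> j * E (2 * t) j) * (1 / (l j + l (p j)))))"
  unfolding D_def A_mat_def fdet_principal_minors
proof (intro sum.cong refl arg_cong2[of _ _ _ _ "(*)"])
  fix J :: "nat set" and p assume "p \<in> {p. p permutes J}"
  then have p: "p permutes J" by simp
  have "(\<Prod>j\<in>J. - (\<xi> j * row t j (p j))) = (\<Prod>j\<in>J. - \<xi> j * (1 / (l j + l (p j))) * E t j * E t (p j))"
  proof (rule prod.cong[OF refl])
    fix j
    have "exp (- (l j + l (p j)) * of_real t) = E t j * E t (p j)"
      unfolding exp_add[symmetric] by (simp add: algebra_simps)
    then have "row t j (p j) = E t j * E t (p j) * (1 / (l j + l (p j)))"
      by (simp add: row_def)
    moreover have "- (x * (a * b * c)) = - x * c * a * b" for a b c x :: complex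
      by (simp add: mult_ac)
    ultimately show "- (\<xi> j * row t j (p j)) = - \<xi> j * (1 / (l j + l (p j))) * E t j * E t (p j)"
      by (simp only:)
  qed
  also have "\<dots> = (\<Prod>j\<in>J. - \<xi> j * (1 / (l j + l (p j))) * E t j) * (\<Prod>j\<in>J. E t (p j))"
    by (rule prod.distrib)
  also have "(\<Prod>j\<in>J. E t (p j)) = (\<Prod>j\<in>J. E t j)"
    using prod.permute[OF p, of "\<lambda>j. E t j"] by (simp add: o_def)
  also have "(\<Prod>j\<in>J. - \<xi> j * (1 / (l j + l (p j))) * E t j) * (\<Prod>j\<in>J. E t j)
      = (\<Prod>j\<in>J. (- 1) * (\<xi> j * E (2 * t) j) * (1 / (l j + l (p j))))"
    unfolding prod.distrib[symmetric]
  proof (rule prod.cong[OF refl])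
    fix j
    have "- x * q * e * e = (- 1) * (x * (e * e)) * q" for x q e :: complex
      by (simp add: mult_ac)
    then show "- \<xi> j * (1 / (l j + l (p j))) * E t j * E t j = (- 1) * (\<xi> j * E (2 * t) j) * (1 / (l j + l (p j)))"
      by (simp only: mult_2 E_add)
  qed
  finally show "(\<Prod>j\<in>J. - (\<xi> j * row t j (p j)))
      = (\<Prod>j\<in>J. (- 1) * (\<xi> j * E (2 * t) j) * (1 / (l j + l (p j))))" .
qed

context
  fixes t :: real
  assumes t: "0 < t"
    and inv: "\<And>u. 0 < u \<Longrightarrow> invertible_operator seq_measure (\<lambda>\<alpha> j. \<alpha> j - R_op l \<xi> u \<alpha> j)"
begin

text \<open>Written with the scalar -1 so that it is literally the resolvent vector inside
  \<open>T_kernel\<close> at \<mu> = -1.\<close>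

definition w_sol :: "real \<Rightarrow> nat \<Rightarrow> complex" where
  "w_sol u = operator_inv seq_measure (\<lambda>\<alpha> j. \<alpha> j + (-1) * R_op l \<xi> u \<alpha> j) (input u)"

lemma inv': "0 < u \<Longrightarrow> invertible_operator seq_measure (\<lambda>\<alpha> j. \<alpha> j + (-1) * R_op l \<xi> u \<alpha> j)"
  using inv by simp

lemma w_sol:
  assumes u: "0 < u"
  shows "w_sol u \<in> L2 seq_measure" "defect u (w_sol u) j = input u j"
proof -
  note S = inverse_operator_inv[OF inv'[OF u]]
  have u0: "0 \<le> u" using u by simp
  note L2 = ell1_L2(1)[OF input_ell1[OF u0]]
  show "w_sol u \<in> L2 seq_measure"
    unfolding w_sol_def by (rule S_L2[OF u0 S L2])
  show "defect u (w_sol u) j = input u j"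
    using S_right[OF u0 S L2, of j] unfolding w_sol_def defect_def by simp
qed

lemma T_kernel_eq: "T_kernel l \<xi> (- 1) u u = C_op (semigroup_op l u (w_sol u))"
  unfolding T_kernel_def resolvent_vector_def w_sol_def by simp

text \<open>Each truncated determinant is the exponential of minus an integral of
  \<open>\<tau> n\<close>. The integrands converge to the diagonal kernel under one exponential
  majorant, which also yields integrability of the limit.\<close>

lemma determinant_limit:
  shows "set_integrable lebesgue {t<..} (\<lambda>u. T_kernel l \<xi> (- 1) u u)"
    and "(\<lambda>n. D n t) \<longlonglongrightarrow> exp (- (LINT u:{t<..}|lebesgue. T_kernel l \<xi> (- 1) u u))"
proof -
  obtain \<kappa> where below: "\<And>u. t \<le> u \<Longrightarrow> bounded_below \<kappa> u"
    using uniformly_bounded_below[OF t inv] by blast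
  have "(\<lambda>n. \<kappa> * (K' * tail n)) \<longlonglongrightarrow> \<kappa> * (K' * 0)"
    by (intro tendsto_mult_left tail_tendsto)
  then have "\<forall>\<^sub>F n in sequentially. \<kappa> * (K' * tail n) < 1 / 2"
    by (rule order_tendstoD) simp
  \<comment> \<open>Because \<kappa> is uniform for u \<ge> t, a single N makes all later
    truncations nonsingular on the whole interval at once.\<close>
  then obtain N where N: "\<And>n. N \<le> n \<Longrightarrow> \<kappa> * (K' * tail n) \<le> 1 / 2"
    unfolding eventually_sequentially by (auto intro: less_imp_le)
  have t0: "0 \<le> u" if "t \<le> u" for u using t that by simp
  have tp: "0 < u" if "t \<le> u" for u using t that by simp
  have nz: "D n u \<noteq> 0" if "N \<le> n" "t \<le> u" for n u
    by (rule D_nz[OF below[OF that(2)] t0[OF that(2)] w_sol[OF tp[OF that(2)]] N[OF that(1)]])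
  \<comment> \<open>The constants \<open>C\<close> and \<open>C'\<close> are built from \<kappa>,
    \<open>\<xi>_norm\<close> and K' only, hence are the same for all n \<ge> N and u \<ge>
    t.\<close>
  obtain C where C: "\<And>n u. N \<le> n \<Longrightarrow> t \<le> u \<Longrightarrow> cmod (\<tau> n u) \<le> C * exp (- \<delta> * u)"
    by (rule that, rule \<tau>_bound[OF below t0 w_sol(1)[OF tp] w_sol(2)[OF tp] N]) assumption+
  obtain C' where "\<And>n u. N \<le> n \<Longrightarrow> t \<le> u \<Longrightarrow>
      cmod (C_op (semigroup_op l u (w_sol u)) - \<tau> n u) \<le> tail n * C'"
    by (rule that, rule \<tau>_diff[OF below t0 w_sol(1)[OF tp] w_sol(2)[OF tp] N]) assumption+
  note C' = this[folded T_kernel_eq]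
  let ?f = "\<lambda>n s. indicator {t<..} s *\<^sub>R \<tau> (n + N) s"
  let ?g = "\<lambda>s. indicator {t<..} s *\<^sub>R T_kernel l \<xi> (- 1) s s"
  have cont: "continuous_on {t..} (\<tau> n)" if "N \<le> n" for n
    unfolding continuous_on_def by (intro ballI \<tau>_continuous nz that) simp
  have meas_f: "?f n \<in> borel_measurable lebesgue" for n
  proof (rule measurable_completion)
    have "continuous_on {t<..} (\<tau> (n + N))"
      by (rule continuous_on_subset[OF cont]) auto
    then show "?f n \<in> borel_measurable lborel"
      using borel_measurable_continuous_on_indicator[of "{t<..}" "\<tau> (n + N)"] by simp
  qed
  have lim: "(\<lambda>n. ?f n s) \<longlonglongrightarrow> ?g s" for s
  proof (cases "t < s")
    case True
    have "(\<lambda>n. tail (n + N) * C') \<longlonglongrightarrow> 0 * C'"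
      by (intro tendsto_mult_right LIMSEQ_ignore_initial_segment tail_tendsto)
    then have "(\<lambda>n. tail (n + N) * C') \<longlonglongrightarrow> 0" by (simp only: mult_zero_left)
    moreover have "norm (T_kernel l \<xi> (- 1) s s - \<tau> (n + N) s) \<le> tail (n + N) * C'" for n
      by (rule C'[OF le_add2 less_imp_le[OF True]])
    ultimately have "(\<lambda>n. T_kernel l \<xi> (- 1) s s - \<tau> (n + N) s) \<longlonglongrightarrow> 0"
      by (rule Lim_null_comparison[OF always_eventually[OF allI], rotated])
    then have "(\<lambda>n. T_kernel l \<xi> (- 1) s s - (T_kernel l \<xi> (- 1) s s - \<tau> (n + N) s)) \<longlonglongrightarrow> T_kernel l \<xi> (- 1) s s - 0"
      by (intro tendsto_diff tendsto_const)
    then show ?thesis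
      using True by (simp only: diff_diff_eq2 diff_zero add_diff_cancel_left' indicator_simps greaterThan_iff scaleR_one)
  next
    case False
    then have "indicator {t<..} s = (0::real)" by simp
    then show ?thesis by (simp only: scaleR_zero_left tendsto_const)
  qed
  have meas_g: "?g \<in> borel_measurable lebesgue"
    by (rule borel_measurable_LIMSEQ_metric[OF meas_f lim])
  have int_w: "integrable lebesgue (\<lambda>s. indicator {t<..} s *\<^sub>R (C * exp (- \<delta> * s)))"
    using set_integrable_mult_right[OF set_integrable_real_exp[OF \<delta>, of t], of C]
    by (simp add: set_integrable_def)
  have bound: "AE s in lebesgue. norm (?f n s) \<le> indicator {t<..} s *\<^sub>R (C * exp (- \<delta> * s))" for n
    using C[of "n + N"] by (intro AE_I2) (simp add: indicator_def)
  note DC = meas_g meas_f int_w AE_I2[OF lim] bound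
  have int_f: "set_integrable lebesgue {t<..} (\<tau> (n + N))" for n
    unfolding set_integrable_def by (rule integrable_dominated_convergence2[OF DC])
  show "set_integrable lebesgue {t<..} (\<lambda>u. T_kernel l \<xi> (- 1) u u)"
    unfolding set_integrable_def by (rule integrable_dominated_convergence[OF DC])
  have "(\<lambda>n. LINT s:{t<..}|lebesgue. \<tau> (n + N) s) \<longlonglongrightarrow> (LINT u:{t<..}|lebesgue. T_kernel l \<xi> (- 1) u u)"
    unfolding set_lebesgue_integral_def by (rule integral_dominated_convergence[OF DC])
  then have "(\<lambda>n. exp (- (LINT s:{t<..}|lebesgue. \<tau> (n + N) s)))
      \<longlonglongrightarrow> exp (- (LINT u:{t<..}|lebesgue. T_kernel l \<xi> (- 1) u u))"
    by (intro tendsto_exp tendsto_minus)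
  moreover have "exp (- (LINT s:{t<..}|lebesgue. \<tau> (n + N) s)) = D (n + N) t" for n
    by (rule exp_integral_log_derivative[symmetric, OF D_has_vector_derivative[OF nz] cont int_f D_tendsto_1]) auto
  ultimately have "(\<lambda>n. D (n + N) t) \<longlonglongrightarrow> exp (- (LINT u:{t<..}|lebesgue. T_kernel l \<xi> (- 1) u u))"
    by simp
  then show "(\<lambda>n. D n t) \<longlonglongrightarrow> exp (- (LINT u:{t<..}|lebesgue. T_kernel l \<xi> (- 1) u u))"
    by (rule LIMSEQ_offset)
qed

text \<open>\<open>has_fredholm_det\<close> stands for det (I + T), hence the negated operator. The
  basis-free minors over subsets of {..<n} add up to \<open>D n t\<close>, whose limit is
  known.\<close>

lemma hankel_determinant:
  "has_fredholm_det half_line (\<lambda>h x. - hankel_op (\<lambda>z. symbol_phi l \<xi> (z + 2 * t)) h x)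
    (exp (- (LINT u:{t<..}|lebesgue. T_kernel l \<xi> (- 1) u u)))"
proof -
  interpret H: nuclear_operator half_line "\<lambda>h x. (- 1) * hankel_op (\<lambda>z. symbol_phi l \<xi> (z + 2 * t)) h x"
    "\<lambda>j. (- 1) * (\<xi> j * E (2 * t) j)" "\<lambda>j s. E s j" "\<lambda>j s. cnj (E s j)" "max 1 (1 / sqrt (2 * \<delta>))"
    by (rule hankel_nuclear) (use t in simp)
  have "has_fredholm_det half_line (\<lambda>h x. (- 1) * hankel_op (\<lambda>z. symbol_phi l \<xi> (z + 2 * t)) h x)
    (exp (- (LINT u:{t<..}|lebesgue. T_kernel l \<xi> (- 1) u u)))"
  proof (rule H.has_fredholm_detI)
    fix X assume "(H.kernel_minor has_sum X) {J. finite J}"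
    then have "(\<lambda>n. \<Sum>J\<in>Pow {..<n}. H.kernel_minor J) \<longlonglongrightarrow> X"
      by (rule has_sum_finite_sets_tendsto)
    moreover have "(\<Sum>J\<in>Pow {..<n}. H.kernel_minor J) = D n t" for n
      unfolding H.kernel_minor_def row_0_inner D_minors ..
    ultimately have "(\<lambda>n. D n t) \<longlonglongrightarrow> X" by simp
    then show "X = exp (- (LINT u:{t<..}|lebesgue. T_kernel l \<xi> (- 1) u u))"
      using determinant_limit(2) by (rule LIMSEQ_unique)
  qed
  then show ?thesis by simp
qed

end

end

theorem theorem6p1:
  fixes l \<xi> :: "nat \<Rightarrow> complex" and \<delta> M :: real
  assumes Re_pos: "\<And>j. Re (l j) > 0"
    and indep: "exponentials_independent l"
    and Theta: "bounded_operator half_line seq_measure (Theta_op l)"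
    and constants_pos: "\<delta> > 0" "M > 0"
    and Re_ge: "\<And>j. Re (l j) \<ge> \<delta>"
    and summ: "\<And>j. summable (\<lambda>k. 1 / (cmod (l j + l k))\<^sup>2)"
    and sum_le: "\<And>j. (\<Sum>k. 1 / (cmod (l j + l k))\<^sup>2) \<le> M"
    and xi: "\<xi> \<in> ell1"
  shows
    \<comment> \<open>(i)\<close>
    "trace_class half_line (hankel_op (symbol_phi l \<xi>))
     \<comment> \<open>(ii): the operator \<open>R\<^sub>x\<close>\<close>
     \<and> (\<forall>x\<ge>0. trace_class seq_measure (R_op l \<xi> x) \<and>
          (\<forall>\<alpha>\<in>L2 seq_measure. (\<forall>s>x. semigroup_op l s \<alpha> \<in> ell1) \<longrightarrow>
             set_integrable lebesgue {x<..}
               (\<lambda>s. L2_norm seq_measure (semigroup_op l s (B_op \<xi> (C_op (semigroup_op l s \<alpha>))))) \<and>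
             (\<forall>j. set_integrable lebesgue {x<..}
                    (\<lambda>s. semigroup_op l s (B_op \<xi> (C_op (semigroup_op l s \<alpha>))) j) \<and>
                  R_op l \<xi> x \<alpha> j =
                    (LINT s:{x<..}|lebesgue. semigroup_op l s (B_op \<xi> (C_op (semigroup_op l s \<alpha>))) j))))
     \<comment> \<open>(ii): the integral equation\<close>
     \<and> (\<exists>U. open U \<and> 0 \<in> U \<and>
          (\<forall>\<mu>\<in>U. \<forall>x y. 0 < x \<and> x \<le> y \<longrightarrow>
             invertible_operator seq_measure (\<lambda>\<alpha> j. \<alpha> j + \<mu> * R_op l \<xi> x \<alpha> j) \<and>
             resolvent_vector l \<xi> \<mu> x y \<in> ell1 \<and>
             set_integrable lebesgue {x<..} (\<lambda>z. T_kernel l \<xi> \<mu> x z * symbol_phi l \<xi> (z + y)) \<and>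
             T_kernel l \<xi> \<mu> x y + \<mu> * symbol_phi l \<xi> (x + y)
               + \<mu> * (LINT z:{x<..}|lebesgue. T_kernel l \<xi> \<mu> x z * symbol_phi l \<xi> (z + y)) = 0))
     \<comment> \<open>(iii)\<close>
     \<and> ((\<forall>t>0. invertible_operator seq_measure (\<lambda>\<alpha> j. \<alpha> j - R_op l \<xi> t \<alpha> j)) \<longrightarrow>
          (\<forall>t>0.
             (\<forall>u>t. resolvent_vector l \<xi> (-1) u u \<in> ell1) \<and>
             set_integrable lebesgue {t<..} (\<lambda>u. T_kernel l \<xi> (-1) u u) \<and>
             has_fredholm_det half_line
               (\<lambda>h x. - hankel_op (\<lambda>z. symbol_phi l \<xi> (z + 2 * t)) h x)
               (exp (- (LINT u:{t<..}|lebesgue. T_kernel l \<xi> (-1) u u)))))"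
proof -
  obtain K where K: "0 \<le> K" "\<And>f. f \<in> L2 half_line \<Longrightarrow> L2_norm seq_measure (Theta_op l f) \<le> K * L2_norm half_line f"
    using bounded_operator_bound[OF Theta] by blast
  interpret linear_system l \<xi> \<delta> K
    by unfold_locales (use constants_pos Re_ge K bounded_operator_L2[OF Theta] xi in auto)
  \<comment> \<open>The parameters for which the Neumann iteration contracts, with the bound for R_x
    that holds for every x \<ge> 0.\<close>
  define U where "U = {\<mu> :: complex. cmod \<mu> * (\<xi>_norm * K') < 1}"
  have U: "open U" "0 \<in> U"
    unfolding U_def by (auto intro!: open_Collect_less continuous_intros)
  show ?thesis
  proof (intro conjI allI ballI impI exI[of _ U] U)
    show "trace_class half_line (hankel_op (symbol_phi l \<xi>))"
      by (rule hankel_trace_class)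
  next
    fix x :: real assume x: "0 \<le> x"
    show "trace_class seq_measure (R_op l \<xi> x)"
      by (rule R_op_trace_class[OF x])
    fix \<alpha> assume \<alpha>: "\<alpha> \<in> L2 seq_measure" and conv: "\<forall>s>x. semigroup_op l s \<alpha> \<in> ell1"
    then have conv': "\<And>s. x < s \<Longrightarrow> semigroup_op l s \<alpha> \<in> ell1" by blast
    show "set_integrable lebesgue {x<..}
        (\<lambda>s. L2_norm seq_measure (semigroup_op l s (B_op \<xi> (C_op (semigroup_op l s \<alpha>)))))"
      by (rule R_op_norm_integrable[OF x \<alpha> conv'])
    fix j
    show "set_integrable lebesgue {x<..} (\<lambda>s. semigroup_op l s (B_op \<xi> (C_op (semigroup_op l s \<alpha>))) j)"
      by (rule R_op_integrable[OF x \<alpha> conv'])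
    show "R_op l \<xi> x \<alpha> j = (LINT s:{x<..}|lebesgue. semigroup_op l s (B_op \<xi> (C_op (semigroup_op l s \<alpha>))) j)"
      by (rule R_op_integral[OF x \<alpha> conv'])
  next
    fix \<mu> and x y :: real assume \<mu>: "\<mu> \<in> U" and "0 < x \<and> x \<le> y"
    then have xy: "0 \<le> x" "0 \<le> y" by auto
    have inv: "invertible_operator seq_measure (\<lambda>\<alpha> j. \<alpha> j + \<mu> * R_op l \<xi> x \<alpha> j)"
      by (rule resolvent_exists[OF xy(1)]) (use \<mu> in \<open>simp add: U_def\<close>)
    then show "invertible_operator seq_measure (\<lambda>\<alpha> j. \<alpha> j + \<mu> * R_op l \<xi> x \<alpha> j)" .
    show "resolvent_vector l \<xi> \<mu> x y \<in> ell1"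
      by (rule resolvent_ell1[OF xy inv])
    show "set_integrable lebesgue {x<..} (\<lambda>z. T_kernel l \<xi> \<mu> x z * symbol_phi l \<xi> (z + y))"
      by (rule integral_equation(1)[OF xy inv])
    show "T_kernel l \<xi> \<mu> x y + \<mu> * symbol_phi l \<xi> (x + y)
        + \<mu> * (LINT z:{x<..}|lebesgue. T_kernel l \<xi> \<mu> x z * symbol_phi l \<xi> (z + y)) = 0"
      by (rule integral_equation(2)[OF xy inv])
  next
    fix t :: real assume "\<forall>t>0. invertible_operator seq_measure (\<lambda>\<alpha> j. \<alpha> j - R_op l \<xi> t \<alpha> j)" and t: "0 < t"
    then have inv: "\<And>u. 0 < u \<Longrightarrow> invertible_operator seq_measure (\<lambda>\<alpha> j. \<alpha> j - R_op l \<xi> u \<alpha> j)" by blast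
    show "resolvent_vector l \<xi> (- 1) u u \<in> ell1" if "t < u" for u
      by (rule resolvent_ell1) (use that t inv'[OF t inv, of u] in auto)
    show "set_integrable lebesgue {t<..} (\<lambda>u. T_kernel l \<xi> (- 1) u u)"
      by (rule determinant_limit(1)[OF t inv])
    show "has_fredholm_det half_line (\<lambda>h x. - hankel_op (\<lambda>z. symbol_phi l \<xi> (z + 2 * t)) h x)
        (exp (- (LINT u:{t<..}|lebesgue. T_kernel l \<xi> (- 1) u u)))"
      by (rule hankel_determinant[OF t inv])
  qed
qed

end
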